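(* Let $f$ be a transcendental meromorphic function and $g$ be an entire function such that $0<\lambda_f(p,q)\le\rho_f(p,q)<\infty$ and $\rho_g(m,n)<\infty$, where $p,q,m,n$ are positive integers with $p\ge q$ and $m\ge n$. Let $F=f^{\alpha}Q[f]$, where $Q[f]$ is a differential polynomial in $f$. Then for any integer $\alpha\ge 1$: (i) if $q\ge m$, $$\limsup_{r\to\infty}\frac{\log^{[p]}T_{f\circ g}\left(\exp^{[n-1]}r\right)}{\log^{[p-1]}T_F\left(\exp^{[q-1]}r\right)}\le\frac{\rho_g(m,n)}{\lambda_f(p,q)};$$ (ii) if $q<m$, $$\limsup_{r\to\infty}\frac{\log^{[p+m-q-1]}T_{f\circ g}\left(\exp^{[n-1]}r\right)}{\log^{[p-1]}T_F\left(\exp^{[q-1]}r\right)}\le\frac{\rho_g(m,n)}{\lambda_f(p,q)}.$$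
   Context: All functions are defined on the complex plane $\mathbb{C}$. Iterated exponentials and logarithms: $\exp^{[0]}x=\log^{[0]}x=x$, and for positive integers $k$, $\exp^{[k]}x=\exp(\exp^{[k-1]}x)$, $\log^{[k]}x=\log(\log^{[k-1]}x)$ (for $x$ large enough that this is defined). $T_h(r)$ is the Nevanlinna characteristic function of a meromorphic function $h$, and $M_g(r)=\max_{|z|=r}|g(z)|$ for an entire function $g$. For positive integers $p\ge q$, the $(p,q)$-th order of an entire function $g$ is $$\rho_g(p,q)=\limsup_{r\to\infty}\frac{\log^{[p]}M_g(r)}{\log^{[q]}r},$$ and the $(p,q)$-th order and $(p,q)$-th lower order of a meromorphic function $f$ are $$\rho_f(p,q)=\limsup_{r\to\infty}\frac{\log^{[p-1]}T_f(r)}{\log^{[q]}r},\qquad \lambda_f(p,q)=\liminf_{r\to\infty}\frac{\log^{[p-1]}T_f(r)}{\log^{[q]}r}.$$ A monomial generated by a transcendental meromorphic function $f$ is an expression $M[f]=f^{n_0}(f^{(1)})^{n_1}\cdots(f^{(k)})^{n_k}$ with non-negative integers $n_0,\dots,n_k$. A differential polynomial generated by (in) $f$ is an expression $Q[f]=a_1M_1[f]+\cdots+a_sM_s[f]$, where $M_1[f],\dots,M_s[f]$ are monomials in $f$ and $a_1,\dots,a_s$ are nonzero constants. *)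

theory Defs
  imports "HOL-Complex_Analysis.Complex_Analysis"
begin

text \<open>
  Meromorphic functions on the plane are functions \<^term>\<open>f :: complex \<Rightarrow> complex\<close> with
  \<^prop>\<open>f meromorphic_on UNIV\<close>. The values at the poles (and at other points of a sparse set)
  are arbitrary. The proximity and counting functions,
  hence the characteristic and the orders, do not see a change of values on a sparse set.
\<close>

definition rational_function :: "(complex \<Rightarrow> complex) \<Rightarrow> bool" where
  "rational_function f \<longleftrightarrow>
     (\<exists>A B :: complex poly. B \<noteq> 0 \<and> (\<forall>\<^sub>F z in cosparse UNIV. f z = poly A z / poly B z))"

definition transcendental_meromorphic :: "(complex \<Rightarrow> complex) \<Rightarrow> bool" where
  "transcendental_meromorphic f \<longleftrightarrow> f meromorphic_on UNIV \<and> \<not> rational_function f"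

definition log_plus :: "real \<Rightarrow> real" where
  "log_plus x = max 0 (ln x)"

definition proximity_fun :: "(complex \<Rightarrow> complex) \<Rightarrow> real \<Rightarrow> real" where
  "proximity_fun f r =
     1 / (2 * pi) * integral {0..2 * pi} (\<lambda>\<theta>. log_plus (norm (f (rcis r \<theta>))))"

text \<open>For meromorphic \<^term>\<open>f\<close> the index set is finite, and \<^term>\<open>- zorder f z\<close> is the
  multiplicity of the pole \<^term>\<open>z\<close>.\<close>

definition pole_count :: "(complex \<Rightarrow> complex) \<Rightarrow> real \<Rightarrow> nat" where
  "pole_count f t = (\<Sum>z | norm z \<le> t \<and> is_pole f z. nat (- zorder f z))"

definition counting_fun :: "(complex \<Rightarrow> complex) \<Rightarrow> real \<Rightarrow> real" where
  "counting_fun f r =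
     integral {0..r} (\<lambda>t. (real (pole_count f t) - real (pole_count f 0)) / t)
     + real (pole_count f 0) * ln r"

definition nevanlinna_char :: "(complex \<Rightarrow> complex) \<Rightarrow> real \<Rightarrow> real" where
  "nevanlinna_char f r = proximity_fun f r + counting_fun f r"

definition max_modulus :: "(complex \<Rightarrow> complex) \<Rightarrow> real \<Rightarrow> real" where
  "max_modulus g r = (SUP z\<in>sphere 0 r. norm (g z))"

text \<open>
  The iterated exponential and logarithm are \<^term>\<open>(exp ^^ k) x\<close> and \<^term>\<open>(ln ^^ k) x\<close>.
  The library function \<^term>\<open>ln :: real \<Rightarrow> real\<close> is total (with \<^prop>\<open>ln (0::real) = 0\<close> and
  \<^prop>\<open>ln (- x) = ln (x::real)\<close>). Iterated logarithms occur only inside limits as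
  \<^term>\<open>r\<close> tends to infinity.
\<close>

definition entire_order :: "(complex \<Rightarrow> complex) \<Rightarrow> nat \<Rightarrow> nat \<Rightarrow> ereal" where
  "entire_order g p q =
     Limsup at_top (\<lambda>r. ereal ((ln ^^ p) (max_modulus g r) / (ln ^^ q) r))"

definition meromorphic_order :: "(complex \<Rightarrow> complex) \<Rightarrow> nat \<Rightarrow> nat \<Rightarrow> ereal" where
  "meromorphic_order f p q =
     Limsup at_top (\<lambda>r. ereal ((ln ^^ (p - 1)) (nevanlinna_char f r) / (ln ^^ q) r))"

definition meromorphic_lower_order :: "(complex \<Rightarrow> complex) \<Rightarrow> nat \<Rightarrow> nat \<Rightarrow> ereal" where
  "meromorphic_lower_order f p q =
     Liminf at_top (\<lambda>r. ereal ((ln ^^ (p - 1)) (nevanlinna_char f r) / (ln ^^ q) r))"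

text \<open>A list of exponents $n_0, \dots, n_k$ encodes the monomial
  $f^{n_0} (f^{(1)})^{n_1} \cdots (f^{(k)})^{n_k}$.\<close>

definition diff_monomial :: "nat list \<Rightarrow> (complex \<Rightarrow> complex) \<Rightarrow> complex \<Rightarrow> complex" where
  "diff_monomial ns f z = (\<Prod>i<length ns. (deriv ^^ i) f z ^ (ns ! i))"

definition differential_polynomial_in ::
    "(complex \<Rightarrow> complex) \<Rightarrow> (complex \<Rightarrow> complex) \<Rightarrow> bool" where
  "differential_polynomial_in f Q \<longleftrightarrow>
     (\<exists>ts :: (complex \<times> nat list) list.
        ts \<noteq> [] \<and> (\<forall>(a, ns) \<in> set ts. a \<noteq> 0 \<and> ns \<noteq> []) \<and>
        Q = (\<lambda>z. \<Sum>(a, ns)\<leftarrow>ts. a * diff_monomial ns f z))"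

end

theory Submission
  imports Defs
begin

text \<open>
  Both \<^term>\<open>f \<circ> g\<close> and \<^term>\<open>F\<close> are compared with \<^term>\<open>f\<close> through the Poisson--Jensen
  inequality. Composing it with \<^term>\<open>g\<close> and averaging with Jensen's formula for $g - b$, $b$ a pole
  of $f$, gives $T_{f \circ g}(r) \le 36\, T_f(M_g(r)^3)$ for large $r$; the cube and the constant are
  invisible after taking logarithms. Conversely, where $|f| \le 1$ the identity
  $f^{-\alpha} = Q[f] / F$ bounds the proximity function of $1/f$ by that of $1/F$ and logarithms of
  $|f^{(i)}/f|$, and every zero of $f$ is a zero of $F$. So $T_f(r) \le 9\, T_F(8r) + O(\log T_f(32r))$,
  in which the error is negligible because $0 < \lambda_f(p,q) \le \rho_f(p,q) < \infty$ and $p \ge 2$.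
  The case $p = 1$ does not occur, since $T_f(r) / \log r \to \infty$ for transcendental $f$.

  Integrals of logarithmic derivatives are avoided: as constant factors in the radius are harmless,
  one can choose a circle far from all zeros and poles, on which $f^{(i)}/f$ is bounded pointwise.
\<close>

section \<open>Poisson's formula for logarithms\<close>

text \<open>The estimates for f o g and F are one-sided and lose constants deliberately: constant
  factors and dilations of r become additive constants after one logarithm, and p >= 2 guarantees
  that logarithm on the side of F. The bound for f o g takes one logarithm more than the order of f
  does, so the finite value rho_f(p,q) enters only as an additive constant. This is why the final
  quotient contains rho_g and lambda_f alone. In the composition estimate the means of -ln |g - b|
  are, up to constants, the negative counting functions of the b-points of g. They compensate the
  poles of f o g, and only a multiple of n(R, f) ln R is left, which N(R^2, f) dominates. The way
  from F back to f leads through 1/f because Q[f] must then be controlled only at zeros of f and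
  where |f| <= 1. At poles of f the terms of Q[f] may cancel, so the poles of F give no lower bound.
  Both assertions are instances of one inequality with d additional logarithms, d = 0 and d = m - q
  - 1.\<close>

definition circle_mean :: "(complex \<Rightarrow> real) \<Rightarrow> real \<Rightarrow> real" where
  "circle_mean \<phi> r = 1 / (2 * pi) * integral {0..2 * pi} (\<lambda>\<theta>. \<phi> (rcis r \<theta>))"

definition circle_integrable :: "(complex \<Rightarrow> real) \<Rightarrow> real \<Rightarrow> bool" where
  "circle_integrable \<phi> r \<longleftrightarrow> (\<lambda>\<theta>. \<phi> (rcis r \<theta>)) absolutely_integrable_on {0..2 * pi}"

definition poisson_kernel :: "real \<Rightarrow> complex \<Rightarrow> complex \<Rightarrow> real" where
  "poisson_kernel R w z = (R\<^sup>2 - (norm w)\<^sup>2) / (norm (z - w))\<^sup>2"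

lemma proximity_fun_eq: "proximity_fun f r = circle_mean (\<lambda>z. log_plus (norm (f z))) r"
  by (simp add: proximity_fun_def circle_mean_def)

lemma continuous_on_rcis [continuous_intros]: "continuous_on A (rcis r)"
  unfolding rcis_def by (intro continuous_intros)

text \<open>A fibre of \<open>rcis r\<close> lies in an arithmetic progression of step 2 pi, hence
  is countable. Every comparison on a circle may therefore ignore finitely many points.\<close>

lemma negligible_rcis_preimage:
  assumes "r > 0" "finite X"
  shows "negligible {\<theta>. rcis r \<theta> \<in> X}"
proof -
  have "countable {\<theta>. rcis r \<theta> = x}" for x
  proof (cases "\<exists>\<theta>0. rcis r \<theta>0 = x")
    case True
    then obtain t where t: "rcis r t = x" by blast
    have "{\<theta>. rcis r \<theta> = x} \<subseteq> range (\<lambda>n::int. t + 2 * pi * n)"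
    proof
      fix s assume "s \<in> {\<theta>. rcis r \<theta> = x}"
      then have "cis s = cis t" using t assms by (auto simp: rcis_def)
      then have "cos s = cos t \<and> sin s = sin t"
        by (metis cis.simps)
      then obtain n :: int where "s = t + 2 * pi * n"
        using sin_cos_eq_iff[of s t] by auto
      then show "s \<in> range (\<lambda>n::int. t + 2 * pi * n)" by auto
    qed
    then show ?thesis by (rule countable_subset) auto
  next
    case False
    then have "{\<theta>. rcis r \<theta> = x} = {}" by auto
    then show ?thesis by (metis countable_empty)
  qed
  then have "countable (\<Union>x\<in>X. {\<theta>. rcis r \<theta> = x})"
    using assms countable_finite by (intro countable_UN) auto
  then have "negligible (\<Union>((\<lambda>t. {t}) ` (\<Union>x\<in>X. {\<theta>. rcis r \<theta> = x})))"
    by (intro negligible_countable_Union) auto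
  moreover have "\<Union>((\<lambda>t. {t}) ` (\<Union>x\<in>X. {\<theta>. rcis r \<theta> = x})) = {\<theta>. rcis r \<theta> \<in> X}" by auto
  ultimately show ?thesis by simp
qed

lemma circle_integrable_continuous:
  assumes "continuous_on (sphere 0 r) \<phi>" "r \<ge> 0"
  shows "circle_integrable \<phi> r"
  unfolding circle_integrable_def
  by (intro absolutely_integrable_continuous_real continuous_on_compose2[OF assms(1)]
      continuous_intros) (use assms in auto)

lemma circle_mean_cong_finite:
  assumes "r > 0" "finite X" "\<And>z. norm z = r \<Longrightarrow> z \<notin> X \<Longrightarrow> \<phi> z = \<psi> z"
  shows "circle_mean \<phi> r = circle_mean \<psi> r"
proof -
  have "integral {0..2*pi} (\<lambda>\<theta>. \<phi> (rcis r \<theta>)) = integral {0..2*pi} (\<lambda>\<theta>. \<psi> (rcis r \<theta>))"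
    by (rule integral_spike[OF negligible_rcis_preimage[OF assms(1,2)]]) (use assms in auto)
  then show ?thesis by (simp add: circle_mean_def)
qed

lemma circle_integrable_cong_finite:
  assumes "r > 0" "finite X" "\<And>z. norm z = r \<Longrightarrow> z \<notin> X \<Longrightarrow> \<phi> z = \<psi> z"
  shows "circle_integrable \<phi> r \<longleftrightarrow> circle_integrable \<psi> r"
  unfolding circle_integrable_def
proof
  show "(\<lambda>\<theta>. \<psi> (rcis r \<theta>)) absolutely_integrable_on {0..2 * pi}"
    if "(\<lambda>\<theta>. \<phi> (rcis r \<theta>)) absolutely_integrable_on {0..2 * pi}"
    using that
    by (rule absolutely_integrable_spike[OF _ negligible_rcis_preimage[OF assms(1,2)]])
      (use assms in auto)
  show "(\<lambda>\<theta>. \<phi> (rcis r \<theta>)) absolutely_integrable_on {0..2 * pi}"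
    if "(\<lambda>\<theta>. \<psi> (rcis r \<theta>)) absolutely_integrable_on {0..2 * pi}"
    using that
    by (rule absolutely_integrable_spike[OF _ negligible_rcis_preimage[OF assms(1,2)]])
      (use assms in auto)
qed

lemma circle_integrable_imp:
  "circle_integrable \<phi> r \<Longrightarrow> (\<lambda>\<theta>. \<phi> (rcis r \<theta>)) integrable_on {0..2 * pi}"
  unfolding circle_integrable_def using set_lebesgue_integral_eq_integral(1) by blast

lemma circle_mean_const [simp]: "circle_mean (\<lambda>_. c) r = c"
  by (simp add: circle_mean_def)

lemma circle_integrable_const [simp]: "circle_integrable (\<lambda>_. c) r"
  by (simp add: circle_integrable_def)

lemma circle_integrable_add:
  assumes "circle_integrable \<phi> r" "circle_integrable \<psi> r"
  shows "circle_integrable (\<lambda>z. \<phi> z + \<psi> z) r"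
  using assms unfolding circle_integrable_def by (rule set_integral_add(1))

lemma circle_mean_add:
  assumes "circle_integrable \<phi> r" "circle_integrable \<psi> r"
  shows "circle_mean (\<lambda>z. \<phi> z + \<psi> z) r = circle_mean \<phi> r + circle_mean \<psi> r"
  using assms[THEN circle_integrable_imp]
  by (simp add: circle_mean_def integral_add ring_distribs)

lemma circle_integrable_cmult:
  assumes "circle_integrable \<phi> r"
  shows "circle_integrable (\<lambda>z. c * \<phi> z) r"
  using assms unfolding circle_integrable_def by (rule set_integrable_mult_right)

lemma circle_mean_cmult: "circle_mean (\<lambda>z. c * \<phi> z) r = c * circle_mean \<phi> r"
  by (simp add: circle_mean_def)

lemma circle_integrable_sum:
  assumes "\<And>a. a \<in> A \<Longrightarrow> circle_integrable (\<phi> a) r"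
  shows "circle_integrable (\<lambda>z. \<Sum>a\<in>A. \<phi> a z) r"
  using assms by (induction A rule: infinite_finite_induct) (auto intro: circle_integrable_add)

lemma circle_mean_sum:
  assumes "\<And>a. a \<in> A \<Longrightarrow> circle_integrable (\<phi> a) r"
  shows "circle_mean (\<lambda>z. \<Sum>a\<in>A. \<phi> a z) r = (\<Sum>a\<in>A. circle_mean (\<phi> a) r)"
  using assms
  by (induction A rule: infinite_finite_induct)
    (auto simp: circle_mean_add circle_integrable_sum)

lemma circle_mean_mono_finite:
  assumes "r > 0" "finite X" "circle_integrable \<phi> r" "circle_integrable \<psi> r"
    and "\<And>z. norm z = r \<Longrightarrow> z \<notin> X \<Longrightarrow> \<phi> z \<le> \<psi> z"
  shows "circle_mean \<phi> r \<le> circle_mean \<psi> r"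
proof -
  \<comment> \<open>Replacing \<open>\<phi>\<close> by \<open>\<psi>\<close> on the finite set makes
    the inequality hold everywhere without changing the mean.\<close>
  define \<phi>' where "\<phi>' = (\<lambda>z. if z \<in> X then \<psi> z else \<phi> z)"
  have eq: "circle_mean \<phi> r = circle_mean \<phi>' r"
    by (rule circle_mean_cong_finite[OF assms(1,2)]) (auto simp: \<phi>'_def)
  have int: "circle_integrable \<phi>' r"
    using assms(3) circle_integrable_cong_finite[OF assms(1,2), of \<phi> \<phi>']
    by (auto simp: \<phi>'_def)
  have "integral {0..2*pi} (\<lambda>\<theta>. \<phi>' (rcis r \<theta>)) \<le> integral {0..2*pi} (\<lambda>\<theta>. \<psi> (rcis r \<theta>))"
    by (rule integral_le[OF int[THEN circle_integrable_imp] assms(4)[THEN circle_integrable_imp]])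
      (use assms in \<open>auto simp: \<phi>'_def\<close>)
  then show ?thesis unfolding eq by (simp add: circle_mean_def divide_right_mono)
qed

text \<open>A non-integrable function has integral 0 by convention, so the sign is right in that
  case too and \<open>proximity_nonneg\<close> holds for every function.\<close>

lemma circle_mean_nonneg:
  assumes "\<And>z. norm z = \<bar>r\<bar> \<Longrightarrow> \<phi> z \<ge> 0"
  shows "circle_mean \<phi> r \<ge> 0"
proof (cases "(\<lambda>\<theta>. \<phi> (rcis r \<theta>)) integrable_on {0..2 * pi}")
  case True
  then show ?thesis unfolding circle_mean_def
    by (intro mult_nonneg_nonneg integral_nonneg) (use assms in auto)
next
  case False
  then show ?thesis by (simp add: circle_mean_def not_integrable_integral)
qed

lemma circle_integrable_max_0:
  assumes "circle_integrable \<phi> r"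
  shows "circle_integrable (\<lambda>z. max 0 (\<phi> z)) r"
  using assms unfolding circle_integrable_def
  by (intro absolutely_integrable_max_1) auto

lemma circle_integrable_mult_continuous:
  assumes "circle_integrable \<phi> r" "continuous_on (sphere 0 r) \<psi>" "r > 0"
  shows "circle_integrable (\<lambda>z. \<psi> z * \<phi> z) r"
  unfolding circle_integrable_def
proof (rule absolutely_integrable_bounded_measurable_product_real)
  have c: "continuous_on {0..2*pi} (\<lambda>\<theta>. \<psi> (rcis r \<theta>))"
    by (intro continuous_on_compose2[OF assms(2)] continuous_intros) (use assms in auto)
  then show "(\<lambda>\<theta>. \<psi> (rcis r \<theta>)) \<in> borel_measurable (lebesgue_on {0..2 * pi})"
    by (intro continuous_imp_measurable_on_sets_lebesgue) auto
  show "bounded ((\<lambda>\<theta>. \<psi> (rcis r \<theta>)) ` {0..2 * pi})"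
    by (intro compact_imp_bounded compact_continuous_image c) auto
  show "(\<lambda>\<theta>. \<phi> (rcis r \<theta>)) absolutely_integrable_on {0..2 * pi}"
    using assms(1) by (simp add: circle_integrable_def)
qed auto

section \<open>The Poisson kernel and Poisson's formula for linear factors\<close>

lemma continuous_on_poisson_kernel:
  assumes "norm w < R"
  shows "continuous_on (sphere 0 R) (poisson_kernel R w)"
  unfolding poisson_kernel_def by (intro continuous_intros) (use assms in auto)

lemma poisson_kernel_0 [simp]: "norm z = R \<Longrightarrow> R > 0 \<Longrightarrow> poisson_kernel R 0 z = 1"
  by (simp add: poisson_kernel_def)

lemma poisson_kernel_nonneg: "norm w < R \<Longrightarrow> poisson_kernel R w z \<ge> 0"
  by (auto simp: poisson_kernel_def intro!: divide_nonneg_nonneg power_mono)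

text \<open>The kernel is at most (R + |w|) / (R - |w|), which equals 3 at |w| = R / 2. This is the
  source of the factor 3 in the comparisons of characteristics below.\<close>

lemma poisson_kernel_le_3:
  assumes "norm z = R" "norm w \<le> R / 2" "R > 0"
  shows "poisson_kernel R w z \<le> 3"
proof -
  have "norm (z - w) \<ge> R - norm w" using assms norm_triangle_ineq2[of z w] by simp
  then have "(norm (z - w))\<^sup>2 \<ge> (R - norm w)\<^sup>2" using assms by (intro power_mono) auto
  then have "3 * (norm (z - w))\<^sup>2 \<ge> 3 * (R - norm w)\<^sup>2" by simp
  moreover have "3 * (R - norm w)\<^sup>2 - (R\<^sup>2 - (norm w)\<^sup>2) = 2 * (R - norm w) * (R - 2 * norm w)"
    by (simp add: power2_eq_square algebra_simps)
  moreover have "2 * (R - norm w) * (R - 2 * norm w) \<ge> 0"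
    using assms by (intro mult_nonneg_nonneg) auto
  moreover have "norm (z - w) > 0" using assms by auto
  ultimately show ?thesis unfolding poisson_kernel_def by (simp add: divide_le_eq)
qed

text \<open>The zero of this linear factor is the reflection of a in the circle of radius R, at
  distance R^2 / |a| from the origin.\<close>

lemma reflection_nonzero:
  assumes "norm a * norm z < R * R"
  shows "complex_of_real (R\<^sup>2) - cnj a * z \<noteq> 0"
proof
  assume "complex_of_real (R\<^sup>2) - cnj a * z = 0"
  then have "norm (complex_of_real (R\<^sup>2)) = norm a * norm z"
    by (metis eq_iff_diff_eq_0 norm_mult complex_mod_cnj)
  then show False using assms by (simp add: power2_eq_square norm_mult)
qed

text \<open>Cauchy's formula is applied to u times (R^2 - |w|^2) / (R^2 - cnj w z). The extra factor
  is 1 at z = w, and on the circle, where R^2 = z cnj z, it turns the Cauchy kernel into the Poisson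
  kernel.\<close>

lemma poisson_formula_analytic:
  assumes u: "u analytic_on cball 0 R" and w: "norm w < R"
  shows "circle_mean (\<lambda>z. poisson_kernel R w z * Re (u z)) R = Re (u w)"
proof -
  have R: "R > 0" using w norm_ge_zero[of w] by linarith
  define v where "v = (\<lambda>z. u z * of_real (R\<^sup>2 - (norm w)\<^sup>2) / (of_real (R\<^sup>2) - cnj w * z))"
  have nz: "of_real (R\<^sup>2) - cnj w * z \<noteq> 0" if "norm z \<le> R" for z
  proof -
    have "norm w * norm z \<le> norm w * R" using that by (intro mult_left_mono) auto
    also have "\<dots> < R * R" using w R by (intro mult_strict_right_mono)
    finally show ?thesis by (rule reflection_nonzero)
  qed
  have "v holomorphic_on cball 0 R"
    unfolding v_def using analytic_imp_holomorphic[OF u] nz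
    by (intro holomorphic_intros) auto
  then have "((\<lambda>z. v z / (z - w)) has_contour_integral (2 * of_real pi * \<i> * v w)) (circlepath 0 R)"
    using w by (intro Cauchy_integral_circlepath_simple) auto
  then have I: "((\<lambda>t. v (0 + R * cis t) / (0 + R * cis t - w) * R * \<i> * cis t) has_integral (2 * of_real pi * \<i> * v w)) {0..2*pi}"
    unfolding circlepath_def by (subst (asm) has_contour_integral_part_circlepath_iff) auto
  have vw: "v w = u w"
  proof -
    have "complex_of_real (R\<^sup>2) - cnj w * w = of_real (R\<^sup>2 - (norm w)\<^sup>2)"
      using complex_norm_square[of w] by (simp add: mult.commute)
    then show ?thesis using nz[of w] w unfolding v_def by simp
  qed
  have eq: "v (0 + R * cis t) / (0 + R * cis t - w) * R * \<i> * cis t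
      = \<i> * (of_real (poisson_kernel R w (rcis R t)) * u (rcis R t))" for t
  proof -
    let ?z = "rcis R t"
    have gen: "x * K / (b * a) / c * \<i> * a = \<i> * (K / (b * c) * x)" if "a \<noteq> 0" "b \<noteq> 0" "c \<noteq> 0" for a b c x K :: complex
      using that by (simp add: field_simps)
    have z: "norm ?z = R" using R by simp
    have zw: "?z \<noteq> w" using z w by auto
    have R2: "complex_of_real (R\<^sup>2) = cnj ?z * ?z"
      by (metis complex_norm_square mult.commute z)
    have d: "of_real (R\<^sup>2) - cnj w * ?z = cnj (?z - w) * ?z"
      unfolding R2 by (simp add: algebra_simps)
    have n2: "complex_of_real ((norm (?z - w))\<^sup>2) = cnj (?z - w) * (?z - w)"
      by (metis complex_norm_square mult.commute)
    have zn: "?z \<noteq> 0" using z R by auto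
    have "v (0 + R * cis t) / (0 + R * cis t - w) * R * \<i> * cis t = v ?z / (?z - w) * \<i> * ?z"
      by (simp add: rcis_def)
    also have "\<dots> = \<i> * (of_real (R\<^sup>2 - (norm w)\<^sup>2) / of_real ((norm (?z - w))\<^sup>2) * u ?z)"
      unfolding v_def d n2 using zn zw gen[of ?z "cnj (?z - w)" "?z - w"] by (simp del: complex_cnj_diff)
    finally show ?thesis by (simp add: poisson_kernel_def)
  qed
  have "((\<lambda>t. \<i> * (of_real (poisson_kernel R w (rcis R t)) * u (rcis R t))) has_integral (2 * of_real pi * \<i> * u w)) {0..2*pi}"
    using I unfolding eq vw .
  from has_integral_mult_right[OF this, of "-\<i>"]
  have "((\<lambda>t. of_real (poisson_kernel R w (rcis R t)) * u (rcis R t)) has_integral (2 * of_real pi * u w)) {0..2*pi}"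
    by (simp add: algebra_simps)
  from has_integral_Re[OF this]
  have "((\<lambda>t. poisson_kernel R w (rcis R t) * Re (u (rcis R t))) has_integral (2 * pi * Re (u w))) {0..2*pi}"
    by simp
  then show ?thesis unfolding circle_mean_def by (simp add: integral_unique)
qed

lemma nonvanishing_analytic_ball:
  assumes "k analytic_on cball 0 R" "\<And>z. norm z \<le> R \<Longrightarrow> k z \<noteq> 0"
  obtains g where "g analytic_on cball 0 R" "\<And>z. norm z \<le> R \<Longrightarrow> k z = exp (g z)"
proof -
  obtain U where U: "open U" "cball 0 R \<subseteq> U" "k holomorphic_on U"
    using assms(1) analytic_on_holomorphic by metis
  define V where "V = {z\<in>U. k z \<noteq> 0}"
  have "continuous_on U k" using U holomorphic_on_imp_continuous_on by blast
  then have "open (U \<inter> k -` (-{0}))"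
    using U(1) by (rule continuous_open_preimage) auto
  moreover have "U \<inter> k -` (-{0}) = V" by (auto simp: V_def)
  ultimately have "open V" by metis
  moreover have "cball 0 R \<subseteq> V" using U assms(2) by (auto simp: V_def)
  ultimately obtain e where e: "e > 0" "(\<Union>x\<in>cball 0 R. ball x e) \<subseteq> V"
    using compact_subset_open_imp_ball_epsilon_subset[of "cball 0 R" V] by auto
  \<comment> \<open>A holomorphic logarithm needs a contractible open set around the closed disc
    without zeros of k. The sum of the disc and a small ball is convex, and compactness puts it
    inside \<open>V\<close>.\<close>
  define W where "W = (\<Union>x\<in>cball (0::complex) R. \<Union>y\<in>ball 0 e. {x + y})"
  have cW: "convex W" unfolding W_def by (intro convex_sums) auto
  have "W = (\<Union>x\<in>cball 0 R. ball x e)"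
  proof -
    have "(\<Union>y\<in>ball 0 e. {x + y}) = ball x e" for x :: complex
    proof -
      have "z \<in> (\<Union>y\<in>ball 0 e. {x + y})" if "z \<in> ball x e" for z
        using that by (intro UN_I[of "z - x"]) (auto simp: dist_norm norm_minus_commute)
      then show ?thesis by (auto simp: dist_norm)
    qed
    then show ?thesis by (auto simp: W_def)
  qed
  then have W: "open W" "W \<subseteq> V" "cball 0 R \<subseteq> W" using e by auto
  have "k holomorphic_on W" using U W by (auto simp: V_def intro: holomorphic_on_subset)
  moreover have "\<And>z. z \<in> W \<Longrightarrow> k z \<noteq> 0" using W by (auto simp: V_def)
  ultimately obtain g where "g holomorphic_on W" "\<And>z. z \<in> W \<Longrightarrow> k z = exp (g z)"
    using contractible_imp_holomorphic_log[of k W] convex_imp_contractible[OF cW] by metis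
  with W show ?thesis
    by (intro that[of g]) (auto simp: analytic_on_holomorphic)
qed

lemma poisson_ln_nonvanishing:
  assumes "k analytic_on cball 0 R" "\<And>z. norm z \<le> R \<Longrightarrow> k z \<noteq> 0" "norm w < R"
  shows "circle_integrable (\<lambda>z. ln (norm (k z))) R"
    "circle_mean (\<lambda>z. poisson_kernel R w z * ln (norm (k z))) R = ln (norm (k w))"
proof -
  have R: "R > 0" using assms(3) norm_ge_zero[of w] by linarith
  obtain g where g: "g analytic_on cball 0 R" "\<And>z. norm z \<le> R \<Longrightarrow> k z = exp (g z)"
    using nonvanishing_analytic_ball[OF assms(1,2)] by metis
  have eq: "ln (norm (k z)) = Re (g z)" if "norm z \<le> R" for z using g(2)[OF that] by simp
  have "circle_mean (\<lambda>z. poisson_kernel R w z * ln (norm (k z))) R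
      = circle_mean (\<lambda>z. poisson_kernel R w z * Re (g z)) R"
    by (rule circle_mean_cong_finite[OF R finite.emptyI]) (simp add: eq)
  then show "circle_mean (\<lambda>z. poisson_kernel R w z * ln (norm (k z))) R = ln (norm (k w))"
    using poisson_formula_analytic[OF g(1) assms(3)] eq[of w] assms(3) by simp
  have "continuous_on (sphere 0 R) (\<lambda>z. ln (norm (k z)))"
    using assms R
    by (intro continuous_intros holomorphic_on_imp_continuous_on
        holomorphic_on_subset[OF analytic_imp_holomorphic[OF assms(1)]]) auto
  then show "circle_integrable (\<lambda>z. ln (norm (k z))) R"
    using R by (intro circle_integrable_continuous) auto
qed

text \<open>On the circle R^2 = z cnj z. So there |z - a| can be replaced by the modulus of a factor
  that has no zero inside the disc.\<close>

lemma norm_reflect_eq: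
  assumes "norm z = R" "R > 0"
  shows "norm (of_real (R\<^sup>2) - cnj a * z) / R = norm (z - a)"
proof -
  have "complex_of_real (R\<^sup>2) = cnj z * z"
    by (metis complex_norm_square mult.commute assms(1))
  then have "of_real (R\<^sup>2) - cnj a * z = cnj (z - a) * z" by (simp add: algebra_simps)
  then show ?thesis using assms by (simp add: norm_mult del: complex_cnj_diff)
qed

text \<open>
  For \<^term>\<open>a\<close> on the circle, the points \<^term>\<open>c n * a\<close> with \<^term>\<open>c n\<close> decreasing to 1 lie outside, and
  the logarithms converge monotonically.
\<close>

lemma poisson_ln_boundary:
  assumes a: "norm a = R" and w: "norm w < R"
  shows "circle_mean (\<lambda>z. poisson_kernel R w z * ln (norm (z - a))) R = ln (norm (w - a))"
    "(\<lambda>\<theta>. poisson_kernel R w (rcis R \<theta>) * ln (norm (rcis R \<theta> - a))) integrable_on {0..2*pi}"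
proof -
  have R: "R > 0" using w norm_ge_zero[of w] by linarith
  define c where "c = (\<lambda>n::nat. 1 + 1 / (real n + 1))"
  have c1: "c n > 1" for n by (simp add: c_def)
  have clim: "c \<longlonglongrightarrow> 1"
  proof -
    have "(\<lambda>n. 1 + 1 / real (Suc n)) \<longlonglongrightarrow> 1 + 0"
      by (intro tendsto_intros lim_1_over_n[THEN LIMSEQ_Suc])
    then show ?thesis by (simp add: c_def add.commute)
  qed
  have cdec: "c (Suc n) \<le> c n" for n by (simp add: c_def frac_le)
  have far: "norm (of_real (c n) * a) > R" for n using a c1[of n] R by (simp add: norm_mult)
  have k: "(\<lambda>z. z - of_real (c n) * a) analytic_on cball 0 R" "\<And>z. norm z \<le> R \<Longrightarrow> z - of_real (c n) * a \<noteq> 0" for n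
    using far[of n] by (auto intro!: analytic_intros)
  \<comment> \<open>At the single point z = a the value is set to 0. There the sequence is then
    constant and its limit agrees with \<open>G\<close>, since ln 0 = 0.\<close>
  define F where "F = (\<lambda>n \<theta>. poisson_kernel R w (rcis R \<theta>) *
     (if rcis R \<theta> = a then 0 else ln (norm (rcis R \<theta> - of_real (c n) * a))))"
  define G where "G = (\<lambda>\<theta>. poisson_kernel R w (rcis R \<theta>) * ln (norm (rcis R \<theta> - a)))"
  \<comment> \<open>For |z| = |a| = R the squared distance from z to t a is R^2 + t^2 R^2 - 2 t Re
    (z cnj a). It increases for t >= 1 because Re (z cnj a) <= R^2.\<close>
  have mono: "norm (z - of_real s * a) \<le> norm (z - of_real t * a)"
    if "norm z = R" "1 \<le> s" "s \<le> t" for z s t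
  proof -
    have e: "(norm (z - of_real t * a))\<^sup>2 = R\<^sup>2 + t\<^sup>2 * R\<^sup>2 - 2 * t * Re (z * cnj a)" for t
    proof -
      have "(norm z)\<^sup>2 = R\<^sup>2" "(norm a)\<^sup>2 = R\<^sup>2" using that a by auto
      then have "R\<^sup>2 + t\<^sup>2 * R\<^sup>2 = (norm z)\<^sup>2 + t\<^sup>2 * (norm a)\<^sup>2" by simp
      then show ?thesis unfolding cmod_power2 by (simp add: power2_eq_square algebra_simps)
    qed
    have "Re (z * cnj a) \<le> norm (z * cnj a)" by (rule complex_Re_le_cmod)
    then have le: "Re (z * cnj a) \<le> R\<^sup>2" using that a by (simp add: norm_mult power2_eq_square)
    have "(t\<^sup>2 * R\<^sup>2 - 2 * t * Re (z * cnj a)) - (s\<^sup>2 * R\<^sup>2 - 2 * s * Re (z * cnj a))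
        = (t - s) * ((t + s) * R\<^sup>2 - 2 * Re (z * cnj a))" by (simp add: power2_eq_square algebra_simps)
    moreover have "(t + s) * R\<^sup>2 \<ge> 2 * R\<^sup>2" using that by (intro mult_right_mono) auto
    ultimately have "(t\<^sup>2 * R\<^sup>2 - 2 * t * Re (z * cnj a)) - (s\<^sup>2 * R\<^sup>2 - 2 * s * Re (z * cnj a)) \<ge> 0"
      using that le by simp
    then have "(norm (z - of_real s * a))\<^sup>2 \<le> (norm (z - of_real t * a))\<^sup>2" unfolding e by simp
    then show ?thesis by (rule power2_le_imp_le) auto
  qed
  have neg: "negligible {\<theta>. rcis R \<theta> \<in> {a}}" by (rule negligible_rcis_preimage[OF R]) auto
  define H where "H = (\<lambda>n \<theta>. poisson_kernel R w (rcis R \<theta>) * ln (norm (rcis R \<theta> - of_real (c n) * a)))"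
  have Hint: "H n integrable_on {0..2*pi}" for n
    unfolding H_def
    by (rule circle_integrable_imp[OF circle_integrable_mult_continuous
         [OF poisson_ln_nonvanishing(1)[OF k w] continuous_on_poisson_kernel[OF w] R]])
  have Hval: "integral {0..2*pi} (H n) = 2 * pi * ln (norm (w - of_real (c n) * a))" for n
    using poisson_ln_nonvanishing(2)[OF k w] pi_gt_zero
    by (simp add: circle_mean_def H_def field_simps)
  have Fint: "F n integrable_on {0..2*pi}" for n
    by (rule integrable_spike[OF Hint neg]) (auto simp: F_def H_def)
  have Fval: "integral {0..2*pi} (F n) = 2 * pi * ln (norm (w - of_real (c n) * a))" for n
    unfolding Hval[symmetric] by (rule integral_spike[OF neg]) (auto simp: F_def H_def)
  have wa: "w \<noteq> a" using w a by auto
  have lim: "(\<lambda>n. 2 * pi * ln (norm (w - of_real (c n) * a))) \<longlonglongrightarrow> 2 * pi * ln (norm (w - of_real 1 * a))"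
    by (intro tendsto_intros clim) (use wa in auto)
  have "G integrable_on {0..2*pi} \<and> (\<lambda>n. integral {0..2*pi} (F n)) \<longlonglongrightarrow> integral {0..2*pi} G"
  proof (rule monotone_convergence_decreasing)
    show "F n integrable_on {0..2*pi}" for n by (rule Fint)
    show "F (Suc n) x \<le> F n x" if "x \<in> {0..2*pi}" for n x
    proof (cases "rcis R x = a")
      case False
      then have "norm (rcis R x - of_real 1 * a) \<le> norm (rcis R x - of_real (c (Suc n)) * a)"
        using c1[of "Suc n"] R by (intro mono) auto
      then have "ln (norm (rcis R x - of_real (c (Suc n)) * a)) \<le> ln (norm (rcis R x - of_real (c n) * a))"
        using False mono[of "rcis R x" "c (Suc n)" "c n"] c1[of "Suc n"] cdec[of n] R
        by (subst ln_le_cancel_iff) (auto intro: less_le_trans)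
      then show ?thesis using False poisson_kernel_nonneg[OF w] by (auto simp: F_def intro: mult_left_mono)
    qed (simp add: F_def)
    show "(\<lambda>n. F n x) \<longlonglongrightarrow> G x" if "x \<in> {0..2*pi}" for x
    proof (cases "rcis R x = a")
      case False
      have "(\<lambda>n. poisson_kernel R w (rcis R x) * ln (norm (rcis R x - of_real (c n) * a)))
         \<longlonglongrightarrow> poisson_kernel R w (rcis R x) * ln (norm (rcis R x - of_real 1 * a))"
        by (intro tendsto_intros clim) (use False in auto)
      then show ?thesis using False by (simp add: F_def G_def)
    qed (simp add: F_def G_def)
    show "bounded (range (\<lambda>n. integral {0..2*pi} (F n)))"
      unfolding Fval using lim by (rule convergent_imp_bounded)
  qed
  then have "G integrable_on {0..2*pi}" "integral {0..2*pi} G = 2 * pi * ln (norm (w - a))"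
    using LIMSEQ_unique[OF lim] unfolding Fval by auto
  then show "circle_mean (\<lambda>z. poisson_kernel R w z * ln (norm (z - a))) R = ln (norm (w - a))"
    "(\<lambda>\<theta>. poisson_kernel R w (rcis R \<theta>) * ln (norm (rcis R \<theta> - a))) integrable_on {0..2*pi}"
    unfolding circle_mean_def G_def by auto
qed

text \<open>The kernel is 1 for w = 0, so \<open>poisson_ln_boundary\<close> gives plain
  integrability. Since ln |z - a| is bounded above, a constant minus it is nonnegative, and
  nonnegative integrable functions are absolutely integrable.\<close>

lemma circle_integrable_ln_boundary:
  assumes a: "norm a = R" and R: "R > 0"
  shows "circle_integrable (\<lambda>z. ln (norm (z - a))) R"
proof -
  define C where "C = max 0 (ln (2 * R))"
  have "(\<lambda>\<theta>. poisson_kernel R 0 (rcis R \<theta>) * ln (norm (rcis R \<theta> - a))) integrable_on {0..2*pi}"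
    using poisson_ln_boundary(2)[OF a, of 0] R by simp
  then have i: "(\<lambda>\<theta>. ln (norm (rcis R \<theta> - a))) integrable_on {0..2*pi}" using R by simp
  have "(\<lambda>\<theta>. C - ln (norm (rcis R \<theta> - a))) absolutely_integrable_on {0..2*pi}"
  proof (rule nonnegative_absolutely_integrable_1)
    show "(\<lambda>\<theta>. C - ln (norm (rcis R \<theta> - a))) integrable_on {0..2*pi}"
      by (intro integrable_diff i) auto
    show "0 \<le> C - ln (norm (rcis R x - a))" for x
    proof (cases "rcis R x = a")
      case False
      have "norm (rcis R x - a) \<le> 2 * R" using norm_triangle_ineq4[of "rcis R x" a] a R by simp
      then have "ln (norm (rcis R x - a)) \<le> ln (2 * R)" using False R by (subst ln_le_cancel_iff) auto
      then show ?thesis by (simp add: C_def)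
    qed (simp add: C_def)
  qed
  then have "(\<lambda>\<theta>. C - (C - ln (norm (rcis R \<theta> - a)))) absolutely_integrable_on {0..2*pi}"
    by (intro set_integral_diff(1)[of _ _ "\<lambda>_. C" "\<lambda>\<theta>. C - ln (norm (rcis R \<theta> - a))"]) (simp_all add: absolutely_integrable_continuous_real)
  then show ?thesis by (simp add: circle_integrable_def)
qed

text \<open>For |a| < R the reflected factor is zero-free on the closed disc and has the modulus of
  z - a on the circle. For |a| = R both factors have the same modulus at w as well, and the boundary
  case applies. Zeros and poles on the circle thus cause no exception later.\<close>

lemma poisson_ln_linear:
  assumes a: "norm a \<le> R" and w: "norm w < R"
  shows "circle_integrable (\<lambda>z. ln (norm (z - a))) R"
    "circle_mean (\<lambda>z. poisson_kernel R w z * ln (norm (z - a))) R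
       = ln (norm (of_real (R\<^sup>2) - cnj a * w) / R)"
proof -
  have R: "R > 0" using w norm_ge_zero[of w] by linarith
  have "circle_integrable (\<lambda>z. ln (norm (z - a))) R \<and>
    circle_mean (\<lambda>z. poisson_kernel R w z * ln (norm (z - a))) R
       = ln (norm (of_real (R\<^sup>2) - cnj a * w) / R)"
  proof (cases "norm a = R")
    case True
    have "norm (of_real (R\<^sup>2) - cnj a * w) / R = norm (w - a)"
    proof -
      have "complex_of_real (R\<^sup>2) = cnj a * a" by (metis complex_norm_square mult.commute True)
      then have "of_real (R\<^sup>2) - cnj a * w = cnj a * (a - w)" by (simp add: algebra_simps)
      then show ?thesis using True R by (simp add: norm_mult norm_minus_commute)
    qed
    then show ?thesis using poisson_ln_boundary(1)[OF True w] circle_integrable_ln_boundary[OF True R] by simp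
  next
    case False
    define k where "k = (\<lambda>z. (of_real (R\<^sup>2) - cnj a * z) / of_real R)"
    have k: "k analytic_on cball 0 R" unfolding k_def using R by (intro analytic_intros) auto
    have nz: "k z \<noteq> 0" if "norm z \<le> R" for z
    proof -
      have "norm a * norm z \<le> norm a * R" using that by (intro mult_left_mono) auto
      also have "\<dots> < R * R" using a False R by (intro mult_strict_right_mono) auto
      finally show ?thesis using R reflection_nonzero by (simp add: k_def)
    qed
    have nk: "norm (k z) = norm (of_real (R\<^sup>2) - cnj a * z) / R" for z
      using R by (simp add: k_def norm_divide)
    have eq: "norm (k z) = norm (z - a)" if "norm z = R" for z
      using norm_reflect_eq[OF that R] nk by metis
    have "circle_mean (\<lambda>z. poisson_kernel R w z * ln (norm (z - a))) R
        = circle_mean (\<lambda>z. poisson_kernel R w z * ln (norm (k z))) R"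
      by (rule circle_mean_cong_finite[OF R finite.emptyI]) (simp add: eq)
    moreover have "circle_integrable (\<lambda>z. ln (norm (z - a))) R \<longleftrightarrow> circle_integrable (\<lambda>z. ln (norm (k z))) R"
      by (rule circle_integrable_cong_finite[OF R finite.emptyI]) (simp add: eq)
    ultimately show ?thesis
      using poisson_ln_nonvanishing[OF k nz w] nk by metis
  qed
  then show "circle_integrable (\<lambda>z. ln (norm (z - a))) R"
    "circle_mean (\<lambda>z. poisson_kernel R w z * ln (norm (z - a))) R
       = ln (norm (of_real (R\<^sup>2) - cnj a * w) / R)" by auto
qed

lemma circle_mean_poisson_0:
  assumes "R > 0"
  shows "circle_mean (\<lambda>z. poisson_kernel R 0 z * \<phi> z) R = circle_mean \<phi> R"
  by (rule circle_mean_cong_finite[OF assms finite.emptyI]) (use assms in simp)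

lemma circle_mean_ln_linear:
  assumes "R > 0"
  shows "circle_integrable (\<lambda>z. ln (norm (z - a))) R"
    and "circle_mean (\<lambda>z. ln (norm (z - a))) R = (if norm a \<le> R then ln R else ln (norm a))"
proof -
  have "circle_integrable (\<lambda>z. ln (norm (z - a))) R \<and>
     circle_mean (\<lambda>z. ln (norm (z - a))) R = (if norm a \<le> R then ln R else ln (norm a))"
  proof (cases "norm a \<le> R")
    case True
    then show ?thesis
      using poisson_ln_linear[OF True, of 0] assms circle_mean_poisson_0[OF assms, of "\<lambda>z. ln (norm (z - a))"]
      by (simp add: norm_mult power2_eq_square)
  next
    case False
    have k: "(\<lambda>z. z - a) analytic_on cball 0 R" "\<And>z. norm z \<le> R \<Longrightarrow> z - a \<noteq> 0"
      using False by (auto intro!: analytic_intros)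
    show ?thesis
      using poisson_ln_nonvanishing[OF k, of 0] assms False circle_mean_poisson_0[OF assms, of "\<lambda>z. ln (norm (z - a))"]
      by simp
  qed
  then show "circle_integrable (\<lambda>z. ln (norm (z - a))) R"
    "circle_mean (\<lambda>z. ln (norm (z - a))) R = (if norm a \<le> R then ln R else ln (norm a))" by auto
qed

section \<open>The Poisson--Jensen inequality\<close>

text \<open>The natural domain of \<open>zorder\<close>: vanishing off a sparse set is excluded, so
  orders add under multiplication, while values on a sparse set remain arbitrary. The class is
  closed under products, powers and inverses.\<close>

definition nonzero_meromorphic :: "(complex \<Rightarrow> complex) \<Rightarrow> bool" where
  "nonzero_meromorphic f \<longleftrightarrow> f meromorphic_on UNIV \<and> (\<forall>\<^sub>\<approx>z. f z \<noteq> 0)"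

lemma nonzero_meromorphicD:
  assumes "nonzero_meromorphic f"
  shows "f meromorphic_on A" "eventually (\<lambda>z. f z \<noteq> 0) (at a)" "frequently (\<lambda>z. f z \<noteq> 0) (at a)"
proof -
  show "f meromorphic_on A" using assms meromorphic_on_subset by (auto simp: nonzero_meromorphic_def)
  show "eventually (\<lambda>z. f z \<noteq> 0) (at a)"
    using assms by (auto simp: nonzero_meromorphic_def eventually_cosparse_open_eq)
  then show "frequently (\<lambda>z. f z \<noteq> 0) (at a)"
    by (intro eventually_frequently) auto
qed

lemma nonzero_meromorphic_isolated:
  assumes "nonzero_meromorphic f"
  shows "isolated_singularity_at f a" "not_essential f a"
  using nonzero_meromorphicD(1)[OF assms, of "{a}"] by (auto simp: meromorphic_at_iff)

lemma not_nonzero_meromorphic: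
  assumes "f meromorphic_on UNIV" "\<not> nonzero_meromorphic f"
  shows "\<forall>\<^sub>\<approx>z. f z = 0"
  using meromorphic_imp_constant_or_avoid[OF assms(1), of 0] assms
  by (auto simp: nonzero_meromorphic_def)

lemma nonzero_meromorphic_inverse:
  "nonzero_meromorphic f \<Longrightarrow> nonzero_meromorphic (\<lambda>z. inverse (f z))"
  unfolding nonzero_meromorphic_def by (auto intro!: meromorphic_intros)

lemma nonzero_meromorphic_mult:
  assumes "nonzero_meromorphic f" "nonzero_meromorphic g"
  shows "nonzero_meromorphic (\<lambda>z. f z * g z)"
  using assms unfolding nonzero_meromorphic_def
  by (auto intro!: meromorphic_intros elim: eventually_elim2)

lemma nonzero_meromorphic_powi:
  assumes "nonzero_meromorphic f"
  shows "nonzero_meromorphic (\<lambda>z. f z powi n)"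
  unfolding nonzero_meromorphic_def
proof
  show "(\<lambda>z. f z powi n) meromorphic_on UNIV"
    by (intro meromorphic_intros nonzero_meromorphicD(1)[OF assms])
  have "\<forall>\<^sub>\<approx>z. f z \<noteq> 0" using assms by (simp add: nonzero_meromorphic_def)
  then show "\<forall>\<^sub>\<approx>z. f z powi n \<noteq> 0" by eventually_elim auto
qed

lemma nonzero_meromorphic_power:
  assumes "nonzero_meromorphic f"
  shows "nonzero_meromorphic (\<lambda>z. f z ^ n)"
  using nonzero_meromorphic_powi[OF assms, of "int n"] by simp

lemma nonzero_meromorphic_prod:
  assumes "\<And>a. a \<in> A \<Longrightarrow> nonzero_meromorphic (f a)"
  shows "nonzero_meromorphic (\<lambda>z. \<Prod>a\<in>A. f a z)"
  using assms
proof (induction A rule: infinite_finite_induct)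
  case (insert x A)
  then have "nonzero_meromorphic (\<lambda>z. f x z * (\<Prod>a\<in>A. f a z))"
    by (intro nonzero_meromorphic_mult) auto
  then show ?case using insert by simp
qed (auto simp: nonzero_meromorphic_def)

lemma nonzero_meromorphic_linear: "nonzero_meromorphic (\<lambda>z. z - a)"
  unfolding nonzero_meromorphic_def eventually_cosparse_open_eq[OF open_UNIV]
proof (intro conjI ballI)
  fix x
  show "eventually (\<lambda>z. z - a \<noteq> 0) (at x)"
  proof (cases "x = a")
    case True then show ?thesis by (auto simp: eventually_at_filter)
  next
    case False
    have "((\<lambda>z. z - a) \<longlongrightarrow> x - a) (at x)" by (intro tendsto_intros)
    then show ?thesis using False by (intro tendsto_imp_eventually_ne) auto
  qed
qed (auto intro!: meromorphic_intros)

text \<open>Sparse sets meet compact sets in finitely many points. This supplies the finite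
  exceptional sets for the circle lemmas.\<close>

lemma cosparse_finite_cball:
  assumes "eventually P (cosparse UNIV)"
  shows "finite {z\<in>cball (0::complex) R. \<not> P z}"
proof -
  have "{z\<in>cball (0::complex) R. \<not> P z} sparse_in cball 0 R"
    using assms unfolding eventually_cosparse
    by (rule sparse_in_subset2[OF sparse_in_subset]) auto
  moreover have "{z\<in>cball (0::complex) R. \<not> P z} \<subseteq> cball 0 R" by auto
  ultimately show ?thesis
    using sparse_in_compact_finite[of "{z\<in>cball (0::complex) R. \<not> P z}" "cball 0 R"]
    by (auto simp: Int_def inf.absorb2 inf.absorb1)
qed

section \<open>Orders of zeros and poles, and factorization on a disc\<close>

lemma is_pole_iff_zorder_neg:
  assumes "nonzero_meromorphic f"
  shows "is_pole f a \<longleftrightarrow> zorder f a < 0"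
  using zorder_neg_imp_is_pole[OF nonzero_meromorphicD(1)[OF assms] nonzero_meromorphicD(2)[OF assms]]
    isolated_pole_imp_neg_zorder[OF nonzero_meromorphic_isolated(1)[OF assms]] by blast

lemma isolated_zero_iff_zorder_pos:
  assumes "nonzero_meromorphic f"
  shows "isolated_zero f a \<longleftrightarrow> zorder f a > 0"
  using zorder_pos_imp_isolated_zero[OF nonzero_meromorphicD(1)[OF assms] nonzero_meromorphicD(2)[OF assms]]
    zorder_isolated_zero_pos'[OF _ nonzero_meromorphic_isolated(1)[OF assms]] by blast

lemma zorder_nonzero_iff:
  assumes "nonzero_meromorphic f"
  shows "zorder f a \<noteq> 0 \<longleftrightarrow> is_pole f a \<or> isolated_zero f a"
  unfolding is_pole_iff_zorder_neg[OF assms] isolated_zero_iff_zorder_pos[OF assms] by auto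

lemma finite_zorder_nonzero:
  assumes "nonzero_meromorphic f"
  shows "finite {a\<in>cball 0 R. zorder f a \<noteq> 0}"
proof -
  have "\<forall>\<^sub>\<approx>z. \<not> is_pole f z" "\<forall>\<^sub>\<approx>z. \<not> isolated_zero f z"
    using meromorphic_on_imp_not_pole_cosparse meromorphic_on_imp_not_zero_cosparse
      nonzero_meromorphicD(1)[OF assms] by auto
  then have "\<forall>\<^sub>\<approx>z. zorder f z = 0" by eventually_elim (use zorder_nonzero_iff[OF assms] in blast)
  then show ?thesis by (rule cosparse_finite_cball)
qed

lemma zorder_inverse_eq:
  assumes "nonzero_meromorphic f"
  shows "zorder (\<lambda>z. inverse (f z)) a = - zorder f a"
  using zorder_power_int[OF nonzero_meromorphicD(1)[OF assms] nonzero_meromorphicD(3)[OF assms], of "-1"]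
  by (simp add: power_int_minus)

lemma zorder_mult_eq:
  assumes "nonzero_meromorphic f" "nonzero_meromorphic g"
  shows "zorder (\<lambda>z. f z * g z) a = zorder f a + zorder g a"
  by (intro zorder_mult nonzero_meromorphicD assms)

lemma zorder_power_eq:
  assumes "nonzero_meromorphic f"
  shows "zorder (\<lambda>z. f z ^ n) a = n * zorder f a"
  using zorder_power_int[OF nonzero_meromorphicD(1)[OF assms] nonzero_meromorphicD(3)[OF assms], of "int n"]
  by simp

lemma zorder_linear: "zorder (\<lambda>z. z - a) b = (if a = b then 1 else 0)"
proof (cases "a = b")
  case True
  have "zorder (\<lambda>z. z - b) b = 1"
    by (rule zorder_eqI[of UNIV _ "\<lambda>_. 1"]) auto
  then show ?thesis using True by simp
next
  case False
  have "zorder (\<lambda>z. z - a) b = 0"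
    by (rule zorder_eqI[of UNIV _ "\<lambda>z. z - a"]) (use False in \<open>auto intro!: holomorphic_intros\<close>)
  then show ?thesis using False by simp
qed

lemma zorder_linear_powi: "zorder (\<lambda>z. (z - a) powi n) b = (if a = b then n else 0)"
  using zorder_power_int[of "\<lambda>z. z - a" b n, OF nonzero_meromorphicD(1)[OF nonzero_meromorphic_linear]
      nonzero_meromorphicD(3)[OF nonzero_meromorphic_linear]] zorder_linear[of a b] by simp

lemma zorder_prod_eq:
  assumes "finite A" "\<And>a. a \<in> A \<Longrightarrow> nonzero_meromorphic (f a)"
  shows "zorder (\<lambda>z. \<Prod>a\<in>A. f a z) b = (\<Sum>a\<in>A. zorder (f a) b)"
  using assms
proof (intro zorder_prod)
  show "f x meromorphic_on {b}" if "x \<in> A" for x using assms nonzero_meromorphicD(1) that by blast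
  show "\<forall>\<^sub>F z in at b. (\<Prod>x\<in>A. f x z) \<noteq> 0"
    using nonzero_meromorphicD(2)[OF nonzero_meromorphic_prod] assms(2) by blast
qed

definition zeros_poles :: "(complex \<Rightarrow> complex) \<Rightarrow> real \<Rightarrow> complex set" where
  "zeros_poles f R = {a\<in>cball 0 R. zorder f a \<noteq> 0}"

lemma finite_zeros_poles: "nonzero_meromorphic f \<Longrightarrow> finite (zeros_poles f R)"
  unfolding zeros_poles_def by (rule finite_zorder_nonzero)

text \<open>Dividing out the zeros and poles of the closed disc leaves order 0 at each of its
  points, and removing singularities makes the quotient analytic and zero-free there. The identity
  is claimed only off a sparse set, where f has its proper values.\<close>

lemma meromorphic_factorization:
  assumes f: "nonzero_meromorphic f"
  shows "\<exists>k. k analytic_on cball 0 R \<and> (\<forall>z. norm z \<le> R \<longrightarrow> k z \<noteq> 0) \<and>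
    (\<forall>\<^sub>\<approx>z. f z = k z * (\<Prod>a\<in>zeros_poles f R. (z - a) powi zorder f a))"
proof -
  let ?S = "zeros_poles f R"
  have fin: "finite ?S" by (rule finite_zeros_poles[OF f])
  define P where "P = (\<lambda>z. \<Prod>a\<in>?S. (z - a) powi (- zorder f a))"
  have P: "nonzero_meromorphic P"
    unfolding P_def by (intro nonzero_meromorphic_prod nonzero_meromorphic_powi nonzero_meromorphic_linear)
  have zP: "zorder P z = - zorder f z" if "norm z \<le> R" for z
  proof -
    have "zorder P z = (\<Sum>a\<in>?S. if a = z then - zorder f a else 0)"
      unfolding P_def
      by (subst zorder_prod_eq[OF fin]) (auto intro!: nonzero_meromorphic_powi nonzero_meromorphic_linear
          simp: zorder_linear_powi)
    also have "\<dots> = - zorder f z" using fin that by (auto simp: sum.delta zeros_poles_def)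
    finally show ?thesis .
  qed
  define p where "p = (\<lambda>z. f z * P z)"
  have p: "nonzero_meromorphic p" unfolding p_def by (rule nonzero_meromorphic_mult[OF f P])
  have zp: "zorder p z = 0" if "norm z \<le> R" for z
    unfolding p_def zorder_mult_eq[OF f P] zP[OF that] by simp
  define k where "k = remove_sings p"
  have "k analytic_on {z} \<and> k z \<noteq> 0" if "norm z \<le> R" for z
  proof -
    have np: "\<not> is_pole p z" and nz: "\<not> isolated_zero p z"
      using zorder_nonzero_iff[OF p] zp[OF that] by auto
    then obtain c where c: "p \<midarrow>z\<rightarrow> c"
      using nonzero_meromorphic_isolated(2)[OF p] by (auto simp: not_essential_def)
    have "c \<noteq> 0" using nz c nonzero_meromorphicD(2)[OF p] by (auto simp: isolated_zero_def)
    moreover have "k z = c" unfolding k_def using c by (rule remove_sings_eqI)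
    moreover have "k analytic_on {z}" unfolding k_def
      using nonzero_meromorphic_isolated(1)[OF p] c by (rule remove_sings_analytic_at)
    ultimately show ?thesis by simp
  qed
  moreover from this have "k analytic_on cball 0 R" by (subst analytic_on_analytic_at) auto
  moreover have "\<forall>\<^sub>\<approx>z. f z = k z * (\<Prod>a\<in>?S. (z - a) powi zorder f a)"
  proof -
    have "\<forall>\<^sub>\<approx>z. k z = p z" unfolding k_def
      by (intro eventually_remove_sings_eq nonzero_meromorphicD(1)[OF p])
    moreover have "\<forall>\<^sub>\<approx>z. P z \<noteq> 0" using P by (auto simp: nonzero_meromorphic_def)
    ultimately show ?thesis
    proof eventually_elim
      case (elim z)
      have "(\<Prod>a\<in>?S. (z - a) powi zorder f a) * P z = 1"
      proof -
        \<comment> \<open>Since 0 \<open>powi\<close> n is 0 for negative n as well,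
          \<open>P\<close> vanishes at every point of \<open>?S\<close>, and
          \<open>P z \<noteq> 0\<close> excludes these points.\<close>
        have "z - a \<noteq> 0" if "a \<in> ?S" for a
          using elim(2) that fin by (auto simp: P_def zeros_poles_def)
        then show ?thesis unfolding P_def prod.distrib[symmetric]
          by (intro prod.neutral) (auto simp: power_int_minus)
      qed
      then show ?case using elim by (simp add: p_def algebra_simps)
    qed
  qed
  ultimately show ?thesis by blast
qed

lemma ln_norm_factorization:
  fixes k :: "complex \<Rightarrow> complex" and m :: "complex \<Rightarrow> int"
  assumes "finite S" "k z \<noteq> 0" "z \<notin> S"
  shows "ln (norm (k z * (\<Prod>a\<in>S. (z - a) powi m a))) = ln (norm (k z)) + (\<Sum>a\<in>S. m a * ln (norm (z - a)))"
proof -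
  have "norm (\<Prod>a\<in>S. (z - a) powi m a) = (\<Prod>a\<in>S. norm (z - a) powi m a)"
    by (simp add: norm_power_int flip: prod_norm)
  moreover have "ln (\<Prod>a\<in>S. norm (z - a) powi m a) = (\<Sum>a\<in>S. ln (norm (z - a) powi m a))"
    using assms by (intro ln_prod) auto
  moreover have "ln (norm (z - a) powi m a) = m a * ln (norm (z - a))" if "a \<in> S" for a
  proof -
    have "norm (z - a) > 0" using that assms by auto
    then show ?thesis by (simp add: ln_powr flip: powr_real_of_int')
  qed
  moreover have "(\<Prod>a\<in>S. norm (z - a) powi m a) \<noteq> 0" using assms by auto
  ultimately show ?thesis using assms by (simp add: norm_mult ln_mult)
qed

text \<open>The factor k stays a parameter: the mean determines \<open>k w\<close> and not the
  possibly arbitrary value \<open>f w\<close>. The two are related only in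
  \<open>poisson_jensen\<close>, where f is analytic at w.\<close>

lemma poisson_meromorphic:
  assumes f: "nonzero_meromorphic f" and R: "R > 0"
    and k: "k analytic_on cball 0 R" "\<And>z. norm z \<le> R \<Longrightarrow> k z \<noteq> 0"
      "\<forall>\<^sub>\<approx>z. f z = k z * (\<Prod>a\<in>zeros_poles f R. (z - a) powi zorder f a)"
  shows "circle_integrable (\<lambda>z. ln (norm (f z))) R"
    and "\<And>w. norm w < R \<Longrightarrow> circle_mean (\<lambda>z. poisson_kernel R w z * ln (norm (f z))) R
       = ln (norm (k w)) + (\<Sum>a\<in>zeros_poles f R. zorder f a * ln (norm (of_real (R\<^sup>2) - cnj a * w) / R))"
proof -
  let ?S = "zeros_poles f R"
  have fin: "finite ?S" by (rule finite_zeros_poles[OF f])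
  define X where "X = ?S \<union> {z\<in>cball 0 R. f z \<noteq> k z * (\<Prod>a\<in>?S. (z - a) powi zorder f a)}"
  have X: "finite X" unfolding X_def using fin cosparse_finite_cball[OF k(3)] by auto
  define L where "L = (\<lambda>z. ln (norm (k z)) + (\<Sum>a\<in>?S. zorder f a * ln (norm (z - a))))"
  have eq: "ln (norm (f z)) = L z" if "norm z = R" "z \<notin> X" for z
    using that ln_norm_factorization[OF fin, of k z "zorder f"] k(2)[of z] by (auto simp: X_def L_def)
  have lin: "circle_integrable (\<lambda>z. ln (norm (z - a))) R" for a
    using circle_mean_ln_linear[OF R] by auto
  have kin: "circle_integrable (\<lambda>z. ln (norm (k z))) R"
    using poisson_ln_nonvanishing(1)[OF k(1,2), of 0] R by simp
  have "circle_integrable L R" unfolding L_def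
    by (intro circle_integrable_add kin circle_integrable_sum circle_integrable_cmult lin)
  then show "circle_integrable (\<lambda>z. ln (norm (f z))) R"
    using circle_integrable_cong_finite[OF R X, of "\<lambda>z. ln (norm (f z))" L] eq by blast
  fix w :: complex assume w: "norm w < R"
  note pk = circle_integrable_mult_continuous[OF _ continuous_on_poisson_kernel[OF w] R]
  have "circle_mean (\<lambda>z. poisson_kernel R w z * ln (norm (f z))) R = circle_mean (\<lambda>z. poisson_kernel R w z * L z) R"
    by (rule circle_mean_cong_finite[OF R X]) (simp add: eq)
  also have "\<dots> = circle_mean (\<lambda>z. poisson_kernel R w z * ln (norm (k z)) +
       (\<Sum>a\<in>?S. zorder f a * (poisson_kernel R w z * ln (norm (z - a))))) R"
    by (simp add: L_def ring_distribs sum_distrib_left mult_ac)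
  also have "\<dots> = circle_mean (\<lambda>z. poisson_kernel R w z * ln (norm (k z))) R +
       (\<Sum>a\<in>?S. zorder f a * circle_mean (\<lambda>z. poisson_kernel R w z * ln (norm (z - a))) R)"
  proof (subst circle_mean_add)
    have i: "circle_integrable (\<lambda>z. zorder f a * (poisson_kernel R w z * ln (norm (z - a)))) R" for a
      by (intro circle_integrable_cmult pk lin)
    then show "circle_integrable (\<lambda>z. \<Sum>a\<in>?S. zorder f a * (poisson_kernel R w z * ln (norm (z - a)))) R"
      by (intro circle_integrable_sum)
    show "circle_mean (\<lambda>z. poisson_kernel R w z * ln (norm (k z))) R
       + circle_mean (\<lambda>z. \<Sum>a\<in>?S. zorder f a * (poisson_kernel R w z * ln (norm (z - a)))) R
       = circle_mean (\<lambda>z. poisson_kernel R w z * ln (norm (k z))) R +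
       (\<Sum>a\<in>?S. zorder f a * circle_mean (\<lambda>z. poisson_kernel R w z * ln (norm (z - a))) R)"
      by (subst circle_mean_sum[OF i]) (simp add: circle_mean_cmult)
  qed (intro pk kin)
  also have "\<dots> = ln (norm (k w)) + (\<Sum>a\<in>?S. zorder f a * ln (norm (of_real (R\<^sup>2) - cnj a * w) / R))"
    using poisson_ln_nonvanishing(2)[OF k(1,2) w] poisson_ln_linear(2)[OF _ w]
    by (auto simp: zeros_poles_def intro!: sum.cong)
  finally show "circle_mean (\<lambda>z. poisson_kernel R w z * ln (norm (f z))) R
       = ln (norm (k w)) + (\<Sum>a\<in>?S. zorder f a * ln (norm (of_real (R\<^sup>2) - cnj a * w) / R))" .
qed

lemma circle_integrable_ln_meromorphic:
  assumes "nonzero_meromorphic f" "R > 0"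
  shows "circle_integrable (\<lambda>z. ln (norm (f z))) R"
  using meromorphic_factorization[OF assms(1), of R] poisson_meromorphic(1)[OF assms] by blast

lemma zorder_analytic_nonzero:
  assumes "f analytic_on {w}" "f w \<noteq> 0"
  shows "zorder f w = 0"
proof -
  obtain U where "open U" "w \<in> U" "f holomorphic_on U" using assms(1) analytic_at by blast
  then show ?thesis by (intro zorder_eqI[of U w f]) (use assms in auto)
qed

text \<open>Both f and its factorization are continuous at w and agree near w off w, hence they
  agree at w. The rest is \<open>poisson_meromorphic\<close>.\<close>

lemma poisson_jensen:
  assumes f: "nonzero_meromorphic f" and w: "norm w < R" "f analytic_on {w}" "f w \<noteq> 0"
  shows "ln (norm (f w)) = circle_mean (\<lambda>z. poisson_kernel R w z * ln (norm (f z))) R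
     - (\<Sum>a\<in>zeros_poles f R. zorder f a * (ln (norm (of_real (R\<^sup>2) - cnj a * w) / R) - ln (norm (w - a))))"
proof -
  let ?S = "zeros_poles f R"
  have R: "R > 0" using w norm_ge_zero[of w] by linarith
  have fin: "finite ?S" by (rule finite_zeros_poles[OF f])
  obtain k where k: "k analytic_on cball 0 R" "\<And>z. norm z \<le> R \<Longrightarrow> k z \<noteq> 0"
      "\<forall>\<^sub>\<approx>z. f z = k z * (\<Prod>a\<in>?S. (z - a) powi zorder f a)"
    using meromorphic_factorization[OF f, of R] by blast
  have wS: "w \<notin> ?S" using zorder_analytic_nonzero[OF w(2,3)] by (auto simp: zeros_poles_def)
  have "k analytic_on {w}" using k(1) w(1) by (auto intro: analytic_on_subset)
  then have "(\<lambda>z. k z * (\<Prod>a\<in>?S. (z - a) powi zorder f a)) analytic_on {w}"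
    using wS by (intro analytic_intros) auto
  then have lim: "((\<lambda>z. k z * (\<Prod>a\<in>?S. (z - a) powi zorder f a)) \<longlongrightarrow> k w * (\<Prod>a\<in>?S. (w - a) powi zorder f a)) (at w)"
    using analytic_at_imp_isCont isContD by blast
  have "(f \<longlongrightarrow> f w) (at w)" using w analytic_at_imp_isCont isContD by blast
  moreover have "eventually (\<lambda>z. f z = k z * (\<Prod>a\<in>?S. (z - a) powi zorder f a)) (at w)"
    using k(3) by (auto simp: eventually_cosparse_open_eq)
  ultimately have "((\<lambda>z. k z * (\<Prod>a\<in>?S. (z - a) powi zorder f a)) \<longlongrightarrow> f w) (at w)"
    by (blast intro: Lim_transform_eventually)
  then have "f w = k w * (\<Prod>a\<in>?S. (w - a) powi zorder f a)"
    using lim by (rule tendsto_unique[OF at_neq_bot])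
  then have "ln (norm (f w)) = ln (norm (k w)) + (\<Sum>a\<in>?S. zorder f a * ln (norm (w - a)))"
    using ln_norm_factorization[OF fin _ wS, of k "zorder f"] k(2)[of w] w by simp
  then show ?thesis using poisson_meromorphic(2)[OF f R k w(1)]
    by (simp add: sum_subtractf right_diff_distrib)
qed

section \<open>Poles with multiplicity, and the pointwise bound\<close>

definition poles_in :: "(complex \<Rightarrow> complex) \<Rightarrow> real \<Rightarrow> complex set" where
  "poles_in f R = {z. norm z \<le> R \<and> is_pole f z}"

definition pole_mult :: "(complex \<Rightarrow> complex) \<Rightarrow> complex \<Rightarrow> nat" where
  "pole_mult f b = nat (- zorder f b)"

lemma finite_poles_in:
  assumes "f meromorphic_on UNIV"
  shows "finite (poles_in f R)"
proof -
  have "poles_in f R = {z\<in>cball 0 R. \<not> \<not> is_pole f z}" by (auto simp: poles_in_def)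
  then show ?thesis using cosparse_finite_cball[OF meromorphic_on_imp_not_pole_cosparse[OF assms]] by metis
qed

lemma pole_count_eq: "pole_count f t = (\<Sum>b\<in>poles_in f t. pole_mult f b)"
  by (simp add: pole_count_def poles_in_def pole_mult_def)

lemma poles_in_subset:
  "nonzero_meromorphic f \<Longrightarrow> poles_in f R \<subseteq> zeros_poles f R"
  by (auto simp: poles_in_def zeros_poles_def is_pole_iff_zorder_neg)

text \<open>Points other than poles have multiplicity 0, so sums for different functions can be
  taken over one common index set.\<close>

lemma sum_poles_in_superset:
  fixes \<phi> :: "complex \<Rightarrow> real"
  assumes u: "nonzero_meromorphic u" and S: "finite S" "poles_in u R \<subseteq> S" "S \<subseteq> cball 0 R"
  shows "(\<Sum>b\<in>poles_in u R. pole_mult u b * \<phi> b) = (\<Sum>a\<in>S. pole_mult u a * \<phi> a)"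
proof (rule sum.mono_neutral_left[OF S(1,2)])
  have "pole_mult u i = 0" if "i \<in> S" "i \<notin> poles_in u R" for i
  proof -
    have "\<not> is_pole u i" using that S(3) by (auto simp: poles_in_def)
    then show ?thesis unfolding is_pole_iff_zorder_neg[OF u] pole_mult_def by simp
  qed
  then show "\<forall>i\<in>S - poles_in u R. pole_mult u i * \<phi> i = 0" by simp
qed

lemma zeros_poles_subset: "zeros_poles f R \<subseteq> cball 0 R"
  by (auto simp: zeros_poles_def)

lemma pole_mult_eq: "pole_mult f b = (if zorder f b < 0 then - real_of_int (zorder f b) else 0)"
  by (simp add: pole_mult_def)

text \<open>The difference of the two sides is the Green function of the disc with pole a. Its sign
  comes from |R^2 - cnj a w|^2 - R^2 |w - a|^2 = (R^2 - |a|^2) (R^2 - |w|^2).\<close>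

lemma green_nonneg:
  assumes "norm a \<le> R" "norm w \<le> R" "R > 0" "w \<noteq> a"
  shows "ln (norm (w - a)) \<le> ln (norm (of_real (R\<^sup>2) - cnj a * w) / R)"
proof -
  have "(norm (of_real (R\<^sup>2) - cnj a * w))\<^sup>2 - (R * norm (w - a))\<^sup>2 = (R\<^sup>2 - (norm a)\<^sup>2) * (R\<^sup>2 - (norm w)\<^sup>2)"
    by (simp add: cmod_power2 power_mult_distrib) (simp add: power2_eq_square algebra_simps)
  also have "\<dots> \<ge> 0" using assms by (intro mult_nonneg_nonneg) (auto intro!: power_mono)
  finally have "R * norm (w - a) \<le> norm (of_real (R\<^sup>2) - cnj a * w)"
    by (intro power2_le_imp_le[of "R * norm (w - a)" "norm (of_real (R\<^sup>2) - cnj a * w)"]) simp_all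
  then have "norm (w - a) \<le> norm (of_real (R\<^sup>2) - cnj a * w) / R"
    using assms by (simp add: field_simps)
  then show ?thesis using assms by (intro ln_mono) auto
qed

lemma log_plus_nonneg [simp]: "log_plus x \<ge> 0" and ln_le_log_plus: "ln x \<le> log_plus x"
  by (auto simp: log_plus_def)

lemma circle_integrable_log_plus:
  assumes "f meromorphic_on UNIV" "R > 0"
  shows "circle_integrable (\<lambda>z. log_plus (norm (f z))) R"
proof (cases "nonzero_meromorphic f")
  case True
  then show ?thesis unfolding log_plus_def
    by (intro circle_integrable_max_0 circle_integrable_ln_meromorphic assms)
next
  case False
  then have "\<forall>\<^sub>\<approx>z. f z = 0" using assms not_nonzero_meromorphic by blast
  from cosparse_finite_cball[OF this, of R]
  have "finite {z\<in>cball 0 R. f z \<noteq> 0}" .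
  from circle_integrable_cong_finite[OF assms(2) this, of "\<lambda>z. log_plus (norm (f z))" "\<lambda>_. 0"]
  show ?thesis by (auto simp: log_plus_def)
qed

lemma proximity_nonneg: "proximity_fun f r \<ge> 0"
  unfolding proximity_fun_eq by (intro circle_mean_nonneg) auto

lemma pointwise_le_proximity:
  assumes f: "nonzero_meromorphic f" and w: "norm w \<le> R / 2" "R > 0" "f analytic_on {w}"
  shows "log_plus (norm (f w)) \<le> 3 * proximity_fun f R
     + (\<Sum>b\<in>poles_in f R. pole_mult f b * (ln (norm (of_real (R\<^sup>2) - cnj b * w) / R) - ln (norm (w - b))))"
    (is "_ \<le> _ + ?G")
proof -
  let ?S = "zeros_poles f R"
  have fin: "finite ?S" by (rule finite_zeros_poles[OF f])
  have wR: "norm w < R" using w by linarith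
  have "b \<noteq> w" if "b \<in> poles_in f R" for b
    using that w(3) analytic_at_imp_no_pole by (auto simp: poles_in_def)
  then have G: "?G \<ge> 0" using green_nonneg[of _ R w] w wR
    by (intro sum_nonneg mult_nonneg_nonneg) (auto simp: poles_in_def)
  show ?thesis
  proof (cases "f w = 0")
    case True
    then show ?thesis using G proximity_nonneg[of f R] by (simp add: log_plus_def)
  next
    case False
    have "- (\<Sum>a\<in>?S. zorder f a * (ln (norm (of_real (R\<^sup>2) - cnj a * w) / R) - ln (norm (w - a))))
       \<le> (\<Sum>a\<in>?S. pole_mult f a * (ln (norm (of_real (R\<^sup>2) - cnj a * w) / R) - ln (norm (w - a))))"
      unfolding sum_negf[symmetric]
    proof (rule sum_mono)
      fix a assume a: "a \<in> ?S"
      then have "a \<noteq> w" using zorder_analytic_nonzero[OF w(3) False] by (auto simp: zeros_poles_def)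
      then have g: "0 \<le> ln (norm (of_real (R\<^sup>2) - cnj a * w) / R) - ln (norm (w - a))"
        using green_nonneg[of a R w] a w wR by (auto simp: zeros_poles_def)
      have "- real_of_int (zorder f a) \<le> real (pole_mult f a)" by (simp add: pole_mult_def)
      from mult_right_mono[OF this g]
      show "- (zorder f a * (ln (norm (of_real (R\<^sup>2) - cnj a * w) / R) - ln (norm (w - a))))
         \<le> pole_mult f a * (ln (norm (of_real (R\<^sup>2) - cnj a * w) / R) - ln (norm (w - a)))"
        by simp
    qed
    also have "\<dots> = ?G"
      by (rule sum_poles_in_superset[OF f fin poles_in_subset[OF f] zeros_poles_subset, symmetric])
    finally have 1: "ln (norm (f w)) \<le> circle_mean (\<lambda>z. poisson_kernel R w z * ln (norm (f z))) R + ?G"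
      using poisson_jensen[OF f wR w(3) False] by simp
    have "circle_mean (\<lambda>z. poisson_kernel R w z * ln (norm (f z))) R \<le> circle_mean (\<lambda>z. 3 * log_plus (norm (f z))) R"
    proof (rule circle_mean_mono_finite[OF w(2) finite.emptyI])
      show "circle_integrable (\<lambda>z. poisson_kernel R w z * ln (norm (f z))) R"
        by (intro circle_integrable_mult_continuous circle_integrable_ln_meromorphic
            continuous_on_poisson_kernel f w wR)
      show "circle_integrable (\<lambda>z. 3 * log_plus (norm (f z))) R"
        using f w by (intro circle_integrable_cmult circle_integrable_log_plus) (auto simp: nonzero_meromorphic_def)
      fix z :: complex assume z: "norm z = R"
      have "poisson_kernel R w z * ln (norm (f z)) \<le> poisson_kernel R w z * log_plus (norm (f z))"
        using poisson_kernel_nonneg[OF wR] by (intro mult_left_mono ln_le_log_plus)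
      also have "\<dots> \<le> 3 * log_plus (norm (f z))"
        using poisson_kernel_le_3[OF z w(1,2)] by (intro mult_right_mono) auto
      finally show "poisson_kernel R w z * ln (norm (f z)) \<le> 3 * log_plus (norm (f z))" .
    qed
    then have "ln (norm (f w)) \<le> 3 * proximity_fun f R + ?G"
      using 1 by (simp add: proximity_fun_eq circle_mean_cmult)
    then show ?thesis using G proximity_nonneg[of f R] by (simp add: log_plus_def)
  qed
qed

section \<open>Jensen's formula and the characteristic\<close>

lemma poles_in_mono: "r \<le> R \<Longrightarrow> poles_in f r \<subseteq> poles_in f R"
  by (auto simp: poles_in_def)

text \<open>This is the contribution of one simple pole of modulus c to the integral in
  \<open>counting_fun\<close>.\<close>

lemma has_integral_jump_over_t:
  fixes c r :: real
  assumes "0 < c" "c \<le> r"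
  shows "((\<lambda>t. if c \<le> t then 1 / t else 0) has_integral (ln r - ln c)) {0..r}"
proof -
  have "((\<lambda>t. 1 / t) has_integral (ln r - ln c)) {c..r}"
    by (rule fundamental_theorem_of_calculus[where f = ln])
      (use assms in \<open>auto intro!: derivative_eq_intros simp flip: has_real_derivative_iff_has_vector_derivative\<close>)
  then have "((\<lambda>t. if t \<in> {c..r} then 1 / t else 0) has_integral (ln r - ln c)) {0..r}"
    using assms by (subst has_integral_restrict) auto
  then show ?thesis
    by (rule has_integral_eq[rotated]) auto
qed

text \<open>A pole at the origin contributes the right term because \<^prop>\<open>ln (0::real) = 0\<close>.\<close>

lemma counting_fun_eq:
  assumes f: "f meromorphic_on UNIV" and r: "r > 0"
  shows "counting_fun f r = (\<Sum>b\<in>poles_in f r. pole_mult f b * (ln r - ln (norm b)))"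
proof -
  let ?P = "poles_in f r" and ?Z = "poles_in f 0"
  have fin: "finite ?P" by (rule finite_poles_in[OF f])
  have Z: "?Z = (if is_pole f 0 then {0} else {})" by (auto simp: poles_in_def)
  have ZP: "?Z \<subseteq> ?P" using r by (auto simp: poles_in_def)
  have dec: "(real (pole_count f t) - real (pole_count f 0)) / t
     = (\<Sum>b\<in>?P - ?Z. pole_mult f b * (if norm b \<le> t then 1 / t else 0))" if "t \<in> {0..r}" for t
  proof -
    have sub: "poles_in f t \<subseteq> ?P" "?Z \<subseteq> poles_in f t" using that by (auto simp: poles_in_def)
    have "real (pole_count f t) = (\<Sum>b\<in>poles_in f t - ?Z. real (pole_mult f b)) + real (pole_count f 0)"
      unfolding pole_count_eq of_nat_sum
      by (rule sum.subset_diff[OF sub(2)]) (rule finite_subset[OF sub(1) fin])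
    also have "(\<Sum>b\<in>poles_in f t - ?Z. real (pole_mult f b))
        = (\<Sum>b\<in>?P - ?Z. real (pole_mult f b) * (if norm b \<le> t then 1 else 0))"
      using fin that by (intro sum.mono_neutral_cong_left) (auto simp: poles_in_def)
    finally have "real (pole_count f t) - real (pole_count f 0)
        = (\<Sum>b\<in>?P - ?Z. real (pole_mult f b) * (if norm b \<le> t then 1 else 0))" by simp
    then show ?thesis by (simp add: sum_divide_distrib) (intro sum.cong, auto)
  qed
  have "((\<lambda>t. \<Sum>b\<in>?P - ?Z. pole_mult f b * (if norm b \<le> t then 1 / t else 0)) has_integral
     (\<Sum>b\<in>?P - ?Z. pole_mult f b * (ln r - ln (norm b)))) {0..r}"
    using fin by (intro has_integral_sum has_integral_mult_right has_integral_jump_over_t)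
      (auto simp: poles_in_def)
  then have "((\<lambda>t. (real (pole_count f t) - real (pole_count f 0)) / t) has_integral
     (\<Sum>b\<in>?P - ?Z. pole_mult f b * (ln r - ln (norm b)))) {0..r}"
    by (rule has_integral_eq[rotated]) (simp add: dec)
  then have "counting_fun f r = (\<Sum>b\<in>?P - ?Z. pole_mult f b * (ln r - ln (norm b))) + real (pole_count f 0) * ln r"
    unfolding counting_fun_def by (simp add: integral_unique)
  also have "real (pole_count f 0) * ln r = (\<Sum>b\<in>?Z. pole_mult f b * (ln r - ln (norm b)))"
    unfolding pole_count_eq by (simp add: Z)
  also have "(\<Sum>b\<in>?P - ?Z. pole_mult f b * (ln r - ln (norm b))) + \<dots> = (\<Sum>b\<in>?P. pole_mult f b * (ln r - ln (norm b)))"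
    by (rule sum.subset_diff[OF ZP fin, symmetric])
  finally show ?thesis .
qed

lemma counting_term_nonneg: "norm b \<le> r \<Longrightarrow> r \<ge> 1 \<Longrightarrow> ln r - ln (norm b) \<ge> 0"
  by (cases "b = 0") auto

lemma counting_nonneg:
  assumes f: "f meromorphic_on UNIV" and r: "r \<ge> 1"
  shows "counting_fun f r \<ge> 0"
  using counting_fun_eq[OF f, of r] r counting_term_nonneg
  by (auto intro!: sum_nonneg mult_nonneg_nonneg simp: poles_in_def)

lemma nevanlinna_char_nonneg:
  assumes "f meromorphic_on UNIV" "r \<ge> 1"
  shows "nevanlinna_char f r \<ge> 0" "proximity_fun f r \<le> nevanlinna_char f r"
    "counting_fun f r \<le> nevanlinna_char f r"
  using counting_nonneg[OF assms] proximity_nonneg[of f r] by (auto simp: nevanlinna_char_def)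

text \<open>Each pole of modulus at most r contributes at least ln R - ln r to N(R). Bounds on the
  characteristic thereby become bounds on numbers of poles.\<close>

lemma pole_count_le_counting:
  assumes f: "f meromorphic_on UNIV" and r: "1 \<le> r" "r \<le> R"
  shows "pole_count f r * (ln R - ln r) \<le> counting_fun f R"
proof -
  have "pole_count f r * (ln R - ln r) = (\<Sum>b\<in>poles_in f r. pole_mult f b * (ln R - ln r))"
    unfolding pole_count_eq by (simp add: sum_distrib_right)
  also have "\<dots> \<le> (\<Sum>b\<in>poles_in f r. pole_mult f b * (ln R - ln (norm b)))"
  proof (intro sum_mono mult_left_mono)
    fix b assume "b \<in> poles_in f r"
    \<comment> \<open>A pole at the origin is covered by ln 0 = 0 and r >= 1.\<close>
    then have "ln (norm b) \<le> ln r" using r by (cases "b = 0") (auto simp: poles_in_def)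
    then show "ln R - ln r \<le> ln R - ln (norm b)" by simp
  qed auto
  also have "\<dots> \<le> (\<Sum>b\<in>poles_in f R. pole_mult f b * (ln R - ln (norm b)))"
    using r counting_term_nonneg[of _ R]
    by (intro sum_mono2 finite_poles_in[OF f] poles_in_mono mult_nonneg_nonneg) (auto simp: poles_in_def)
  also have "\<dots> = counting_fun f R" using counting_fun_eq[OF f, of R] r by simp
  finally show ?thesis .
qed

text \<open>\<open>zor_poly f 0 0\<close> is the leading Laurent coefficient of f at 0, so this is
  the constant term of Jensen's formula.\<close>

definition jensen_const :: "(complex \<Rightarrow> complex) \<Rightarrow> real" where
  "jensen_const f = ln (norm (zor_poly f 0 0))"

lemma jensen_formula:
  assumes f: "nonzero_meromorphic f" and r: "r > 0"
  shows "circle_mean (\<lambda>z. ln (norm (f z))) r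
     = counting_fun (\<lambda>z. inverse (f z)) r - counting_fun f r + jensen_const f"
proof -
  let ?S = "zeros_poles f r" and ?g = "\<lambda>z. inverse (f z)"
  have fin: "finite ?S" by (rule finite_zeros_poles[OF f])
  have g: "nonzero_meromorphic ?g" by (rule nonzero_meromorphic_inverse[OF f])
  obtain k where k: "k analytic_on cball 0 r" "\<And>z. norm z \<le> r \<Longrightarrow> k z \<noteq> 0"
      "\<forall>\<^sub>\<approx>z. f z = k z * (\<Prod>a\<in>?S. (z - a) powi zorder f a)"
    using meromorphic_factorization[OF f, of r] by blast
  have 1: "circle_mean (\<lambda>z. ln (norm (f z))) r = ln (norm (k 0)) + (\<Sum>a\<in>?S. zorder f a * ln r)"
    using poisson_meromorphic(2)[OF f r k, of 0] circle_mean_poisson_0[OF r, of "\<lambda>z. ln (norm (f z))"] r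
    by (simp add: norm_mult power2_eq_square)
  let ?T = "?S - {0}"
  have S0: "finite ?T" using fin by auto
  \<comment> \<open>This is f without its power of z at the origin. It is analytic there, and its
    value at 0 is the leading Laurent coefficient.\<close>
  define h where "h = (\<lambda>z. k z * (\<Prod>a\<in>?T. (z - a) powi zorder f a))"
  have "k analytic_on {0}" using k(1) r by (auto intro: analytic_on_subset)
  then have "h analytic_on {0}" unfolding h_def
    by (intro analytic_intros) auto
  then have hlim: "(h \<longlongrightarrow> h 0) (at 0)" using analytic_at_imp_isCont isContD by blast
  have "eventually (\<lambda>z. f z = k z * (\<Prod>a\<in>?S. (z - a) powi zorder f a)) (at 0)"
    using k(3) eventually_cosparse_imp_eventually_at by blast
  moreover have "eventually (\<lambda>z::complex. z \<noteq> 0) (at 0)" by (auto simp: eventually_at_filter)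
  ultimately have "eventually (\<lambda>z. h z = f z * (z - 0) powi - zorder f 0) (at 0)"
  proof eventually_elim
    case (elim z)
    show ?case
    proof (cases "0 \<in> ?S")
      case True
      then have "f z = k z * (z powi zorder f 0 * (\<Prod>a\<in>?T. (z - a) powi zorder f a))"
        using elim prod.remove[OF fin True, of "\<lambda>a. (z - a) powi zorder f a"] by simp
      moreover have "z powi zorder f 0 * z powi - zorder f 0 = 1"
        using elim by (simp add: power_int_minus)
      ultimately show ?thesis by (simp add: h_def mult_ac)
    next
      case False
      then have "zorder f 0 = 0" using r by (auto simp: zeros_poles_def)
      moreover have "?T = ?S" using False by auto
      ultimately show ?thesis using elim by (simp add: h_def)
    qed
  qed
  then have "((\<lambda>z. f z * (z - 0) powi - zorder f 0) \<longlongrightarrow> h 0) (at 0)"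
    using hlim by (blast intro: Lim_transform_eventually)
  then have "zor_poly f 0 0 = h 0"
    by (intro zor_poly_eqI[where g = "\<lambda>x. x" and F = "at 0"] nonzero_meromorphic_isolated[OF f]
        nonzero_meromorphicD(3)[OF f]) (auto simp: filterlim_ident)
  then have 2: "jensen_const f = ln (norm (k 0)) + (\<Sum>a\<in>?T. zorder f a * ln (norm (0 - a)))"
    using ln_norm_factorization[OF S0, of k 0 "zorder f"] k(2)[of 0] r by (simp add: jensen_const_def h_def)
  \<comment> \<open>The term a = 0 may be put back because ln 0 = 0.\<close>
  have 3: "(\<Sum>a\<in>?T. zorder f a * ln (norm (0 - a))) = (\<Sum>a\<in>?S. zorder f a * ln (norm a))"
    using fin by (intro sum.mono_neutral_cong_left) auto
  have N: "counting_fun u r = (\<Sum>a\<in>?S. pole_mult u a * (ln r - ln (norm a)))"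
    if u: "nonzero_meromorphic u" "poles_in u r \<subseteq> ?S" for u
    unfolding counting_fun_eq[OF nonzero_meromorphicD(1)[OF u(1)] r]
    by (rule sum_poles_in_superset[OF u(1) fin u(2) zeros_poles_subset])
  have sg: "poles_in ?g r \<subseteq> ?S"
    using poles_in_subset[OF g, of r] zorder_inverse_eq[OF f] by (auto simp: zeros_poles_def)
  have "counting_fun ?g r - counting_fun f r = (\<Sum>a\<in>?S. zorder f a * (ln r - ln (norm a)))"
    unfolding N[OF g sg] N[OF f poles_in_subset[OF f]] sum_subtractf[symmetric]
    by (intro sum.cong) (auto simp: pole_mult_eq zorder_inverse_eq[OF f])
  then show ?thesis unfolding 1 2 3 by (simp add: right_diff_distrib sum_subtractf)
qed

lemma log_plus_diff: "x \<ge> 0 \<Longrightarrow> log_plus x - log_plus (inverse x) = ln x"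
  by (cases "x = 0") (auto simp: log_plus_def ln_inverse)

lemma first_fundamental_theorem:
  assumes f: "nonzero_meromorphic f" and r: "r > 0"
  shows "nevanlinna_char f r = nevanlinna_char (\<lambda>z. inverse (f z)) r + jensen_const f"
proof -
  let ?g = "\<lambda>z. inverse (f z)"
  have i: "circle_integrable (\<lambda>z. log_plus (norm (f z))) r" "circle_integrable (\<lambda>z. log_plus (norm (?g z))) r"
    using f nonzero_meromorphic_inverse[OF f] r
    by (auto intro!: circle_integrable_log_plus simp: nonzero_meromorphic_def)
  have "circle_mean (\<lambda>z. ln (norm (f z))) r = circle_mean (\<lambda>z. log_plus (norm (f z)) + (-1) * log_plus (norm (?g z))) r"
    using log_plus_diff by (simp add: norm_inverse)
  also have "\<dots> = proximity_fun f r - proximity_fun ?g r"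
    unfolding proximity_fun_eq
    by (subst circle_mean_add[OF i(1) circle_integrable_cmult[OF i(2)]]) (simp only: circle_mean_cmult; simp)
  finally show ?thesis using jensen_formula[OF f r] by (simp add: nevanlinna_char_def)
qed

text \<open>This averages the Green function of the large disc over a smaller circle. Added to the
  term of b in N(r), the mean gives ln R - ln |b|, the term of b in N(R).\<close>

lemma circle_mean_green:
  assumes "0 < r" "r < R" "norm b \<le> R"
  shows "circle_integrable (\<lambda>z. ln (norm (of_real (R\<^sup>2) - cnj b * z) / R) - ln (norm (z - b))) r"
    "circle_mean (\<lambda>z. ln (norm (of_real (R\<^sup>2) - cnj b * z) / R) - ln (norm (z - b))) r
      = ln R - (if norm b \<le> r then ln r else ln (norm b))"
proof -
  define k where "k = (\<lambda>z. (of_real (R\<^sup>2) - cnj b * z) / of_real R)"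
  have nz: "k z \<noteq> 0" if "norm z \<le> r" for z
  proof -
    have "norm b * norm z \<le> R * r" using that assms by (intro mult_mono) auto
    also have "\<dots> < R * R" using assms by simp
    finally show ?thesis using assms reflection_nonzero by (simp add: k_def)
  qed
  have k: "k analytic_on cball 0 r" unfolding k_def using assms by (intro analytic_intros) auto
  have nk: "norm (of_real (R\<^sup>2) - cnj b * z) / R = norm (k z)" for z
    using assms by (simp add: k_def norm_divide)
  have k0: "norm (k 0) = R" using assms by (simp add: k_def norm_divide norm_mult power2_eq_square)
  have ki: "circle_integrable (\<lambda>z. ln (norm (k z))) r" "circle_mean (\<lambda>z. ln (norm (k z))) r = ln R"
    using poisson_ln_nonvanishing[OF k nz, of 0] assms
      circle_mean_poisson_0[OF assms(1), of "\<lambda>z. ln (norm (k z))"] k0 by auto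
  note li = circle_mean_ln_linear[OF assms(1), of b]
  have eq: "(\<lambda>z. ln (norm (of_real (R\<^sup>2) - cnj b * z) / R) - ln (norm (z - b)))
      = (\<lambda>z. ln (norm (k z)) + (-1) * ln (norm (z - b)))" unfolding nk by simp
  show "circle_integrable (\<lambda>z. ln (norm (of_real (R\<^sup>2) - cnj b * z) / R) - ln (norm (z - b))) r"
    unfolding eq by (intro circle_integrable_add ki circle_integrable_cmult li)
  show "circle_mean (\<lambda>z. ln (norm (of_real (R\<^sup>2) - cnj b * z) / R) - ln (norm (z - b))) r
      = ln R - (if norm b \<le> r then ln r else ln (norm b))"
    unfolding eq circle_mean_add[OF ki(1) circle_integrable_cmult[OF li(1)]] circle_mean_cmult ki(2) li(2)
    by simp
qed

text \<open>
  In fact the characteristic is increasing. The factor 3 comes from bounding the Poisson kernel at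
  \<^prop>\<open>norm w \<le> R / 2\<close> and does not matter for the orders.
\<close>

lemma nevanlinna_char_quasi_mono:
  assumes f: "nonzero_meromorphic f" and r: "0 < r" "2 * r \<le> R" "1 \<le> R"
  shows "nevanlinna_char f r \<le> 3 * nevanlinna_char f R"
proof -
  have R: "r < R" "R > 0" using r by auto
  have mf: "f meromorphic_on A" for A by (rule nonzero_meromorphicD(1)[OF f])
  let ?P = "poles_in f R"
  have fin: "finite ?P" by (rule finite_poles_in[OF mf])
  define G where "G = (\<lambda>b z. ln (norm (of_real (R\<^sup>2) - cnj b * z) / R) - ln (norm (z - b)))"
  have Gi: "circle_integrable (G b) r" and Gm: "circle_mean (G b) r = ln R - (if norm b \<le> r then ln r else ln (norm b))"
    if "b \<in> ?P" for b
    using circle_mean_green[OF r(1) R(1), of b] that by (auto simp: G_def poles_in_def)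
  define X where "X = {z\<in>cball 0 r. \<not> f analytic_on {z}}"
  have X: "finite X" unfolding X_def
    by (rule cosparse_finite_cball[OF meromorphic_on_imp_analytic_cosparse[OF mf]])
  have Si: "circle_integrable (\<lambda>z. \<Sum>b\<in>?P. pole_mult f b * G b z) r"
    by (intro circle_integrable_sum circle_integrable_cmult Gi)
  have "proximity_fun f r \<le> circle_mean (\<lambda>z. 3 * proximity_fun f R + (\<Sum>b\<in>?P. pole_mult f b * G b z)) r"
    unfolding proximity_fun_eq[of f r]
  proof (rule circle_mean_mono_finite[OF r(1) X])
    show "circle_integrable (\<lambda>z. 3 * proximity_fun f R + (\<Sum>b\<in>?P. pole_mult f b * G b z)) r"
      by (intro circle_integrable_add Si) auto
    show "log_plus (cmod (f z)) \<le> 3 * proximity_fun f R + (\<Sum>b\<in>?P. pole_mult f b * G b z)"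
      if "norm z = r" "z \<notin> X" for z
      unfolding G_def by (rule pointwise_le_proximity[OF f]) (use that r R in \<open>auto simp: X_def\<close>)
  qed (intro circle_integrable_log_plus mf r)
  also have "\<dots> = 3 * proximity_fun f R + (\<Sum>b\<in>?P. pole_mult f b * circle_mean (G b) r)"
    by (subst circle_mean_add[OF _ Si], simp, subst circle_mean_sum)
      (auto intro!: circle_integrable_cmult Gi simp: circle_mean_cmult)
  also have "(\<Sum>b\<in>?P. pole_mult f b * circle_mean (G b) r)
      = (\<Sum>b\<in>?P. pole_mult f b * (ln R - (if norm b \<le> r then ln r else ln (norm b))))"
    by (simp add: Gm)
  finally have m: "proximity_fun f r \<le> 3 * proximity_fun f R +
     (\<Sum>b\<in>?P. pole_mult f b * (ln R - (if norm b \<le> r then ln r else ln (norm b))))" .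
  have "counting_fun f r = (\<Sum>b\<in>poles_in f r. pole_mult f b * (ln r - ln (norm b)))"
    by (rule counting_fun_eq[OF mf r(1)])
  also have "\<dots> = (\<Sum>b\<in>?P. if norm b \<le> r then pole_mult f b * (ln r - ln (norm b)) else 0)"
    using fin R by (intro sum.mono_neutral_cong_left) (auto simp: poles_in_def)
  finally have "nevanlinna_char f r \<le> 3 * proximity_fun f R +
     ((\<Sum>b\<in>?P. pole_mult f b * (ln R - (if norm b \<le> r then ln r else ln (norm b)))) +
      (\<Sum>b\<in>?P. if norm b \<le> r then pole_mult f b * (ln r - ln (norm b)) else 0))"
    using m by (simp add: nevanlinna_char_def)
  \<comment> \<open>A pole with |b| <= r gives (ln R - ln r) + (ln r - ln |b|), any other pole gives
    ln R - ln |b| from the first sum alone.\<close>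
  also have "(\<Sum>b\<in>?P. pole_mult f b * (ln R - (if norm b \<le> r then ln r else ln (norm b)))) +
      (\<Sum>b\<in>?P. if norm b \<le> r then pole_mult f b * (ln r - ln (norm b)) else 0)
      = (\<Sum>b\<in>?P. pole_mult f b * (ln R - ln (norm b)))"
    unfolding sum.distrib[symmetric] by (intro sum.cong) (auto simp: algebra_simps)
  also have "\<dots> = counting_fun f R" by (rule counting_fun_eq[OF mf R(2), symmetric])
  finally show ?thesis using counting_nonneg[OF mf r(3)] by (simp add: nevanlinna_char_def)
qed

lemma nevanlinna_char_cong:
  assumes "\<forall>\<^sub>\<approx>z. f z = g z" "r > 0"
  shows "nevanlinna_char f r = nevanlinna_char g r"
proof -
  have at: "eventually (\<lambda>z. f z = g z) (at a)" for a
    using assms(1) by (auto simp: eventually_cosparse_open_eq)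
  have "is_pole f a = is_pole g a" "zorder f a = zorder g a" for a
    using is_pole_cong[OF at refl] zorder_cong[OF at refl] by auto
  then have "pole_count f = pole_count g" by (simp add: pole_count_def fun_eq_iff)
  moreover have "proximity_fun f r = proximity_fun g r"
    unfolding proximity_fun_eq
    by (rule circle_mean_cong_finite[OF assms(2) cosparse_finite_cball[OF assms(1), of r]]) auto
  ultimately show ?thesis by (simp add: nevanlinna_char_def counting_fun_def)
qed

lemma nevanlinna_char_const: "nevanlinna_char (\<lambda>_. c) r = log_plus (norm c)"
proof -
  have "\<not> is_pole (\<lambda>_. c) a" for a :: complex by (rule analytic_at_imp_no_pole) auto
  then have "pole_count (\<lambda>_. c) t = 0" for t by (simp add: pole_count_def)
  then show ?thesis by (simp add: nevanlinna_char_def counting_fun_def proximity_fun_eq)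
qed

lemma log_plus_add_le: "x \<ge> 0 \<Longrightarrow> y \<ge> 0 \<Longrightarrow> log_plus (x + y) \<le> log_plus x + log_plus y + ln 2"
proof -
  assume xy: "x \<ge> 0" "y \<ge> 0"
  show ?thesis
  proof (cases "x + y \<le> 1")
    case True
    then have "log_plus (x + y) = 0" using xy by (cases "x + y = 0") (auto simp: log_plus_def)
    then show ?thesis using log_plus_nonneg[of x] log_plus_nonneg[of y] by simp
  next
    case False
    define m where "m = max x y"
    have m: "m > 0" "x + y \<le> 2 * m" using False xy by (auto simp: m_def)
    have "ln (x + y) \<le> ln (2 * m)" using m False by (subst ln_le_cancel_iff) auto
    also have "\<dots> = ln 2 + ln m" using m by (simp add: ln_mult)
    also have "ln m \<le> log_plus x + log_plus y"
      using ln_le_log_plus[of x] ln_le_log_plus[of y] log_plus_nonneg[of x] log_plus_nonneg[of y]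
      unfolding m_def max_def by (smt (verit))
    finally have "ln (x + y) \<le> log_plus x + log_plus y + ln 2" by simp
    moreover have "0 \<le> log_plus x + log_plus y + ln 2" by (simp add: add_nonneg_nonneg)
    ultimately show ?thesis unfolding log_plus_def[of "x + y"] by simp
  qed
qed

text \<open>Subtracting a constant preserves poles and their multiplicities, so only the proximity
  function changes, and there \<open>log_plus\<close> is subadditive up to ln 2.\<close>

lemma nevanlinna_char_diff_const_le:
  assumes f: "f meromorphic_on UNIV" and r: "r > 0"
  shows "nevanlinna_char (\<lambda>z. f z - c) r \<le> nevanlinna_char f r + log_plus (norm c) + ln 2"
proof -
  have "is_pole (\<lambda>z. f z - c) a = is_pole f a" for a
  proof -
    have 1: "filterlim (\<lambda>z. f z - c) at_infinity (at a)" if "filterlim f at_infinity (at a)"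
      using tendsto_add_filterlim_at_infinity'[OF that tendsto_const[of "-c"]] by simp
    have 2: "filterlim f at_infinity (at a)" if "filterlim (\<lambda>z. f z - c) at_infinity (at a)"
      using tendsto_add_filterlim_at_infinity'[OF that tendsto_const[of c]] by simp
    show ?thesis unfolding is_pole_def using 1 2 by blast
  qed
  moreover have "zorder (\<lambda>z. f z - c) a = zorder f a" if "is_pole f a" for a
  proof (cases "c = 0")
    case False
    have "zorder (\<lambda>z. f z + (- c)) a = zorder f a"
    proof (rule zorder_add1)
      show "f meromorphic_on {a}" using f by (auto intro: meromorphic_on_subset)
      then have iso: "isolated_singularity_at f a" by (simp add: meromorphic_at_iff)
      have "eventually (\<lambda>z. f z \<noteq> 0) (at a)" using that non_zero_neighbour_pole by blast
      then show "\<exists>\<^sub>F z in at a. f z \<noteq> 0" by (intro eventually_frequently) auto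
      have "zorder f a < 0" by (rule isolated_pole_imp_neg_zorder[OF iso that])
      moreover have "zorder (\<lambda>_. - c) a = 0"
        by (rule zorder_analytic_nonzero) (use False in auto)
      ultimately show "zorder f a < zorder (\<lambda>_. - c) a" by simp
    qed (use False in \<open>auto intro!: eventually_frequently\<close>)
    then show ?thesis by simp
  qed simp
  ultimately have "pole_count (\<lambda>z. f z - c) = pole_count f"
    unfolding pole_count_def by (intro ext sum.cong) auto
  then have "counting_fun (\<lambda>z. f z - c) r = counting_fun f r" by (simp add: counting_fun_def)
  moreover have "proximity_fun (\<lambda>z. f z - c) r \<le> circle_mean (\<lambda>z. log_plus (norm (f z)) + (log_plus (norm c) + ln 2)) r"
    unfolding proximity_fun_eq
  proof (rule circle_mean_mono_finite[OF r finite.emptyI])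
    show "circle_integrable (\<lambda>z. log_plus (cmod (f z - c))) r"
      using f r by (intro circle_integrable_log_plus meromorphic_intros)
    show "circle_integrable (\<lambda>z. log_plus (cmod (f z)) + (log_plus (cmod c) + ln 2)) r"
      using f r by (intro circle_integrable_add circle_integrable_log_plus) auto
    show "log_plus (cmod (f z - c)) \<le> log_plus (cmod (f z)) + (log_plus (cmod c) + ln 2)" for z
    proof -
      have "log_plus (cmod (f z - c)) \<le> log_plus (cmod (f z) + cmod c)"
      proof (cases "f z = c")
        case True then show ?thesis by (simp add: log_plus_def)
      next
        case False
        then have "ln (cmod (f z - c)) \<le> ln (cmod (f z) + cmod c)"
          using norm_triangle_ineq4[of "f z" c] by (intro ln_mono) auto
        then show ?thesis by (auto simp: log_plus_def)
      qed
      then show ?thesis using log_plus_add_le[of "cmod (f z)" "cmod c"] by simp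
    qed
  qed
  ultimately show ?thesis
    using f r by (simp add: nevanlinna_char_def circle_mean_add circle_integrable_log_plus proximity_fun_eq)
qed

text \<open>At a point a of analyticity, f - f(a) has a zero, so its inverse has a pole and a
  counting function of size at least ln r - O(1). The first fundamental theorem carries this growth
  over to f.\<close>

lemma nevanlinna_char_at_top:
  assumes f: "f meromorphic_on UNIV" and nc: "\<And>c. \<not> (\<forall>\<^sub>\<approx>z. f z = c)"
  shows "filterlim (nevanlinna_char f) at_top at_top"
proof -
  have "eventually (\<lambda>z. f analytic_on {z}) (at 0)"
    using meromorphic_on_imp_analytic_cosparse[OF f] by (auto simp: eventually_cosparse_open_eq)
  then obtain a where a: "f analytic_on {a}"
    using eventually_happens[of _ "at (0::complex)"] by (auto simp: trivial_limit_at)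
  define g where "g = (\<lambda>z. f z - f a)"
  have mg: "g meromorphic_on UNIV" unfolding g_def using f by (intro meromorphic_intros)
  have g: "nonzero_meromorphic g"
  proof (rule ccontr)
    assume "\<not> ?thesis"
    then have "\<forall>\<^sub>\<approx>z. g z = 0" using not_nonzero_meromorphic[OF mg] by blast
    then have "\<forall>\<^sub>\<approx>z. f z = f a" by eventually_elim (simp add: g_def)
    then show False using nc by blast
  qed
  have "g analytic_on {a}" unfolding g_def using a by (intro analytic_intros)
  then have "isCont g a" by (rule analytic_at_imp_isCont)
  then have "(g \<longlongrightarrow> 0) (at a)" by (simp add: isCont_def g_def)
  then have "isolated_zero g a" using nonzero_meromorphicD(2)[OF g] by (simp add: isolated_zero_def)
  then have za: "zorder g a > 0" using isolated_zero_iff_zorder_pos[OF g] by blast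
  define h where "h = (\<lambda>z. inverse (g z))"
  have h: "nonzero_meromorphic h" unfolding h_def by (rule nonzero_meromorphic_inverse[OF g])
  have hm: "h meromorphic_on UNIV" using h by (simp add: nonzero_meromorphic_def)
  have "zorder h a < 0" unfolding h_def zorder_inverse_eq[OF g] using za by simp
  then have pa: "is_pole h a" "pole_mult h a \<ge> 1" using is_pole_iff_zorder_neg[OF h] by (auto simp: pole_mult_def)
  define C where "C = log_plus (norm (f a)) + ln 2 - jensen_const g"
  have "ln r - ln (max 1 (norm a)) - C \<le> nevanlinna_char f r" if r: "r \<ge> max 1 (norm a)" for r
  proof -
    let ?s = "max 1 (norm a)"
    have r0: "r > 0" "r \<ge> 1" using r by auto
    have "1 \<le> pole_count h ?s"
    proof -
      have "pole_mult h a \<le> pole_count h ?s"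
        unfolding pole_count_eq
        by (rule member_le_sum) (use pa finite_poles_in[OF hm] in \<open>auto simp: poles_in_def\<close>)
      then show ?thesis using pa by simp
    qed
    then have "1 * (ln r - ln ?s) \<le> pole_count h ?s * (ln r - ln ?s)"
      using r by (intro mult_right_mono) auto
    also have "\<dots> \<le> counting_fun h r"
      using r by (intro pole_count_le_counting[OF hm]) auto
    also have "\<dots> \<le> nevanlinna_char h r" by (rule nevanlinna_char_nonneg(3)[OF hm r0(2)])
    also have "\<dots> = nevanlinna_char g r - jensen_const g"
      using first_fundamental_theorem[OF g r0(1)] by (simp add: h_def)
    also have "nevanlinna_char g r \<le> nevanlinna_char f r + log_plus (norm (f a)) + ln 2"
      unfolding g_def by (rule nevanlinna_char_diff_const_le[OF f r0(1)])
    finally show ?thesis by (simp add: C_def)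
  qed
  then have ev: "eventually (\<lambda>r. ln r - ln (max 1 (norm a)) - C \<le> nevanlinna_char f r) at_top"
    using eventually_ge_at_top by (rule eventually_mono[rotated])
  have "filterlim (\<lambda>r::real. - (ln (max 1 (norm a)) + C) + ln r) at_top at_top"
    by (rule filterlim_tendsto_add_at_top[OF tendsto_const ln_at_top])
  then have "filterlim (\<lambda>r::real. ln r - ln (max 1 (norm a)) - C) at_top at_top"
    by (simp add: algebra_simps)
  then show ?thesis using ev by (rule filterlim_at_top_mono)
qed

text \<open>The numerator of the Green function is at most 2 R. What is left depends on w only
  through |w - b|, which Jensen's formula can average after the substitution of g z for w.\<close>

lemma pointwise_le_proximity':
  assumes f: "nonzero_meromorphic f" and w: "norm w \<le> R / 2" "R > 0" "f analytic_on {w}"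
  shows "log_plus (norm (f w)) \<le> 3 * proximity_fun f R
     + (\<Sum>b\<in>poles_in f R. pole_mult f b * (ln (2 * R) - ln (norm (w - b))))"
proof -
  have "ln (norm (of_real (R\<^sup>2) - cnj b * w) / R) \<le> ln (2 * R)" if "b \<in> poles_in f R" for b
  proof -
    have "norm b * norm w \<le> R * (R / 2)"
      using that w by (intro mult_mono) (auto simp: poles_in_def)
    moreover have "R * R > 0" using w by simp
    ultimately have b: "norm b * norm w < R * R" by simp
    have "norm (of_real (R\<^sup>2) - cnj b * w) \<le> R * R + norm b * norm w"
      using norm_triangle_ineq4[of "of_real (R\<^sup>2)" "cnj b * w"] by (simp add: norm_mult power2_eq_square)
    also have "\<dots> \<le> R * (2 * R)" using b by simp
    finally have up: "norm (of_real (R\<^sup>2) - cnj b * w) / R \<le> 2 * R"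
      using w by (simp add: divide_le_eq mult_ac)
    have "R * R - norm b * norm w > 0" using b by simp
    moreover have "R * R - norm b * norm w \<le> norm (of_real (R\<^sup>2) - cnj b * w)"
      using norm_triangle_ineq2[of "of_real (R\<^sup>2)" "cnj b * w"] by (simp add: norm_mult power2_eq_square)
    ultimately have "norm (of_real (R\<^sup>2) - cnj b * w) / R > 0"
      using w(2) by (intro divide_pos_pos) linarith+
    then show ?thesis using up by (rule ln_mono[rotated])
  qed
  then have "(\<Sum>b\<in>poles_in f R. pole_mult f b * (ln (norm (of_real (R\<^sup>2) - cnj b * w) / R) - ln (norm (w - b))))
     \<le> (\<Sum>b\<in>poles_in f R. pole_mult f b * (ln (2 * R) - ln (norm (w - b))))"
    by (intro sum_mono mult_left_mono) auto
  then show ?thesis using pointwise_le_proximity[OF f w] by simp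
qed

section \<open>Growth of transcendental functions\<close>

text \<open>Cauchy's inequality kills all Taylor coefficients of index above N. A bound for
  arbitrarily large R is enough, and the negation of a growth condition yields no more than
  that.\<close>

lemma entire_polynomial_bound_imp_polynomial:
  assumes h: "h holomorphic_on UNIV"
    and bd: "\<exists>\<^sub>F R in at_top. \<forall>z. norm z \<le> R \<longrightarrow> norm (h z) \<le> K * R ^ N"
  shows "\<exists>A. \<forall>z. h z = poly A z"
proof -
  have z: "(deriv ^^ j) h 0 = 0" if j: "j > N" for j
  proof (rule ccontr)
    assume nz: "(deriv ^^ j) h 0 \<noteq> 0"
    define d where "d = norm ((deriv ^^ j) h 0)"
    have d: "d > 0" using nz by (simp add: d_def)
    have "((\<lambda>R. fact j * \<bar>K\<bar> * inverse R) \<longlongrightarrow> fact j * \<bar>K\<bar> * 0) at_top"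
      by (intro tendsto_intros tendsto_inverse_0_at_top filterlim_ident)
    then have "eventually (\<lambda>R. fact j * \<bar>K\<bar> * inverse R < d) at_top"
      using d by (simp add: order_tendsto_iff)
    then have ev: "eventually (\<lambda>R. fact j * \<bar>K\<bar> * inverse R < d \<and> R \<ge> 1) at_top"
      using eventually_ge_at_top[of 1] by eventually_elim auto
    from frequently_eventually_frequently[OF bd ev]
    obtain R where R: "\<forall>z. norm z \<le> R \<longrightarrow> norm (h z) \<le> K * R ^ N" "fact j * \<bar>K\<bar> * inverse R < d" "R \<ge> 1"
      by (auto dest: frequently_ex)
    have "norm ((deriv ^^ j) h 0) \<le> fact j * (K * R ^ N) / R ^ j"
      using h R
      by (intro Cauchy_inequality) (auto intro: holomorphic_on_subset holomorphic_on_imp_continuous_on)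
    also have "\<dots> \<le> fact j * (\<bar>K\<bar> * R ^ N) / R ^ j"
      using R by (intro divide_right_mono mult_left_mono mult_right_mono) auto
    also have "\<dots> = fact j * \<bar>K\<bar> * (R ^ N / R ^ j)" by simp
    also have "R ^ N / R ^ j \<le> inverse R"
    proof -
      have "R ^ N * R = R ^ Suc N" by simp
      also have "\<dots> \<le> R ^ j" using j R by (intro power_increasing) auto
      finally show ?thesis using R by (simp add: field_simps)
    qed
    then have "fact j * \<bar>K\<bar> * (R ^ N / R ^ j) \<le> fact j * \<bar>K\<bar> * inverse R"
      by (intro mult_left_mono) auto
    finally show False using R by (simp add: d_def)
  qed
  define A where "A = (\<Sum>j\<le>N. monom ((deriv ^^ j) h 0 / fact j) j)"
  have "h w = poly A w" for w
  proof -
    have "(\<lambda>n. (deriv ^^ n) h 0 / fact n * (w - 0) ^ n) sums h w"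
      by (rule holomorphic_power_series[of h 0 "norm w + 1"]) (use h in \<open>auto intro: holomorphic_on_subset\<close>)
    moreover have "(\<lambda>n. (deriv ^^ n) h 0 / fact n * (w - 0) ^ n) sums (\<Sum>n\<le>N. (deriv ^^ n) h 0 / fact n * (w - 0) ^ n)"
      by (rule sums_finite) (use z in auto)
    ultimately have "h w = (\<Sum>n\<le>N. (deriv ^^ n) h 0 / fact n * (w - 0) ^ n)" by (rule sums_unique2)
    then show ?thesis by (simp add: A_def poly_sum poly_monom)
  qed
  then show ?thesis by blast
qed

text \<open>From n(sqrt r) (ln r) / 2 <= N(r) < C ln r one gets n(sqrt r) < 2 C for arbitrarily
  large r. Any finite set of poles lies within sqrt r eventually, so its size is bounded.\<close>

lemma finite_poles_of_log_growth:
  assumes f: "nonzero_meromorphic f"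
    and gr: "\<exists>\<^sub>F r in at_top. nevanlinna_char f r < C * ln r"
  shows "finite {b. is_pole f b}"
proof -
  have mf: "f meromorphic_on UNIV" using f by (simp add: nonzero_meromorphic_def)
  have "card G \<le> nat \<lceil>2 * C\<rceil>" if G: "G \<subseteq> {b. is_pole f b}" "finite G" for G
  proof -
    define s where "s = Max (insert 1 (norm ` G))"
    have s: "s \<ge> 1" "\<And>b. b \<in> G \<Longrightarrow> norm b \<le> s" using G by (auto simp: s_def)
    obtain r where r: "nevanlinna_char f r < C * ln r" "r \<ge> s ^ 2 + 1"
      using frequently_eventually_frequently[OF gr eventually_ge_at_top[of "s ^ 2 + 1"]]
      by (auto dest: frequently_ex)
    have r1: "r > 1" using r s by (smt (verit) one_le_power)
    have sr: "s \<le> sqrt r" using r s by (intro real_le_rsqrt) auto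
    have s1: "1 \<le> sqrt r" using r1 by simp
    have le: "sqrt r \<le> r" using r1 by (simp add: sqrt_le_D real_le_lsqrt power2_eq_square)
    have "card G \<le> (\<Sum>b\<in>G. pole_mult f b)"
    proof -
      have "1 \<le> pole_mult f b" if "b \<in> G" for b
        using that G is_pole_iff_zorder_neg[OF f] by (auto simp: pole_mult_def)
      then show ?thesis using sum_mono[of G "\<lambda>_. 1" "pole_mult f"] by simp
    qed
    also have "\<dots> \<le> pole_count f (sqrt r)"
      unfolding pole_count_eq using G s sr
      by (intro sum_mono2 finite_poles_in[OF mf]) (auto simp: poles_in_def intro: order_trans)
    finally have "real (card G) * (ln r / 2) \<le> pole_count f (sqrt r) * (ln r - ln (sqrt r))"
      using r1 by (simp add: ln_sqrt)
    also have "\<dots> \<le> counting_fun f r" by (rule pole_count_le_counting[OF mf s1 le])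
    also have "\<dots> \<le> nevanlinna_char f r" using r1 by (intro nevanlinna_char_nonneg(3) mf) auto
    also have "\<dots> < C * ln r" by (rule r)
    finally have "real (card G) < 2 * C" using r1 by (simp add: field_simps)
    then show ?thesis by linarith
  qed
  then show ?thesis using finite_if_finite_subsets_card_bdd by blast
qed

text \<open>Otherwise T_f(r) < C ln r for arbitrarily large r. Then f has finitely many poles, and
  multiplying by the polynomial with these zeros gives an entire function of polynomial growth, so f
  would be rational.\<close>

lemma transcendental_growth:
  assumes tr: "transcendental_meromorphic f"
  shows "filterlim (\<lambda>r. nevanlinna_char f r / ln r) at_top at_top"
proof (rule ccontr)
  assume "\<not> ?thesis"
  then obtain C0 where C0: "\<not> eventually (\<lambda>r. C0 \<le> nevanlinna_char f r / ln r) at_top"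
    by (auto simp: filterlim_at_top)
  define C where "C = max C0 0"
  have mf: "f meromorphic_on UNIV" and nr: "\<not> rational_function f"
    using tr by (auto simp: transcendental_meromorphic_def)
  have f: "nonzero_meromorphic f"
  proof (rule ccontr)
    assume "\<not> ?thesis"
    then have "\<forall>\<^sub>\<approx>z. f z = poly 0 z / poly 1 z" using not_nonzero_meromorphic[OF mf] by simp
    then show False using nr unfolding rational_function_def by (metis one_neq_zero)
  qed
  have gr: "\<exists>\<^sub>F r in at_top. nevanlinna_char f r < C * ln r"
  proof -
    have "\<exists>\<^sub>F r in at_top. \<not> C0 \<le> nevanlinna_char f r / ln r" using C0 by (simp add: frequently_def)
    from frequently_eventually_frequently[OF this eventually_gt_at_top[of 1]]
    show ?thesis
    proof (rule frequently_elim1)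
      fix r :: real assume r: "\<not> C0 \<le> nevanlinna_char f r / ln r \<and> 1 < r"
      then have "nevanlinna_char f r < C0 * ln r" by (auto simp: field_simps not_le)
      also have "\<dots> \<le> C * ln r" using r by (intro mult_right_mono) (auto simp: C_def)
      finally show "nevanlinna_char f r < C * ln r" .
    qed
  qed
  define P where "P = {b. is_pole f b}"
  have fP: "finite P" unfolding P_def by (rule finite_poles_of_log_growth[OF f gr])
  define D where "D = (\<lambda>z. \<Prod>b\<in>P. (z - b) ^ pole_mult f b)"
  have D: "nonzero_meromorphic D" unfolding D_def
    by (intro nonzero_meromorphic_prod nonzero_meromorphic_power nonzero_meromorphic_linear)
  define h where "h = (\<lambda>z. f z * D z)"
  have h: "nonzero_meromorphic h" unfolding h_def by (rule nonzero_meromorphic_mult[OF f D])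
  have zh: "\<not> is_pole h z" for z
  proof -
    have "zorder D z = (\<Sum>b\<in>P. if b = z then int (pole_mult f b) else 0)"
      unfolding D_def by (subst zorder_prod_eq[OF fP])
        (auto intro!: nonzero_meromorphic_power nonzero_meromorphic_linear sum.cong
          simp: zorder_power_eq[OF nonzero_meromorphic_linear] zorder_linear)
    also have "\<dots> = (if z \<in> P then int (pole_mult f z) else 0)" using fP by (simp add: sum.delta)
    finally have "zorder h z \<ge> 0"
      using is_pole_iff_zorder_neg[OF f, of z]
      by (auto simp: h_def zorder_mult_eq[OF f D] P_def pole_mult_def)
    then show ?thesis using is_pole_iff_zorder_neg[OF h] by (simp add: not_less)
  qed
  define e where "e = remove_sings h"
  have "e analytic_on {z}" for z
  proof -
    obtain c where "h \<midarrow>z\<rightarrow> c"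
      using nonzero_meromorphic_isolated(2)[OF h, of z] zh[of z] by (auto simp: not_essential_def)
    then show ?thesis unfolding e_def by (intro remove_sings_analytic_at nonzero_meromorphic_isolated(1)[OF h])
  qed
  then have "e analytic_on UNIV" by (subst analytic_on_analytic_at) auto
  then have eh: "e holomorphic_on UNIV" by (rule analytic_imp_holomorphic)
  have eq: "\<forall>\<^sub>\<approx>z. e z = h z" unfolding e_def
    by (intro eventually_remove_sings_eq nonzero_meromorphicD(1)[OF h])
  define n where "n = (\<Sum>b\<in>P. pole_mult f b)"
  \<comment> \<open>The part 3 C pays for the factor 3 of the pointwise bound. Each of the n poles,
    with multiplicity, costs ln (2 R), which also explains the factor \<open>2 ^ n\<close>
    below.\<close>
  define N where "N = nat \<lceil>3 * C\<rceil> + n"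
  define s where "s = Max (insert 1 (norm ` P))"
  have s: "s \<ge> 1" "\<And>b. b \<in> P \<Longrightarrow> norm b \<le> s" using fP by (auto simp: s_def)
  have bd: "norm (e z) \<le> 2 ^ n * R ^ N" if R: "nevanlinna_char f R < C * ln R" "R \<ge> s" and z: "norm z < R / 2" for R z
  proof -
    have R1: "R \<ge> 1" using R s by auto
    have PR: "poles_in f R = P" using R s by (auto simp: poles_in_def P_def intro: order_trans)
    have ball: "eventually (\<lambda>w. w \<in> ball 0 (R / 2)) (at z)"
      using z by (intro eventually_at_in_open') auto
    have "eventually (\<lambda>w. e w = h w) (at z)" "eventually (\<lambda>w. f analytic_on {w}) (at z)" "eventually (\<lambda>w. h w \<noteq> 0) (at z)"
      using eq meromorphic_on_imp_analytic_cosparse[OF mf] h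
      by (auto simp: eventually_cosparse_open_eq nonzero_meromorphic_def)
    with ball have "eventually (\<lambda>w. norm (e w) \<le> 2 ^ n * R ^ N) (at z)"
    proof eventually_elim
      case (elim w)
      have wP: "w \<notin> P" using elim analytic_at_imp_no_pole by (auto simp: P_def)
      have fw: "f w \<noteq> 0" "D w \<noteq> 0" using elim by (auto simp: h_def)
      have "ln (norm (D w)) = (\<Sum>b\<in>P. pole_mult f b * ln (norm (w - b)))"
      proof -
        have "norm (D w) = (\<Prod>b\<in>P. norm (w - b) ^ pole_mult f b)"
          by (simp add: D_def norm_power flip: prod_norm)
        moreover have "ln (\<Prod>b\<in>P. norm (w - b) ^ pole_mult f b) = (\<Sum>b\<in>P. ln (norm (w - b) ^ pole_mult f b))"
          using wP fP by (intro ln_prod) auto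
        moreover have "ln (norm (w - b) ^ pole_mult f b) = pole_mult f b * ln (norm (w - b))" if "b \<in> P" for b
          by (rule ln_realpow)
        ultimately show ?thesis by simp
      qed
      then have "ln (norm (h w)) = ln (norm (f w)) + (\<Sum>b\<in>P. pole_mult f b * ln (norm (w - b)))"
        using fw by (simp add: h_def norm_mult ln_mult)
      also have "ln (norm (f w)) \<le> 3 * proximity_fun f R
         + (\<Sum>b\<in>P. pole_mult f b * (ln (2 * R) - ln (norm (w - b))))"
        using pointwise_le_proximity'[OF f, of w R] elim R1 ln_le_log_plus[of "norm (f w)"] by (simp add: PR)
      \<comment> \<open>The singular terms cancel against ln |D w|, so the bound is uniform up to
        the poles.\<close>
      also have "\<dots> + (\<Sum>b\<in>P. pole_mult f b * ln (norm (w - b))) = 3 * proximity_fun f R + n * ln (2 * R)"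
        by (simp add: n_def right_diff_distrib sum_subtractf sum_distrib_right)
      also have "\<dots> \<le> 3 * (C * ln R) + n * ln (2 * R)"
        using nevanlinna_char_nonneg(2)[OF mf R1] R by simp
      also have "3 * (C * ln R) \<le> nat \<lceil>3 * C\<rceil> * ln R"
      proof -
        have "3 * C \<le> nat \<lceil>3 * C\<rceil>" by linarith
        then have "3 * C * ln R \<le> nat \<lceil>3 * C\<rceil> * ln R" using R1 by (intro mult_right_mono) auto
        then show ?thesis by simp
      qed
      also have "nat \<lceil>3 * C\<rceil> * ln R + n * ln (2 * R) = ln (2 ^ n * R ^ N)"
        using R1 by (simp add: N_def ln_mult ln_realpow ring_distribs)
      finally have "ln (norm (h w)) \<le> ln (2 ^ n * R ^ N)" by simp
      then show ?case using elim R1 by simp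
    qed
    moreover have "((\<lambda>w. norm (e w)) \<longlongrightarrow> norm (e z)) (at z)"
      using \<open>e analytic_on {z}\<close> by (intro tendsto_norm isContD analytic_at_imp_isCont)
    ultimately show ?thesis using tendsto_upperbound[OF _ _ at_neq_bot] by blast
  qed
  \<comment> \<open>The bound \<open>bd\<close> is valid for |z| < R / 2. It is applied for |z| <= R
    / 4, and \<open>4 ^ N\<close> compensates for renaming R / 4 as R.\<close>
  have "\<exists>\<^sub>F R in at_top. \<forall>z. norm z \<le> R \<longrightarrow> norm (e z) \<le> (2 ^ n * 4 ^ N) * R ^ N"
    unfolding frequently_def eventually_at_top_linorder
  proof (rule notI, elim exE)
    fix R0 assume H: "\<forall>R\<ge>R0. \<not> (\<forall>z. norm z \<le> R \<longrightarrow> norm (e z) \<le> (2 ^ n * 4 ^ N) * R ^ N)"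
    obtain R where R: "nevanlinna_char f R < C * ln R" "R \<ge> max s (4 * R0)"
      using frequently_eventually_frequently[OF gr eventually_ge_at_top[of "max s (4 * R0)"]]
      by (auto dest: frequently_ex)
    have "R > 0" using R s by auto
    then have "norm (e z) \<le> 2 ^ n * 4 ^ N * (R / 4) ^ N" if "norm z \<le> R / 4" for z
      using bd[of R z] R that by (simp add: power_divide)
    then show False using H[rule_format, of "R / 4"] R by auto
  qed
  then obtain A where A: "\<And>z. e z = poly A z"
    using entire_polynomial_bound_imp_polynomial[OF eh] by blast
  define B where "B = (\<Prod>b\<in>P. [:- b, 1:] ^ pole_mult f b)"
  have B: "B \<noteq> 0" "\<And>z. poly B z = D z" using fP by (auto simp: B_def D_def poly_prod)
  have "\<forall>\<^sub>\<approx>z. D z \<noteq> 0" using D by (simp add: nonzero_meromorphic_def)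
  with eq have "\<forall>\<^sub>\<approx>z. f z = poly A z / poly B z"
    by eventually_elim (simp add: A[symmetric] B h_def)
  then show False using nr B(1) unfolding rational_function_def by blast
qed


section \<open>Composition with an entire function\<close>

text \<open>A nonconstant entire g avoids the value g z in a punctured neighbourhood of z. Hence
  properties that hold off a sparse set pull back along g.\<close>

lemma entire_filterlim_at:
  assumes "g holomorphic_on UNIV" "\<not> g constant_on UNIV"
  shows "filterlim g (at (g z)) (at z)" "nonzero_meromorphic (\<lambda>z. g z - b)"
proof -
  have an: "(\<lambda>z. g z - b) analytic_on A" for b A
  proof -
    have "(\<lambda>z. g z - b) analytic_on UNIV"
      using assms(1) by (subst analytic_on_open) (auto intro!: holomorphic_intros)
    then show ?thesis by (rule analytic_on_subset) auto
  qed
  show nz: "nonzero_meromorphic (\<lambda>z. g z - b)" for b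
  proof (rule ccontr)
    assume H: "\<not> ?thesis"
    have "\<forall>\<^sub>\<approx>z. g z - b = 0"
      by (rule not_nonzero_meromorphic[OF analytic_on_imp_meromorphic_on[OF an] H])
    then have "eventually (\<lambda>w. g w - b = 0) (at z)" for z by (simp add: eventually_cosparse_open_eq)
    moreover have "((\<lambda>w. g w - b) \<longlongrightarrow> g z - b) (at z)" for z
      using analytic_at_imp_isCont[OF an] isContD by blast
    ultimately have "g z - b = 0" for z
      using tendsto_unique[OF at_neq_bot, of "\<lambda>w. g w - b" "g z - b" z 0]
        tendsto_eventually[of "\<lambda>w. g w - b" 0 "at z"] by simp
    then have "g z = b" for z by simp
    then show False using assms(2) by (auto simp: constant_on_def)
  qed
  have "isCont (\<lambda>w. g w - 0) z" by (rule analytic_at_imp_isCont[OF an])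
  then have "(g \<longlongrightarrow> g z) (at z)" by (simp add: isCont_def)
  moreover have "eventually (\<lambda>w. g w \<noteq> g z) (at z)"
    using nonzero_meromorphicD(2)[OF nz[of "g z"], of z] by simp
  ultimately show "filterlim g (at (g z)) (at z)" by (simp add: filterlim_at)
qed

lemma cosparse_compose_entire:
  assumes "g holomorphic_on UNIV" "\<not> g constant_on UNIV" "\<forall>\<^sub>\<approx>w. P w"
  shows "\<forall>\<^sub>\<approx>z. P (g z)"
  using assms(3) entire_filterlim_at(1)[OF assms(1,2)]
  by (auto simp: eventually_cosparse_open_eq filterlim_iff)

text \<open>Near g c write f as a zero-free analytic factor times (w - g c)^k and substitute
  g.\<close>

lemma zorder_compose_entire:
  assumes f: "nonzero_meromorphic f" and g: "g holomorphic_on UNIV" "\<not> g constant_on UNIV"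
  shows "zorder (f \<circ> g) c = zorder f (g c) * zorder (\<lambda>z. g z - g c) c"
proof -
  define h where "h = zor_poly f (g c)"
  define k where "k = zorder f (g c)"
  obtain r where r: "h (g c) \<noteq> 0" "r > 0" "h holomorphic_on cball (g c) r"
     "\<And>w. w \<in> cball (g c) r - {g c} \<Longrightarrow> f w = h w * (w - g c) powi k \<and> h w \<noteq> 0"
    using zorder_exist[OF nonzero_meromorphic_isolated[OF f] nonzero_meromorphicD(3)[OF f], of "g c"]
    unfolding h_def k_def by auto
  have gm: "nonzero_meromorphic (\<lambda>z. g z - g c)" by (rule entire_filterlim_at(2)[OF g])
  have ga: "g analytic_on {c}"
    using analytic_on_open[of UNIV g] g(1) by (auto intro: analytic_on_subset)
  have "eventually (\<lambda>w. w \<in> ball (g c) r - {g c}) (at (g c))"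
    using r(2) by (intro eventually_at_in_open) auto
  then have ev: "eventually (\<lambda>z. g z \<in> ball (g c) r - {g c}) (at c)"
    using entire_filterlim_at(1)[OF g, of c] by (auto simp: filterlim_iff)
  have "h analytic_on ball (g c) r"
    using r(3) by (subst analytic_on_open) (auto intro: holomorphic_on_subset)
  then have "h analytic_on {g c}" using r(2) by (auto intro: analytic_on_subset)
  then have ha: "(h \<circ> g) analytic_on {c}" using ga by (intro analytic_on_compose) auto
  have "eventually (\<lambda>z. (f \<circ> g) z = (h \<circ> g) z * (g z - g c) powi k) (at c)"
    using ev by eventually_elim (use r(4) in auto)
  then have "zorder (f \<circ> g) c = zorder (\<lambda>z. (h \<circ> g) z * (g z - g c) powi k) c"
    by (rule zorder_cong) simp
  also have "\<dots> = zorder (h \<circ> g) c + zorder (\<lambda>z. (g z - g c) powi k) c"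
  proof (rule zorder_mult)
    show "h \<circ> g meromorphic_on {c}" using ha by (rule analytic_on_imp_meromorphic_on)
    have "eventually (\<lambda>z. (h \<circ> g) z \<noteq> 0) (at c)"
      using ev by eventually_elim (use r(4) in auto)
    then show "\<exists>\<^sub>F z in at c. (h \<circ> g) z \<noteq> 0" by (intro eventually_frequently) auto
  qed (intro nonzero_meromorphicD nonzero_meromorphic_powi gm)+
  also have "zorder (h \<circ> g) c = 0" using ha r(1) by (intro zorder_analytic_nonzero) auto
  also have "zorder (\<lambda>z. (g z - g c) powi k) c = k * zorder (\<lambda>z. g z - g c) c"
    by (intro zorder_power_int nonzero_meromorphicD gm)
  finally show ?thesis by (simp add: k_def comp_def)
qed

lemma max_modulus_ge:
  assumes g: "g holomorphic_on UNIV" and z: "norm z \<le> r"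
  shows "norm (g z) \<le> max_modulus g r"
proof -
  have r: "r \<ge> 0" using z norm_ge_zero order_trans by blast
  have cg: "continuous_on A g" for A
    using g holomorphic_on_imp_continuous_on continuous_on_subset by blast
  have bdd: "bdd_above ((\<lambda>z. norm (g z)) ` sphere 0 r)"
    by (intro bounded_imp_bdd_above compact_imp_bounded compact_continuous_image continuous_intros cg) auto
  show ?thesis
  proof (rule maximum_modulus_frontier[of g "cball 0 r"])
    show "g holomorphic_on interior (cball 0 r)" using g by (rule holomorphic_on_subset) auto
    show "norm (g w) \<le> max_modulus g r" if "w \<in> frontier (cball 0 r)" for w
      unfolding max_modulus_def using that by (intro cSUP_upper bdd) (simp add: frontier_cball)
  qed (use z cg in auto)
qed

lemma max_modulus_at_top:
  assumes g: "g holomorphic_on UNIV" "\<not> g constant_on UNIV"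
  shows "filterlim (max_modulus g) at_top at_top"
  unfolding filterlim_at_top
proof
  fix C
  have "\<not> bounded (range g)" using Liouville_theorem[OF g(1)] g(2) by blast
  then obtain z where z: "norm (g z) > C" by (auto simp: bounded_iff not_le)
  have "C \<le> max_modulus g r" if "r \<ge> norm z" for r
    using max_modulus_ge[OF g(1) that] z by simp
  then show "eventually (\<lambda>r. C \<le> max_modulus g r) at_top"
    using eventually_ge_at_top by (rule eventually_mono[rotated])
qed

lemma meromorphic_compose_entire:
  assumes "f meromorphic_on UNIV" "g holomorphic_on UNIV"
  shows "(f \<circ> g) meromorphic_on UNIV"
  using meromorphic_on_compose[of f UNIV g UNIV] assms by (simp add: analytic_on_open comp_def)

text \<open>A pole c of f o g lies over the pole b = g c of f, with the product of the two
  multiplicities. Grouping by b leaves for each b the counting function of the b-points of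
  g.\<close>

lemma counting_compose_le:
  assumes f: "nonzero_meromorphic f" and g: "g holomorphic_on UNIV" "\<not> g constant_on UNIV"
    and r: "r \<ge> 1" and R: "max_modulus g r \<le> R"
  shows "counting_fun (f \<circ> g) r \<le> (\<Sum>b\<in>poles_in f R. pole_mult f b * counting_fun (\<lambda>z. inverse (g z - b)) r)"
proof -
  have mf: "f meromorphic_on UNIV" using f by (simp add: nonzero_meromorphic_def)
  have mfg: "(f \<circ> g) meromorphic_on UNIV" by (rule meromorphic_compose_entire[OF mf g(1)])
  have fg: "nonzero_meromorphic (f \<circ> g)"
    using cosparse_compose_entire[OF g, of "\<lambda>w. f w \<noteq> 0"] f mfg by (auto simp: nonzero_meromorphic_def)
  have gb: "nonzero_meromorphic (\<lambda>z. g z - b)" for b by (rule entire_filterlim_at(2)[OF g])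
  have gib: "nonzero_meromorphic (\<lambda>z. inverse (g z - b))" for b by (rule nonzero_meromorphic_inverse[OF gb])
  let ?P = "poles_in (f \<circ> g) r" and ?B = "poles_in f R"
  let ?C = "\<lambda>b. poles_in (\<lambda>z. inverse (g z - b)) r"
  let ?w = "\<lambda>c. ln r - ln (norm c)"
  let ?m = "\<lambda>b. pole_mult (\<lambda>z. inverse (g z - b))"
  have zpos: "zorder (\<lambda>z. g z - g c) c > 0" for c
  proof -
    have "((\<lambda>z. g z - g c) \<longlongrightarrow> 0) (at c)"
      using entire_filterlim_at(1)[OF g, of c] by (simp add: filterlim_at LIM_zero)
    then have "isolated_zero (\<lambda>z. g z - g c) c"
      using nonzero_meromorphicD(2)[OF gb] by (simp add: isolated_zero_def)
    then show ?thesis using isolated_zero_iff_zorder_pos[OF gb] by blast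
  qed
  have pm: "pole_mult (f \<circ> g) c = pole_mult f (g c) * ?m (g c) c" for c
  proof -
    have "nat (- (k * e)) = nat (- k) * nat e" if "e > 0" for k e :: int
    proof (cases "k \<le> 0")
      case True
      then show ?thesis using nat_mult_distrib[of "- k" e] by simp
    next
      case False
      then have "k * e > 0" using that by simp
      then show ?thesis using False by simp
    qed
    then show ?thesis using zpos[of c]
      by (simp add: pole_mult_def zorder_compose_entire[OF f g] zorder_inverse_eq[OF gb])
  qed
  have in1: "g c \<in> ?B" "c \<in> ?C (g c)" if "c \<in> ?P" for c
  proof -
    have c: "norm c \<le> r" "zorder (f \<circ> g) c < 0" using that is_pole_iff_zorder_neg[OF fg] by (auto simp: poles_in_def)
    then have "zorder f (g c) < 0" using zpos[of c] unfolding zorder_compose_entire[OF f g]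
      by (simp add: mult_less_0_iff)
    then show "g c \<in> ?B" using max_modulus_ge[OF g(1) c(1)] R is_pole_iff_zorder_neg[OF f]
      by (auto simp: poles_in_def)
    show "c \<in> ?C (g c)" using c zpos[of c] is_pole_iff_zorder_neg[OF gib] zorder_inverse_eq[OF gb]
      by (auto simp: poles_in_def)
  qed
  have finB: "finite ?B" by (rule finite_poles_in[OF mf])
  have finC: "finite (?C b)" for b using gib by (intro finite_poles_in) (simp add: nonzero_meromorphic_def)
  have "counting_fun (f \<circ> g) r = (\<Sum>c\<in>?P. pole_mult (f \<circ> g) c * ?w c)"
    using r by (intro counting_fun_eq mfg) auto
  also have "\<dots> = (\<Sum>c\<in>?P. (\<lambda>(b, c). pole_mult f b * (?m b c * ?w c)) (g c, c))"
    by (simp add: pm mult_ac)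
  \<comment> \<open>Tagging each pole with its image embeds the sum into a double sum whose further
    terms are nonnegative, as r >= 1.\<close>
  also have "\<dots> = (\<Sum>x\<in>(\<lambda>c. (g c, c)) ` ?P. (\<lambda>(b, c). pole_mult f b * (?m b c * ?w c)) x)"
    by (subst sum.reindex) (auto simp: inj_on_def)
  also have "\<dots> \<le> (\<Sum>x\<in>(SIGMA b:?B. ?C b). (\<lambda>(b, c). pole_mult f b * (?m b c * ?w c)) x)"
    using in1 finB finC r counting_term_nonneg[OF _ r]
    by (intro sum_mono2 finite_SigmaI) (auto simp: poles_in_def intro!: mult_nonneg_nonneg)
  also have "\<dots> = (\<Sum>b\<in>?B. \<Sum>c\<in>?C b. pole_mult f b * (?m b c * ?w c))"
    using finB finC by (subst sum.Sigma) auto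
  also have "\<dots> = (\<Sum>b\<in>?B. pole_mult f b * counting_fun (\<lambda>z. inverse (g z - b)) r)"
    using r by (intro sum.cong refl, subst counting_fun_eq)
       (auto simp: sum_distrib_left intro: nonzero_meromorphicD(1)[OF gib])
  finally show ?thesis .
qed

text \<open>The pointwise bound is averaged at g z over |z| = r. By Jensen's formula each -ln |g z -
  b| has mean minus the counting function of the b-points minus a constant, and
  \<open>counting_compose_le\<close> shows that these counting functions absorb all poles of f o
  g.\<close>

lemma nevanlinna_char_compose_le:
  assumes f: "nonzero_meromorphic f" and g: "g holomorphic_on UNIV" "\<not> g constant_on UNIV"
    and r: "r \<ge> 1" and R: "2 * max_modulus g r \<le> R" "R > 0"
  shows "nevanlinna_char (f \<circ> g) r \<le> 3 * proximity_fun f R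
    + (\<Sum>b\<in>poles_in f R. pole_mult f b * (ln (2 * R) - jensen_const (\<lambda>z. g z - b)))"
proof -
  have r0: "r > 0" using r by simp
  have mf: "f meromorphic_on UNIV" using f by (simp add: nonzero_meromorphic_def)
  have mfg: "(f \<circ> g) meromorphic_on UNIV" by (rule meromorphic_compose_entire[OF mf g(1)])
  have gb: "nonzero_meromorphic (\<lambda>z. g z - b)" for b by (rule entire_filterlim_at(2)[OF g])
  have "norm (g 0) \<le> max_modulus g r" using max_modulus_ge[OF g(1), of 0 r] r by simp
  then have M0: "max_modulus g r \<ge> 0" using norm_ge_zero order_trans by blast
  let ?B = "poles_in f R"
  let ?N = "\<lambda>b. counting_fun (\<lambda>z. inverse (g z - b)) r"
  have li: "circle_integrable (\<lambda>z. ln (norm (g z - b))) r" for b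
    by (rule circle_integrable_ln_meromorphic[OF gb r0])
  have lm: "circle_mean (\<lambda>z. ln (norm (g z - b))) r = ?N b + jensen_const (\<lambda>z. g z - b)" for b
  proof -
    have "\<not> is_pole (\<lambda>z. g z - b) c" for c
      by (rule not_is_pole_holomorphic[of UNIV]) (auto intro!: holomorphic_intros g)
    then have "poles_in (\<lambda>z. g z - b) r = {}" by (simp add: poles_in_def)
    then have "counting_fun (\<lambda>z. g z - b) r = 0"
      using counting_fun_eq[OF nonzero_meromorphicD(1)[OF gb] r0, of b] by simp
    then show ?thesis using jensen_formula[OF gb r0, of b] by simp
  qed
  define X where "X = {z\<in>cball 0 r. \<not> f analytic_on {g z}}"
  have X: "finite X" unfolding X_def
    by (intro cosparse_finite_cball cosparse_compose_entire[OF g] meromorphic_on_imp_analytic_cosparse[OF mf])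
  let ?U = "\<lambda>b z. pole_mult f b * (ln (2 * R) + (-1) * ln (norm (g z - b)))"
  have Ui: "circle_integrable (?U b) r" for b
    by (intro circle_integrable_cmult circle_integrable_add li) simp
  have Um: "circle_mean (?U b) r = pole_mult f b * (ln (2 * R) - (?N b + jensen_const (\<lambda>z. g z - b)))" for b
    unfolding circle_mean_cmult
    by (subst circle_mean_add[OF circle_integrable_const circle_integrable_cmult[OF li]])
      (simp only: circle_mean_cmult circle_mean_const lm; simp)
  have Si: "circle_integrable (\<lambda>z. \<Sum>b\<in>?B. ?U b z) r" by (intro circle_integrable_sum Ui)
  have "proximity_fun (f \<circ> g) r \<le> circle_mean (\<lambda>z. 3 * proximity_fun f R + (\<Sum>b\<in>?B. ?U b z)) r"
    unfolding proximity_fun_eq[of "f \<circ> g"]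
  proof (rule circle_mean_mono_finite[OF r0 X])
    show "circle_integrable (\<lambda>z. log_plus (norm ((f \<circ> g) z))) r"
      by (rule circle_integrable_log_plus[OF mfg r0])
    show "circle_integrable (\<lambda>z. 3 * proximity_fun f R + (\<Sum>b\<in>?B. ?U b z)) r"
      by (intro circle_integrable_add Si) simp
    fix z :: complex assume z: "norm z = r" "z \<notin> X"
    have "norm (g z) \<le> R / 2" using max_modulus_ge[OF g(1), of z r] z R by simp
    then show "log_plus (norm ((f \<circ> g) z)) \<le> 3 * proximity_fun f R + (\<Sum>b\<in>?B. ?U b z)"
      using pointwise_le_proximity'[OF f, of "g z" R] z R(2) by (simp add: X_def)
  qed
  also have "\<dots> = 3 * proximity_fun f R + (\<Sum>b\<in>?B. circle_mean (?U b) r)"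
    by (subst circle_mean_add[OF _ Si], simp, subst circle_mean_sum[OF Ui], simp)
  also have "\<dots> = 3 * proximity_fun f R + (\<Sum>b\<in>?B. pole_mult f b * (ln (2 * R) - jensen_const (\<lambda>z. g z - b)))
      - (\<Sum>b\<in>?B. pole_mult f b * ?N b)"
    unfolding Um by (simp add: right_diff_distrib distrib_left sum_subtractf sum.distrib)
  finally show ?thesis using counting_compose_le[OF f g r, of R] R(1) M0 by (simp add: nevanlinna_char_def)
qed

lemma jensen_const_nonzero:
  assumes "u analytic_on {0}" "u 0 \<noteq> 0"
  shows "jensen_const u = ln (norm (u 0))"
proof -
  have c: "(u \<longlongrightarrow> u 0) (at 0)" using assms(1) by (intro isContD analytic_at_imp_isCont)
  then have ev: "eventually (\<lambda>z. u z \<noteq> 0) (at 0)" using assms(2) by (intro tendsto_imp_eventually_ne) auto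
  have m: "u meromorphic_on {0}" using assms(1) by (rule analytic_on_imp_meromorphic_on)
  have "zor_poly u 0 0 = u 0"
  proof (rule zor_poly_eqI[where g = "\<lambda>x. x" and F = "at 0"])
    show "isolated_singularity_at u 0" "not_essential u 0" using m by (auto simp: meromorphic_at_iff)
    show "\<exists>\<^sub>F w in at 0. u w \<noteq> 0" using ev by (intro eventually_frequently) auto
    show "((\<lambda>x. u x * (x - 0) powi - zorder u 0) \<longlongrightarrow> u 0) (at 0)"
      using c zorder_analytic_nonzero[OF assms] by simp
  qed (auto simp: filterlim_ident)
  then show ?thesis by (simp add: jensen_const_def)
qed

text \<open>With M the maximum modulus and R = 2 M, the values g z lie in the half disc. The bound
  is 3 T(R) + 3 N(R^2) <= (9 + 3) T(R^2) <= 36 T(M^3), each change of radius costing a factor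
  3.\<close>

lemma nevanlinna_char_compose_eventually_le:
  assumes f: "nonzero_meromorphic f" and g: "g holomorphic_on UNIV" "\<not> g constant_on UNIV"
  shows "eventually (\<lambda>r. nevanlinna_char (f \<circ> g) r \<le> 36 * nevanlinna_char f (max_modulus g r ^ 3)) at_top"
proof -
  have mf: "f meromorphic_on UNIV" using f by (simp add: nonzero_meromorphic_def)
  let ?J = "\<lambda>b. jensen_const (\<lambda>z. g z - b)"
  \<comment> \<open>Poles outside this finite set satisfy |g 0 - b| >= 1 and have a nonnegative
    Jensen constant. A single \<open>J\<close> therefore bounds -\<open>?J b\<close> for all poles
    b, independently of r.\<close>
  define Q where "Q = insert (g 0) (poles_in f (norm (g 0) + 1))"
  have Q: "finite Q" unfolding Q_def using finite_poles_in[OF mf] by simp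
  define J where "J = Max (insert 0 ((\<lambda>b. - ?J b) ` Q))"
  have J0: "J \<ge> 0" using Q by (simp add: J_def)
  have J: "- ?J b \<le> J" if b: "is_pole f b" for b
  proof (cases "b \<in> Q")
    case True then show ?thesis using Q by (auto simp: J_def)
  next
    case False
    then have nb: "norm b > norm (g 0) + 1" "g 0 \<noteq> b" using b by (auto simp: Q_def poles_in_def)
    have "(\<lambda>z. g z - b) analytic_on UNIV"
      using g(1) by (subst analytic_on_open) (auto intro!: holomorphic_intros)
    then have "?J b = ln (norm (g 0 - b))"
      using nb by (intro jensen_const_nonzero) (auto intro: analytic_on_subset)
    moreover have "norm (g 0 - b) \<ge> 1" using nb norm_triangle_ineq2[of b "g 0"] by (simp add: norm_minus_commute)
    ultimately show ?thesis using J0 ln_ge_zero[of "norm (g 0 - b)"] by linarith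
  qed
  have "eventually (\<lambda>r. max_modulus g r \<ge> max 8 (exp J)) at_top"
    using max_modulus_at_top[OF g] unfolding filterlim_at_top by blast
  then show ?thesis using eventually_ge_at_top[of 1]
  proof eventually_elim
    case (elim r)
    define M where "M = max_modulus g r"
    define R where "R = 2 * M"
    have M: "M \<ge> 8" "M \<ge> exp J" using elim by (auto simp: M_def)
    have R: "R \<ge> 16" "R \<ge> exp J" using M exp_gt_zero[of J] by (auto simp: R_def)
    have lnR: "ln (2 * R) + J \<le> 3 * ln R"
    proof -
      have "J \<le> ln R" using R by (subst ln_ge_iff) auto
      moreover have "ln (2 * R) = ln 2 + ln R" using R by (simp add: ln_mult)
      moreover have "ln 2 \<le> ln R" using R by simp
      ultimately show ?thesis by simp
    qed
    have "nevanlinna_char (f \<circ> g) r \<le> 3 * proximity_fun f R + (\<Sum>b\<in>poles_in f R. pole_mult f b * (ln (2 * R) - ?J b))"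
      using R elim by (intro nevanlinna_char_compose_le[OF f g]) (auto simp: R_def M_def)
    also have "(\<Sum>b\<in>poles_in f R. pole_mult f b * (ln (2 * R) - ?J b)) \<le> (\<Sum>b\<in>poles_in f R. pole_mult f b * (3 * ln R))"
    proof (intro sum_mono mult_left_mono)
      fix b assume "b \<in> poles_in f R"
      then show "ln (2 * R) - ?J b \<le> 3 * ln R" using J[of b] lnR by (simp add: poles_in_def)
    qed simp
    \<comment> \<open>Since ln R = ln R^2 - ln R, the factor n(R) ln R is at most N(R^2).\<close>
    also have "\<dots> = 3 * (pole_count f R * (ln (R ^ 2) - ln R))"
      using R by (simp add: pole_count_eq sum_distrib_right sum_distrib_left ln_realpow mult_ac)
    also have "pole_count f R * (ln (R ^ 2) - ln R) \<le> counting_fun f (R ^ 2)"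
      using R by (intro pole_count_le_counting[OF mf]) (auto simp: power2_eq_square)
    also have "counting_fun f (R ^ 2) \<le> nevanlinna_char f (R ^ 2)"
      using R by (intro nevanlinna_char_nonneg(3)[OF mf]) simp
    also have "proximity_fun f R \<le> nevanlinna_char f R"
      using R by (intro nevanlinna_char_nonneg(2)[OF mf]) simp
    also have "nevanlinna_char f R \<le> 3 * nevanlinna_char f (R ^ 2)"
    proof (rule nevanlinna_char_quasi_mono[OF f])
      show "2 * R \<le> R ^ 2" unfolding power2_eq_square using R by (intro mult_right_mono) auto
      show "1 \<le> R ^ 2" using R one_le_power[of R 2] by simp
    qed (use R in simp)
    also have "nevanlinna_char f (R ^ 2) \<le> 3 * nevanlinna_char f (M ^ 3)"
    proof (rule nevanlinna_char_quasi_mono[OF f])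
      \<comment> \<open>Here M >= 8 enters: 2 R^2 = 8 M^2 must not exceed M^3.\<close>
      have "8 * (M * M) \<le> M * (M * M)" using M by (intro mult_right_mono) auto
      then show "2 * R ^ 2 \<le> M ^ 3" by (simp add: R_def power2_eq_square power3_eq_cube)
      show "1 \<le> M ^ 3" using M by simp
    qed (use R in simp)
    finally show ?case by (simp add: M_def comp_def)
  qed
qed

section \<open>Derivatives and differential polynomials\<close>

text \<open>Pigeonhole: of the card S + 1 candidate radii with spacing 2 e, each point of S comes
  closer than e to at most one.\<close>

lemma exists_separated_radius:
  assumes S: "finite S" and r: "(r::real) > 0"
  obtains \<rho> where "r \<le> \<rho>" "\<rho> \<le> 2 * r" "\<And>a. a \<in> S \<Longrightarrow> \<bar>\<rho> - norm a\<bar> \<ge> r / (2 * (real (card S) + 1))"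
proof -
  let ?n = "card S"
  define e where "e = r / (2 * (real ?n + 1))"
  have e: "e > 0" "2 * (real ?n + 1) * e = r" using r by (auto simp: e_def)
  define p where "p = (\<lambda>i::nat. r + (2 * real i + 1) * e)"
  have pr: "r \<le> p i" "p i \<le> 2 * r" if "i \<le> ?n" for i
  proof -
    show "r \<le> p i" using e by (simp add: p_def)
    have "(2 * real i + 1) * e \<le> 2 * (real ?n + 1) * e" using that e by (intro mult_right_mono) auto
    then show "p i \<le> 2 * r" unfolding e(2) by (simp add: p_def)
  qed
  have "\<exists>i\<le>?n. \<forall>a\<in>S. \<bar>p i - norm a\<bar> \<ge> e"
  proof (rule ccontr)
    assume "\<not> ?thesis"
    then have "\<forall>i\<le>?n. \<exists>a\<in>S. \<bar>p i - norm a\<bar> < e" by (meson not_le)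
    then obtain a where a: "\<And>i. i \<le> ?n \<Longrightarrow> a i \<in> S \<and> \<bar>p i - norm (a i)\<bar> < e"
      by metis
    have "inj_on a {..?n}"
    proof (rule inj_onI)
      fix i j assume ij: "i \<in> {..?n}" "j \<in> {..?n}" "a i = a j"
      have "\<bar>p i - norm (a i)\<bar> < e" "\<bar>p j - norm (a i)\<bar> < e" using a[of i] a[of j] ij by auto
      then have "\<bar>p i - p j\<bar> < 2 * e" by linarith
      also have "p i - p j = 2 * e * (real i - real j)" by (simp add: p_def algebra_simps)
      finally have "2 * e * \<bar>real i - real j\<bar> < 2 * e" using e by (simp add: abs_mult)
      then have "\<bar>real i - real j\<bar> < 1" using e by simp
      then show "i = j" by linarith
    qed
    then have "card {..?n} \<le> card S" using a S by (intro card_inj_on_le) auto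
    then show False by simp
  qed
  then show ?thesis using that pr unfolding e_def by blast
qed

text \<open>
  The Borel--Caratheodory argument for a logarithm of \<^term>\<open>f\<close>: it is at most 1 in modulus on a disc
  of radius \<^term>\<open>\<eta> / (2 * B + 4)\<close>, and Cauchy's inequality on that disc bounds all derivatives.
\<close>

lemma higher_deriv_le_of_nonvanishing:
  assumes hol: "f holomorphic_on ball z \<eta>" and \<eta>: "\<eta> > 0" and nz: "\<And>w. w \<in> ball z \<eta> \<Longrightarrow> f w \<noteq> 0"
    and B: "B \<ge> 0" and bd: "\<And>w. w \<in> ball z \<eta> \<Longrightarrow> ln (norm (f w)) - ln (norm (f z)) \<le> B"
  shows "norm ((deriv ^^ i) f z) \<le> fact i * (exp 1 * norm (f z)) / (\<eta> / (2 * B + 4)) ^ i"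
proof -
  \<comment> \<open>The margin 1 makes Re U < A strict and A positive even for B = 0.\<close>
  define A where "A = B + 1"
  have A: "A > 0" using B by (simp add: A_def)
  have z: "f z \<noteq> 0" using nz \<eta> by simp
  obtain g where g: "g holomorphic_on ball z \<eta>" "\<And>w. w \<in> ball z \<eta> \<Longrightarrow> f w = exp (g w)"
    using contractible_imp_holomorphic_log[OF hol convex_imp_contractible[OF convex_ball]] nz by metis
  define U where "U = (\<lambda>\<zeta>. g (z + of_real \<eta> * \<zeta>) - g z)"
  have inb: "z + of_real \<eta> * \<zeta> \<in> ball z \<eta>" if "norm \<zeta> < 1" for \<zeta>
    using that \<eta> by (simp add: dist_norm norm_mult)
  have U: "U holomorphic_on ball 0 1" unfolding U_def
    by (intro holomorphic_intros holomorphic_on_compose_gen[of _ _ g, unfolded comp_def, OF _ g(1)])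
      (use inb in auto)
  have ReU: "Re (U \<zeta>) < A" if "norm \<zeta> < 1" for \<zeta>
  proof -
    have "ln (norm (f w)) = Re (g w)" if "w \<in> ball z \<eta>" for w using g(2)[OF that] by simp
    then have "Re (U \<zeta>) \<le> B" using bd[OF inb[OF that]] inb[OF that] \<eta> by (simp add: U_def)
    then show ?thesis by (simp add: A_def)
  qed
  \<comment> \<open>The map U / (2 A - U) sends the half plane Re U < A into the unit disc and fixes
    0, so Schwarz's lemma applies.\<close>
  define \<phi> where "\<phi> = (\<lambda>\<zeta>. U \<zeta> / (2 * of_real A - U \<zeta>))"
  have den: "2 * of_real A - U \<zeta> \<noteq> 0" if "norm \<zeta> < 1" for \<zeta>
  proof
    assume "2 * of_real A - U \<zeta> = 0"
    then have "Re (U \<zeta>) = 2 * A" by (simp add: complex_eq_iff)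
    then show False using ReU[OF that] A by simp
  qed
  have lt: "norm (\<phi> \<zeta>) < 1" if "norm \<zeta> < 1" for \<zeta>
  proof -
    have "(norm (2 * of_real A - U \<zeta>))\<^sup>2 - (norm (U \<zeta>))\<^sup>2 = 4 * A * (A - Re (U \<zeta>))"
      by (simp add: cmod_power2) (simp add: power2_eq_square algebra_simps)
    moreover have "4 * A * (A - Re (U \<zeta>)) > 0" using A ReU[OF that] by simp
    ultimately have "(norm (U \<zeta>))\<^sup>2 < (norm (2 * of_real A - U \<zeta>))\<^sup>2" by simp
    then have "norm (U \<zeta>) < norm (2 * of_real A - U \<zeta>)" by (rule power2_less_imp_less) simp
    then show ?thesis using den[OF that] by (simp add: \<phi>_def norm_divide divide_less_eq)
  qed
  have "\<phi> holomorphic_on ball 0 1" unfolding \<phi>_def using U den by (intro holomorphic_intros) auto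
  moreover have "\<phi> 0 = 0" by (simp add: \<phi>_def U_def)
  ultimately have sch: "norm (\<phi> \<zeta>) \<le> norm \<zeta>" if "norm \<zeta> < 1" for \<zeta>
    using Schwarz_Lemma(1)[of \<phi> \<zeta>] lt that by blast
  \<comment> \<open>Schwarz's lemma gives |U| <= t (2 A + |U|) on the disc of radius t, hence |U| <=
    2 A t / (1 - t). This t makes the quotient at most 1, and 2 A + 2 = 2 B + 4.\<close>
  define t where "t = 1 / (2 * A + 2)"
  have t: "0 < t" "t < 1" "2 * A * t \<le> 1 - t" using A by (auto simp: t_def field_simps)
  have U1: "norm (U \<zeta>) \<le> 1" if "norm \<zeta> \<le> t" for \<zeta>
  proof -
    have z1: "norm \<zeta> < 1" using that t by simp
    have "norm (U \<zeta>) = norm (\<phi> \<zeta>) * norm (2 * of_real A - U \<zeta>)"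
      using den[OF z1] by (simp add: \<phi>_def norm_divide)
    also have "\<dots> \<le> t * (2 * A + norm (U \<zeta>))"
    proof (intro mult_mono)
      show "norm (\<phi> \<zeta>) \<le> t" using sch[OF z1] that by simp
      show "norm (2 * of_real A - U \<zeta>) \<le> 2 * A + norm (U \<zeta>)"
        using norm_triangle_ineq4[of "2 * of_real A" "U \<zeta>"] A by (simp add: norm_mult)
    qed (use t in auto)
    finally have "(1 - t) * norm (U \<zeta>) \<le> 2 * A * t" by (simp add: algebra_simps)
    also have "\<dots> \<le> (1 - t) * 1" using t by simp
    finally show ?thesis using t by (simp only: mult_le_cancel_left_pos)
  qed
  have fe: "norm (f w) \<le> exp 1 * norm (f z)" if "norm (z - w) = \<eta> * t" for w
  proof -
    define \<zeta> where "\<zeta> = (w - z) / of_real \<eta>"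
    have w: "w = z + of_real \<eta> * \<zeta>" using \<eta> by (simp add: \<zeta>_def)
    have n: "norm \<zeta> = t" using that \<eta> by (simp add: \<zeta>_def norm_divide norm_minus_commute)
    have wb: "w \<in> ball z \<eta>" unfolding w using n t by (intro inb) simp
    have "norm (f w) = exp (Re (g w))" using g(2)[OF wb] by simp
    also have "Re (g w) = Re (U \<zeta>) + Re (g z)" by (simp add: U_def w)
    also have "exp (Re (U \<zeta>) + Re (g z)) = exp (Re (U \<zeta>)) * norm (f z)"
      using g(2)[of z] \<eta> by (simp add: exp_add)
    also have "\<dots> \<le> exp 1 * norm (f z)"
      using U1[of \<zeta>] n complex_Re_le_cmod[of "U \<zeta>"] by (intro mult_right_mono) auto
    finally show ?thesis .
  qed
  have "\<eta> * t < \<eta> * 1" using t \<eta> by (intro mult_strict_left_mono) auto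
  then have sub: "cball z (\<eta> * t) \<subseteq> ball z \<eta>" by auto
  have "norm ((deriv ^^ i) f z) \<le> fact i * (exp 1 * norm (f z)) / (\<eta> * t) ^ i"
  proof (rule Cauchy_inequality)
    show "f holomorphic_on ball z (\<eta> * t)" "continuous_on (cball z (\<eta> * t)) f"
      using holomorphic_on_subset[OF hol sub] ball_subset_cball
      by (auto intro: holomorphic_on_imp_continuous_on holomorphic_on_subset)
  qed (use \<eta> t fe in auto)
  also have "\<eta> * t = \<eta> / (2 * B + 4)" by (simp add: t_def A_def)
  finally show ?thesis .
qed

lemma nicely_meromorphic_nonzero_at:
  assumes f: "f nicely_meromorphic_on UNIV" "nonzero_meromorphic f" and "zorder f w = 0"
  shows "f analytic_on {w}" "f w \<noteq> 0"
proof -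
  have "\<not> is_pole f w" "\<not> isolated_zero f w" using zorder_nonzero_iff[OF f(2), of w] assms(3) by auto
  then show "f analytic_on {w}" "f w \<noteq> 0"
    using nicely_meromorphic_on_imp_analytic_at[OF f(1)] zero_or_pole[OF f(1) _ _ nonzero_meromorphicD(2)[OF f(2)]]
    by auto
qed

lemma card_zeros_poles_le:
  assumes f: "nonzero_meromorphic f"
  shows "card (zeros_poles f R) \<le> pole_count f R + pole_count (\<lambda>z. inverse (f z)) R"
proof -
  let ?g = "\<lambda>z. inverse (f z)"
  have g: "nonzero_meromorphic ?g" by (rule nonzero_meromorphic_inverse[OF f])
  have p: "(\<Sum>a\<in>zeros_poles f R. pole_mult u a) = pole_count u R"
    if u: "nonzero_meromorphic u" "poles_in u R \<subseteq> zeros_poles f R" for u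
    using sum_poles_in_superset[OF u(1) finite_zeros_poles[OF f] u(2) zeros_poles_subset, of "\<lambda>_. 1"]
    by (simp add: pole_count_eq flip: of_nat_sum)
  have sg: "poles_in ?g R \<subseteq> zeros_poles f R"
    using poles_in_subset[OF g, of R] zorder_inverse_eq[OF f] by (auto simp: zeros_poles_def)
  have "card (zeros_poles f R) = (\<Sum>a\<in>zeros_poles f R. 1)" by simp
  also have "\<dots> \<le> (\<Sum>a\<in>zeros_poles f R. pole_mult f a + pole_mult ?g a)"
  proof (intro sum_mono)
    fix a assume "a \<in> zeros_poles f R"
    then have "zorder f a \<noteq> 0" by (simp add: zeros_poles_def)
    then show "1 \<le> pole_mult f a + pole_mult ?g a"
      unfolding pole_mult_def zorder_inverse_eq[OF f] by linarith
  qed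
  also have "\<dots> = pole_count f R + pole_count ?g R"
    by (simp add: sum.distrib p[OF f poles_in_subset[OF f]] p[OF g sg])
  finally show ?thesis .
qed

text \<open>On a circle separated from all zeros and poles, the pointwise bounds for f and 1/f
  control the variation of ln |f| on discs of radius e / 2. With Y the sum of their characteristics,
  n and L are O(Y + 1), so B is O((Y + 1)^2), and 1 / e is O(Y + 1). The product of the last two is
  the origin of the cube. Only polynomial dependence matters, since a logarithm is taken
  later.\<close>

lemma higher_deriv_le_on_circle:
  assumes f: "f nicely_meromorphic_on UNIV" "nonzero_meromorphic f"
  shows "\<exists>c\<ge>1. \<forall>r\<ge>1. \<exists>\<rho>. r \<le> \<rho> \<and> \<rho> \<le> 2 * r \<and>
     (\<forall>z. norm z = \<rho> \<longrightarrow> f analytic_on {z} \<and> f z \<noteq> 0 \<and>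
       (\<forall>i. norm ((deriv ^^ i) f z) \<le> 3 * fact i * (c * (nevanlinna_char f (16 * r) + c) ^ 3) ^ i * norm (f z)))"
proof -
  let ?g = "\<lambda>z. inverse (f z)"
  have g: "nonzero_meromorphic ?g" by (rule nonzero_meromorphic_inverse[OF f(2)])
  have mf: "f meromorphic_on UNIV" and mg: "?g meromorphic_on UNIV"
    using f(2) g by (auto simp: nonzero_meromorphic_def)
  \<comment> \<open>The number 60000 exceeds the 57600 = 2^3 * 7200 that appears at the end. The
    Jensen constant allows 1/f to be replaced by f.\<close>
  define c where "c = 60000 + \<bar>jensen_const f\<bar>"
  show ?thesis
  proof (rule exI[of _ c], intro conjI allI impI)
    fix r :: real assume r: "r \<ge> 1"
    define R where "R = 8 * r"
    define S where "S = zeros_poles f R"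
    define n where "n = real (card S)"
    define e where "e = r / (2 * (n + 1))"
    have n0: "n \<ge> 0" by (simp add: n_def)
    have e: "0 < e" "e \<le> r" using r n0 by (auto simp: e_def divide_le_eq algebra_simps)
    have fin: "finite S" unfolding S_def by (rule finite_zeros_poles[OF f(2)])
    obtain \<rho> where \<rho>: "r \<le> \<rho>" "\<rho> \<le> 2 * r" "\<And>a. a \<in> S \<Longrightarrow> \<bar>\<rho> - norm a\<bar> \<ge> e"
      using exists_separated_radius[OF fin, of r] r unfolding e_def n_def by auto
    define \<nu> where "\<nu> = real (pole_count f R) + real (pole_count ?g R)"
    have n\<nu>: "n \<le> \<nu>" using card_zeros_poles_le[OF f(2), of R] by (simp add: n_def \<nu>_def S_def)
    have \<nu>0: "\<nu> \<ge> 0" by (simp add: \<nu>_def)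
    define Y where "Y = nevanlinna_char f (2 * R) + nevanlinna_char ?g (2 * R)"
    have R: "R \<ge> 1" "2 * R \<ge> 1" "R \<le> 2 * R" "R > 0" using r by (auto simp: R_def)
    have Y0: "Y \<ge> 0" using nevanlinna_char_nonneg(1)[OF mf R(2)] nevanlinna_char_nonneg(1)[OF mg R(2)]
      by (simp add: Y_def)
    have \<nu>Y: "\<nu> \<le> 2 * Y"
    proof -
      have l: "pole_count u R * ln 2 \<le> nevanlinna_char u (2 * R)" if "u meromorphic_on UNIV" for u
        using pole_count_le_counting[OF that R(1,3)] nevanlinna_char_nonneg(3)[OF that R(2)] R
        by (simp add: ln_mult)
      have "\<nu> * ln 2 \<le> Y" using l[OF mf] l[OF mg] by (simp add: \<nu>_def Y_def ring_distribs)
      moreover have "\<nu> * (1 / 2) \<le> \<nu> * ln 2" using \<nu>0 ln2_ge_two_thirds by (intro mult_left_mono) auto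
      ultimately show ?thesis by simp
    qed
    \<comment> \<open>This is ln (2 R) - ln (e / 2), the largest cost of one pole for a point at
      distance at least e / 2 from it.\<close>
    define L where "L = ln (4 * R / e)"
    have Leq: "4 * R / e = 64 * (n + 1)" using r n0 by (simp add: R_def e_def field_simps)
    have L0: "L \<ge> 0" unfolding L_def Leq using n0 by simp
    have L: "L \<le> 64 * (\<nu> + 1)"
    proof -
      have "L \<le> ln (64 * (\<nu> + 1))" unfolding L_def Leq using n\<nu> n0 by (subst ln_le_cancel_iff) auto
      also have "\<dots> \<le> 64 * (\<nu> + 1)" using \<nu>0 ln_le_minus_one[of "64 * (\<nu> + 1)"] by simp
      finally show ?thesis .
    qed
    define B where "B = 3 * proximity_fun f R + 3 * proximity_fun ?g R + \<nu> * L"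
    have B0: "B \<ge> 0" using proximity_nonneg \<nu>0 L0 by (simp add: B_def)
    have BY: "B \<le> 400 * (Y + 1) ^ 2"
    proof -
      have pr: "3 * proximity_fun u R \<le> 9 * nevanlinna_char u (2 * R)" if "nonzero_meromorphic u" for u
        using nevanlinna_char_quasi_mono[OF that, of R "2 * R"] R
          nevanlinna_char_nonneg(2)[OF nonzero_meromorphicD(1)[OF that] R(1)] by simp
      have "\<nu> * L \<le> (2 * Y) * (64 * (2 * Y + 1))"
        using L \<nu>Y \<nu>0 L0 Y0 by (intro mult_mono) auto
      then have "B \<le> 9 * Y + (2 * Y) * (64 * (2 * Y + 1))"
        using pr[OF f(2)] pr[OF g] by (simp add: B_def Y_def)
      also have "\<dots> \<le> 400 * (Y + 1) ^ 2" using Y0 by (simp add: power2_eq_square algebra_simps)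
      finally show ?thesis .
    qed
    have point: "f analytic_on {w} \<and> f w \<noteq> 0" if z: "norm z = \<rho>" and w: "dist z w < e" for z w
    proof -
      have wz: "\<bar>norm w - norm z\<bar> < e" using w norm_triangle_ineq3[of w z] by (simp add: dist_norm norm_minus_commute)
      then have "norm w \<le> R" using z \<rho>(1,2) e r unfolding R_def by linarith
      moreover have "w \<notin> S" using \<rho>(3)[of w] wz z by auto
      ultimately have "zorder f w = 0" by (auto simp: S_def zeros_poles_def)
      then show ?thesis using nicely_meromorphic_nonzero_at[OF f] by blast
    qed
    have upper: "log_plus (norm (u w)) \<le> 3 * proximity_fun u R + pole_count u R * L"
      if u: "nonzero_meromorphic u" "poles_in u R \<subseteq> S" "u analytic_on {w}" and z: "norm z = \<rho>" and w: "dist z w < e / 2" for u z w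
    proof -
      have wz: "\<bar>norm w - norm z\<bar> < e / 2" using w norm_triangle_ineq3[of w z] by (simp add: dist_norm norm_minus_commute)
      then have wR: "norm w \<le> R / 2" using z \<rho>(1,2) e r unfolding R_def by linarith
      have "log_plus (norm (u w)) \<le> 3 * proximity_fun u R
         + (\<Sum>b\<in>poles_in u R. pole_mult u b * (ln (2 * R) - ln (norm (w - b))))"
        by (rule pointwise_le_proximity'[OF u(1) wR R(4) u(3)])
      also have "(\<Sum>b\<in>poles_in u R. pole_mult u b * (ln (2 * R) - ln (norm (w - b)))) \<le> (\<Sum>b\<in>poles_in u R. pole_mult u b * L)"
      proof (intro sum_mono mult_left_mono)
        fix b assume "b \<in> poles_in u R"
        then have "\<bar>\<rho> - norm b\<bar> \<ge> e" using \<rho>(3) u(2) by blast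
        then have "norm (w - b) \<ge> e / 2" using wz z norm_triangle_ineq3[of w b] by linarith
        then have "ln (e / 2) \<le> ln (norm (w - b))" using e by (intro ln_mono) auto
        moreover have "L = ln (2 * R) - ln (e / 2)"
        proof -
          have "L = ln (2 * R / (e / 2))" by (simp add: L_def)
          also have "\<dots> = ln (2 * R) - ln (e / 2)" using R e by (subst ln_div) simp_all
          finally show ?thesis .
        qed
        ultimately show "ln (2 * R) - ln (norm (w - b)) \<le> L" by simp
      qed simp
      finally show ?thesis by (simp add: pole_count_eq sum_distrib_right)
    qed
    have sf: "poles_in f R \<subseteq> S" unfolding S_def by (rule poles_in_subset[OF f(2)])
    have sg: "poles_in ?g R \<subseteq> S"
      using poles_in_subset[OF g, of R] zorder_inverse_eq[OF f(2)] by (auto simp: zeros_poles_def S_def)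
    have cc: "1 \<le> c" by (simp add: c_def)
    have T0: "nevanlinna_char f (16 * r) \<ge> 0" using r by (intro nevanlinna_char_nonneg(1)[OF mf]) auto
    have "norm ((deriv ^^ i) f z) \<le> 3 * fact i * (c * (nevanlinna_char f (16 * r) + c) ^ 3) ^ i * norm (f z)"
      if z: "norm z = \<rho>" for z i
    proof -
      have an: "f analytic_on ball z (e / 2)"
        by (subst analytic_on_analytic_at) (use point[OF z] e in auto)
      have "norm ((deriv ^^ i) f z) \<le> fact i * (exp 1 * norm (f z)) / ((e / 2) / (2 * B + 4)) ^ i"
      proof (rule higher_deriv_le_of_nonvanishing)
        show "f holomorphic_on ball z (e / 2)" using an by (rule analytic_imp_holomorphic)
        show "f w \<noteq> 0" if "w \<in> ball z (e / 2)" for w using point[OF z, of w] that e by auto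
        fix w assume w: "w \<in> ball z (e / 2)"
        have fw: "f analytic_on {w}" "f w \<noteq> 0" using point[OF z, of w] w e by auto
        have fz: "f analytic_on {z}" "f z \<noteq> 0" using point[OF z, of z] e by auto
        have gz: "?g analytic_on {z}" using fz by (intro analytic_intros) auto
        have "ln (norm (f w)) \<le> 3 * proximity_fun f R + pole_count f R * L"
          using upper[OF f(2) sf fw(1) z] w ln_le_log_plus[of "norm (f w)"] by (simp add: order_trans)
        moreover have "- ln (norm (f z)) \<le> 3 * proximity_fun ?g R + pole_count ?g R * L"
          using upper[OF g sg gz z] e ln_le_log_plus[of "norm (?g z)"] by (simp add: norm_inverse ln_inverse)
        ultimately show "ln (norm (f w)) - ln (norm (f z)) \<le> B" by (simp add: B_def \<nu>_def ring_distribs)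
      qed (use e B0 in auto)
      also have "\<dots> = fact i * (exp 1 * norm (f z)) * ((2 * B + 4) * 2 / e) ^ i"
        using e B0 by (simp add: power_divide field_simps)
      also have "\<dots> \<le> fact i * (3 * norm (f z)) * (c * (nevanlinna_char f (16 * r) + c) ^ 3) ^ i"
      proof (intro mult_mono power_mono)
        show "exp 1 \<le> (3::real)" by (rule exp_le)
        have "2 / e = 4 * (n + 1) / r" using r n0 by (simp add: e_def)
        \<comment> \<open>The assumption r >= 1 removes the radius, so that the bound depends on the
          characteristic alone.\<close>
        also have "\<dots> \<le> 4 * (n + 1) / 1" using r n0 by (intro divide_left_mono) auto
        also have "\<dots> \<le> 4 * (2 * Y + 1)" using n\<nu> \<nu>Y by simp
        also have "\<dots> \<le> 8 * (Y + 1)" using Y0 by simp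
        finally have e2: "2 / e \<le> 8 * (Y + 1)" .
        have "1 \<le> (Y + 1) ^ 2" using Y0 by simp
        then have "2 * B + 4 \<le> 900 * (Y + 1) ^ 2" using BY by simp
        then have "(2 * B + 4) * (2 / e) \<le> (900 * (Y + 1) ^ 2) * (8 * (Y + 1))"
          using e2 e B0 Y0 by (intro mult_mono) auto
        also have "\<dots> = 7200 * (Y + 1) ^ 3" by (simp add: power2_eq_square power3_eq_cube)
        also have "\<dots> \<le> 7200 * (2 * (nevanlinna_char f (16 * r) + c)) ^ 3"
        proof (intro mult_left_mono power_mono)
          have "nevanlinna_char f (2 * R) = nevanlinna_char ?g (2 * R) + jensen_const f"
            using R by (intro first_fundamental_theorem f) auto
          then have "Y + 1 \<le> 2 * nevanlinna_char f (2 * R) + \<bar>jensen_const f\<bar> + 1" by (simp add: Y_def)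
          then show "Y + 1 \<le> 2 * (nevanlinna_char f (16 * r) + c)" by (simp add: c_def R_def)
        qed (use Y0 in auto)
        also have "\<dots> = 57600 * (nevanlinna_char f (16 * r) + c) ^ 3"
          unfolding power_mult_distrib by simp
        also have "\<dots> \<le> c * (nevanlinna_char f (16 * r) + c) ^ 3"
          using T0 cc by (intro mult_right_mono) (auto simp: c_def)
        finally show "(2 * B + 4) * 2 / e \<le> c * (nevanlinna_char f (16 * r) + c) ^ 3" by simp
      qed (use B0 e in auto)
      finally show ?thesis by (simp add: mult_ac)
    qed
    moreover have "f analytic_on {z} \<and> f z \<noteq> 0" if "norm z = \<rho>" for z
      using point[OF that, of z] e by simp
    ultimately show "\<exists>\<rho>. r \<le> \<rho> \<and> \<rho> \<le> 2 * r \<and>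
     (\<forall>z. norm z = \<rho> \<longrightarrow> f analytic_on {z} \<and> f z \<noteq> 0 \<and>
       (\<forall>i. norm ((deriv ^^ i) f z) \<le> 3 * fact i * (c * (nevanlinna_char f (16 * r) + c) ^ 3) ^ i * norm (f z)))"
      using \<rho> by (intro exI[of _ \<rho>]) blast
  qed (simp add: c_def)
qed


text \<open>Naming the list of terms allows induction on it, including the empty list, and
  evaluation of the same differential polynomial at f and at \<open>remove_sings f\<close>.\<close>

definition diff_poly :: "(complex \<times> nat list) list \<Rightarrow> (complex \<Rightarrow> complex) \<Rightarrow> complex \<Rightarrow> complex" where
  "diff_poly ts f z = (\<Sum>(a, ns)\<leftarrow>ts. a * diff_monomial ns f z)"

lemma diff_poly_simps:
  "diff_poly [] f = (\<lambda>z. 0)"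
  "diff_poly ((a, ns) # ts) f = (\<lambda>z. a * diff_monomial ns f z + diff_poly ts f z)"
  by (auto simp: diff_poly_def fun_eq_iff)

lemma meromorphic_diff_poly:
  assumes "f meromorphic_on A"
  shows "diff_poly ts f meromorphic_on A"
proof (induction ts)
  case (Cons t ts)
  have "(\<lambda>z. diff_monomial ns f z) meromorphic_on A" for ns
    unfolding diff_monomial_def by (intro meromorphic_intros assms)
  then show ?case using Cons by (cases t) (auto simp: diff_poly_simps intro!: meromorphic_intros)
qed (auto simp: diff_poly_simps)

lemma analytic_diff_poly:
  assumes "f analytic_on A"
  shows "diff_poly ts f analytic_on A"
proof (induction ts)
  case (Cons t ts)
  have "(\<lambda>z. diff_monomial ns f z) analytic_on A" for ns
    unfolding diff_monomial_def by (intro analytic_intros analytic_higher_deriv assms)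
  then show ?case using Cons by (cases t) (auto simp: diff_poly_simps intro!: analytic_intros)
qed (simp add: diff_poly_simps)

lemma diff_poly_cong:
  assumes "eventually (\<lambda>w. f w = g w) (nhds z)"
  shows "diff_poly ts f z = diff_poly ts g z"
proof -
  have "(deriv ^^ i) f z = (deriv ^^ i) g z" for i
    by (rule higher_deriv_cong_ev[OF assms refl])
  then show ?thesis by (simp add: diff_poly_def diff_monomial_def)
qed

lemma norm_diff_monomial_le:
  assumes "E \<ge> 1" "\<And>i. i < length ns \<Longrightarrow> norm ((deriv ^^ i) f z) \<le> E"
  shows "norm (diff_monomial ns f z) \<le> E ^ (\<Sum>i<length ns. ns ! i)"
proof -
  have "norm (diff_monomial ns f z) = (\<Prod>i<length ns. norm ((deriv ^^ i) f z) ^ (ns ! i))"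
    by (simp add: diff_monomial_def norm_power flip: prod_norm)
  also have "\<dots> \<le> (\<Prod>i<length ns. E ^ (ns ! i))"
    using assms by (intro prod_mono) (auto intro!: power_mono)
  also have "\<dots> = E ^ (\<Sum>i<length ns. ns ! i)" by (rule power_sum[symmetric])
  finally show ?thesis .
qed

text \<open>The constants depend on the list of terms only, so one choice serves all points and
  radii. The condition E >= 1 allows the degrees of different monomials to be raised to a common
  exponent.\<close>

lemma norm_diff_poly_le:
  "\<exists>A L k. A \<ge> (1::real) \<and> (\<forall>f z E. E \<ge> 1 \<longrightarrow> (\<forall>i\<le>(k::nat). norm ((deriv ^^ i) f z) \<le> E)
     \<longrightarrow> norm (diff_poly ts f z) \<le> A * E ^ (L::nat))"
proof (induction ts)
  case Nil
  show ?case by (intro exI[of _ 1] exI[of _ 0]) (simp add: diff_poly_simps)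
next
  case (Cons t ts)
  obtain a ns where t: "t = (a, ns)" by (cases t)
  obtain A L k where IH: "A \<ge> (1::real)" "\<And>f z E. E \<ge> 1 \<Longrightarrow> (\<And>i. i \<le> (k::nat) \<Longrightarrow> norm ((deriv ^^ i) f z) \<le> E) \<Longrightarrow> norm (diff_poly ts f z) \<le> A * E ^ L"
    using Cons.IH by blast
  define d where "d = (\<Sum>i<length ns. ns ! i)"
  have "norm (diff_poly (t # ts) f z) \<le> (norm a + A) * E ^ (d + L)"
    if E: "E \<ge> 1" and le: "\<And>i. i \<le> k + length ns \<Longrightarrow> norm ((deriv ^^ i) f z) \<le> E" for f z E
  proof -
    have "norm (diff_poly (t # ts) f z) \<le> norm a * norm (diff_monomial ns f z) + norm (diff_poly ts f z)"
      unfolding t diff_poly_simps by (metis norm_triangle_ineq norm_mult)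
    also have "norm (diff_monomial ns f z) \<le> E ^ d"
      unfolding d_def using E le by (intro norm_diff_monomial_le) auto
    also have "E ^ d \<le> E ^ (d + L)" using E by (intro power_increasing) auto
    also have "norm (diff_poly ts f z) \<le> A * E ^ L" using E le by (intro IH(2)) auto
    also have "A * E ^ L \<le> A * E ^ (d + L)" using E IH(1) by (intro mult_left_mono power_increasing) auto
    finally show ?thesis by (simp add: mult_left_mono ring_distribs)
  qed
  moreover have "norm a + A \<ge> 1" using IH(1) by (simp add: add_increasing)
  ultimately show ?case by blast
qed

lemma log_plus_le_1: "0 \<le> x \<Longrightarrow> x \<le> 1 \<Longrightarrow> log_plus x = 0"
  by (cases "x = 0") (auto simp: log_plus_def)

text \<open>Where |f| > 1 the left integrand is 0. Where |f| <= 1 it is -ln |f| <= -alpha ln |f|,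
  which is ln |1/F| + ln |q| and thus at most ln |1/F| + ln W.\<close>

lemma proximity_inverse_le_power_mult:
  assumes f: "nonzero_meromorphic f" and q: "nonzero_meromorphic q" and \<rho>: "\<rho> > 0" and \<alpha>: "\<alpha> \<ge> 1" and W: "W \<ge> 1"
    and bd: "\<And>z. norm z = \<rho> \<Longrightarrow> norm (f z) \<le> 1 \<Longrightarrow> norm (q z) \<le> W"
  shows "proximity_fun (\<lambda>z. inverse (f z)) \<rho> \<le> proximity_fun (\<lambda>z. inverse (f z ^ \<alpha> * q z)) \<rho> + ln W"
proof -
  have F: "nonzero_meromorphic (\<lambda>z. f z ^ \<alpha> * q z)"
    by (intro nonzero_meromorphic_mult nonzero_meromorphic_power f q)
  have i: "circle_integrable (\<lambda>z. log_plus (norm (inverse (u z)))) \<rho>" if "nonzero_meromorphic u" for u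
    using nonzero_meromorphic_inverse[OF that] \<rho>
    by (intro circle_integrable_log_plus) (auto simp: nonzero_meromorphic_def)
  define X where "X = {z\<in>cball 0 \<rho>. \<not> f z ^ \<alpha> * q z \<noteq> 0}"
  have X: "finite X" unfolding X_def using F by (intro cosparse_finite_cball) (simp add: nonzero_meromorphic_def)
  have "proximity_fun (\<lambda>z. inverse (f z)) \<rho> \<le> circle_mean (\<lambda>z. log_plus (norm (inverse (f z ^ \<alpha> * q z))) + ln W) \<rho>"
    unfolding proximity_fun_eq
  proof (rule circle_mean_mono_finite[OF \<rho> X i[OF f]])
    show "circle_integrable (\<lambda>z. log_plus (norm (inverse (f z ^ \<alpha> * q z))) + ln W) \<rho>"
      by (intro circle_integrable_add i F) simp
    fix z :: complex assume z: "norm z = \<rho>" "z \<notin> X"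
    then have nz: "f z \<noteq> 0" "q z \<noteq> 0" using \<alpha> by (auto simp: X_def)
    have lW: "ln W \<ge> 0" using W by simp
    show "log_plus (norm (inverse (f z))) \<le> log_plus (norm (inverse (f z ^ \<alpha> * q z))) + ln W"
    proof (cases "norm (f z) \<le> 1")
      case True
      have "- ln (norm (f z)) \<ge> 0" using True nz by simp
      then have "- ln (norm (f z)) \<le> \<alpha> * (- ln (norm (f z)))"
        using \<alpha> mult_right_mono[of 1 "real \<alpha>" "- ln (norm (f z))"] by simp
      moreover have "ln (norm (q z)) \<le> ln W" using bd[OF z(1) True] nz by (intro ln_mono) auto
      moreover have "ln (norm (inverse (f z ^ \<alpha> * q z))) = - (\<alpha> * ln (norm (f z))) - ln (norm (q z))"
        using nz by (simp add: norm_inverse norm_mult norm_power ln_inverse ln_mult ln_realpow)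
      moreover have "log_plus (norm (inverse (f z))) = - ln (norm (f z))"
        using True nz by (simp add: log_plus_def norm_inverse ln_inverse)
      ultimately show ?thesis using ln_le_log_plus[of "norm (inverse (f z ^ \<alpha> * q z))"] by simp
    next
      case False
      then have "log_plus (norm (inverse (f z))) = 0"
        by (intro log_plus_le_1) (auto simp: norm_inverse inverse_le_1_iff)
      then show ?thesis using lW by (simp add: add_nonneg_nonneg)
    qed
  qed
  also have "\<dots> = proximity_fun (\<lambda>z. inverse (f z ^ \<alpha> * q z)) \<rho> + ln W"
    unfolding proximity_fun_eq by (subst circle_mean_add[OF i[OF F]]) auto
  finally show ?thesis .
qed

text \<open>At a zero of f the order alpha ord(f) + ord(q) of the product is at least ord(f), as
  alpha >= 1 and q has no pole there. For a differential polynomial the latter holds because f is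
  analytic at its zeros.\<close>

lemma counting_inverse_le_power_mult:
  assumes f: "nonzero_meromorphic f" and q: "nonzero_meromorphic q" and \<rho>: "\<rho> \<ge> 1" and \<alpha>: "\<alpha> \<ge> 1"
    and pos: "\<And>a. zorder f a > 0 \<Longrightarrow> zorder q a \<ge> 0"
  shows "counting_fun (\<lambda>z. inverse (f z)) \<rho> \<le> counting_fun (\<lambda>z. inverse (f z ^ \<alpha> * q z)) \<rho>"
proof -
  let ?F = "\<lambda>z. f z ^ \<alpha> * q z"
  have fa: "nonzero_meromorphic (\<lambda>z. f z ^ \<alpha>)" by (intro nonzero_meromorphic_power f)
  have F: "nonzero_meromorphic ?F" by (intro nonzero_meromorphic_mult fa q)
  note iF = nonzero_meromorphic_inverse[OF F] and fi = nonzero_meromorphic_inverse[OF f]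
  have \<rho>0: "\<rho> > 0" using \<rho> by simp
  have z: "zorder (\<lambda>z. inverse (?F z)) a = - (\<alpha> * zorder f a + zorder q a)" for a
    unfolding zorder_inverse_eq[OF F] zorder_mult_eq[OF fa q] zorder_power_eq[OF f] ..
  have le: "zorder f a \<le> \<alpha> * zorder f a + zorder q a" if "zorder f a > 0" for a
    using pos[OF that] mult_right_mono[of 1 "int \<alpha>" "zorder f a"] \<alpha> that by linarith
  define S where "S = poles_in (\<lambda>z. inverse (f z)) \<rho> \<union> poles_in (\<lambda>z. inverse (?F z)) \<rho>"
  have S: "finite S" "S \<subseteq> cball 0 \<rho>" "poles_in (\<lambda>z. inverse (f z)) \<rho> \<subseteq> S"
      "poles_in (\<lambda>z. inverse (?F z)) \<rho> \<subseteq> S"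
    using finite_poles_in nonzero_meromorphicD(1)[OF fi] nonzero_meromorphicD(1)[OF iF]
    by (auto simp: S_def poles_in_def)
  have N: "counting_fun u \<rho> = (\<Sum>a\<in>S. pole_mult u a * (ln \<rho> - ln (norm a)))"
    if u: "nonzero_meromorphic u" "poles_in u \<rho> \<subseteq> S" for u
    unfolding counting_fun_eq[OF nonzero_meromorphicD(1)[OF u(1)] \<rho>0]
    by (rule sum_poles_in_superset[OF u(1) S(1) u(2) S(2)])
  show ?thesis unfolding N[OF fi S(3)] N[OF iF S(4)]
  proof (intro sum_mono mult_right_mono)
    fix a assume "a \<in> S"
    then show "0 \<le> ln \<rho> - ln (norm a)" using \<rho> S(2) by (intro counting_term_nonneg) auto
    show "real (pole_mult (\<lambda>z. inverse (f z)) a) \<le> real (pole_mult (\<lambda>z. inverse (?F z)) a)"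
      using le[of a] unfolding pole_mult_def z zorder_inverse_eq[OF f] by linarith
  qed
qed

lemma zorder_nonneg_analytic:
  assumes "nonzero_meromorphic q" "q analytic_on {a}"
  shows "zorder q a \<ge> 0"
  using is_pole_iff_zorder_neg[OF assms(1), of a] analytic_at_imp_no_pole[OF assms(2)] by simp

text \<open>The good radius is sought in [2 r, 4 r], so that
  \<open>nevanlinna_char_quasi_mono\<close> applies from r to \<open>\<rho>\<close> and from
  \<open>\<rho>\<close> to 8 r; this gives 9 = 3 * 3. The derivative bound for radius 2 r brings in
  32 r. Normalizing f at its singularities makes it analytic at every point that is not a
  pole.\<close>

lemma nevanlinna_char_le_of_diff_poly_nice:
  assumes f: "f nicely_meromorphic_on UNIV" "nonzero_meromorphic f"
    and F: "nonzero_meromorphic (\<lambda>z. f z ^ \<alpha> * diff_poly ts f z)" and \<alpha>: "\<alpha> \<ge> 1"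
  shows "\<exists>K\<ge>1. \<forall>r\<ge>1. nevanlinna_char f r
     \<le> 9 * nevanlinna_char (\<lambda>z. f z ^ \<alpha> * diff_poly ts f z) (8 * r) + K + K * ln (nevanlinna_char f (32 * r) + K)"
proof -
  let ?Q = "diff_poly ts f" and ?F = "\<lambda>z. f z ^ \<alpha> * diff_poly ts f z"
  have mf: "f meromorphic_on UNIV" using f(2) by (simp add: nonzero_meromorphic_def)
  have Q: "nonzero_meromorphic ?Q"
  proof -
    have "\<forall>\<^sub>\<approx>z. ?F z \<noteq> 0" using F by (simp add: nonzero_meromorphic_def)
    then have "\<forall>\<^sub>\<approx>z. ?Q z \<noteq> 0" by eventually_elim auto
    then show ?thesis using meromorphic_diff_poly[OF mf] by (simp add: nonzero_meromorphic_def)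
  qed
  obtain c where c: "c \<ge> 1" "\<And>r. r \<ge> 1 \<Longrightarrow> \<exists>\<rho>. r \<le> \<rho> \<and> \<rho> \<le> 2 * r \<and>
     (\<forall>z. norm z = \<rho> \<longrightarrow> f analytic_on {z} \<and> f z \<noteq> 0 \<and>
       (\<forall>i. norm ((deriv ^^ i) f z) \<le> 3 * fact i * (c * (nevanlinna_char f (16 * r) + c) ^ 3) ^ i * norm (f z)))"
    using higher_deriv_le_on_circle[OF f] by blast
  obtain A L k where Q_le: "A \<ge> 1" "\<And>f z E. E \<ge> 1 \<Longrightarrow> (\<And>i. i \<le> k \<Longrightarrow> norm ((deriv ^^ i) f z) \<le> E) \<Longrightarrow> norm (diff_poly ts f z) \<le> A * E ^ L"
    using norm_diff_poly_le[of ts] by blast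
  define K0 where "K0 = ln A + L * (ln (3 * fact k) + k * ln c) + \<bar>jensen_const f\<bar> + \<bar>jensen_const ?F\<bar>"
  define K where "K = max c (max (3 * K0) (9 * real L * k))"
  have K: "K \<ge> c" "K \<ge> 3 * K0" "K \<ge> 9 * real L * k" "K \<ge> 1" using c(1) by (auto simp: K_def)
  have "nevanlinna_char f r \<le> 9 * nevanlinna_char ?F (8 * r) + K + K * ln (nevanlinna_char f (32 * r) + K)" if r: "r \<ge> 1" for r
  proof -
    define T where "T = nevanlinna_char f (32 * r)"
    have T0: "T \<ge> 0" unfolding T_def using r by (intro nevanlinna_char_nonneg(1)[OF mf]) auto
    define V where "V = c * (T + c) ^ 3"
    obtain \<rho> where \<rho>: "2 * r \<le> \<rho>" "\<rho> \<le> 4 * r"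
      "\<And>z. norm z = \<rho> \<Longrightarrow> f analytic_on {z} \<and> f z \<noteq> 0 \<and>
       (\<forall>i. norm ((deriv ^^ i) f z) \<le> 3 * fact i * V ^ i * norm (f z))"
      using c(2)[of "2 * r"] r unfolding V_def T_def by auto
    have \<rho>1: "\<rho> \<ge> 1" "\<rho> > 0" using \<rho> r by auto
    have Tc: "T + c \<ge> 1" using T0 c by simp
    have "1 * 1 \<le> c * (T + c) ^ 3" using Tc c(1) by (intro mult_mono one_le_power) auto
    then have V1: "V \<ge> 1" by (simp add: V_def)
    \<comment> \<open>One bound for all derivatives up to order k at points where |f| <= 1; there
      the factor \<open>norm (f z)\<close> is replaced by 1.\<close>
    define E where "E = 3 * fact k * V ^ k"
    have Ebd: "3 * fact i * V ^ i \<le> E" if "i \<le> k" for i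
      unfolding E_def using that V1 by (intro mult_mono power_increasing fact_mono) auto
    have E1: "E \<ge> 1" using Ebd[of 0] by simp
    define W where "W = A * E ^ L"
    have W1: "W \<ge> 1"
    proof -
      have "1 * 1 \<le> A * E ^ L" using Q_le(1) E1 by (intro mult_mono one_le_power) auto
      then show ?thesis by (simp add: W_def)
    qed
    have lnW: "ln W = ln A + L * (ln (3 * fact k) + k * (ln c + 3 * ln (T + c)))"
    proof -
      have "ln V = ln c + 3 * ln (T + c)" unfolding V_def using c(1) Tc by (simp add: ln_mult ln_realpow)
      moreover have "ln E = ln (3 * fact k) + k * ln V"
        unfolding E_def using V1 by (subst ln_mult) (auto simp: ln_realpow)
      moreover have "ln W = ln A + L * ln E"
        unfolding W_def using Q_le(1) E1 by (subst ln_mult) (auto simp: ln_realpow)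
      ultimately show ?thesis by simp
    qed
    have m: "proximity_fun (\<lambda>z. inverse (f z)) \<rho> \<le> proximity_fun (\<lambda>z. inverse (?F z)) \<rho> + ln W"
    proof (rule proximity_inverse_le_power_mult[OF f(2) Q \<rho>1(2) \<alpha> W1])
      fix z :: complex assume z: "norm z = \<rho>" "norm (f z) \<le> 1"
      show "norm (?Q z) \<le> W" unfolding W_def
      proof (rule Q_le(2)[OF E1])
        fix i assume i: "i \<le> k"
        have "norm ((deriv ^^ i) f z) \<le> 3 * fact i * V ^ i * norm (f z)" using \<rho>(3)[OF z(1)] by blast
        also have "\<dots> \<le> 3 * fact i * V ^ i * 1" using z(2) V1 by (intro mult_left_mono) auto
        also have "\<dots> \<le> E" using Ebd[OF i] by simp
        finally show "norm ((deriv ^^ i) f z) \<le> E" .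
      qed
    qed
    have N: "counting_fun (\<lambda>z. inverse (f z)) \<rho> \<le> counting_fun (\<lambda>z. inverse (?F z)) \<rho>"
    proof (rule counting_inverse_le_power_mult[OF f(2) Q \<rho>1(1) \<alpha>])
      fix a assume "zorder f a > 0"
      then have "\<not> is_pole f a" using is_pole_iff_zorder_neg[OF f(2)] by simp
      then have "f analytic_on {a}" using nicely_meromorphic_on_imp_analytic_at[OF f(1)] by simp
      then show "zorder ?Q a \<ge> 0" by (intro zorder_nonneg_analytic[OF Q] analytic_diff_poly)
    qed
    have "nevanlinna_char f \<rho> = nevanlinna_char (\<lambda>z. inverse (f z)) \<rho> + jensen_const f"
      by (rule first_fundamental_theorem[OF f(2) \<rho>1(2)])
    also have "nevanlinna_char (\<lambda>z. inverse (f z)) \<rho> \<le> nevanlinna_char (\<lambda>z. inverse (?F z)) \<rho> + ln W"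
      using m N by (simp add: nevanlinna_char_def)
    also have "nevanlinna_char (\<lambda>z. inverse (?F z)) \<rho> = nevanlinna_char ?F \<rho> - jensen_const ?F"
      using first_fundamental_theorem[OF F \<rho>1(2)] by simp
    also have "nevanlinna_char ?F \<rho> \<le> 3 * nevanlinna_char ?F (8 * r)"
      using \<rho> r by (intro nevanlinna_char_quasi_mono[OF F]) auto
    finally have "nevanlinna_char f \<rho> \<le> 3 * nevanlinna_char ?F (8 * r) + (ln W + \<bar>jensen_const f\<bar> + \<bar>jensen_const ?F\<bar>)"
      by simp
    also have "ln W + \<bar>jensen_const f\<bar> + \<bar>jensen_const ?F\<bar> = K0 + 3 * real L * k * ln (T + c)"
      unfolding lnW K0_def by (simp add: algebra_simps)
    finally have "nevanlinna_char f \<rho> \<le> 3 * nevanlinna_char ?F (8 * r) + (K0 + 3 * real L * k * ln (T + c))" .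
    moreover have "nevanlinna_char f r \<le> 3 * nevanlinna_char f \<rho>"
      using \<rho> r by (intro nevanlinna_char_quasi_mono[OF f(2)]) auto
    ultimately have "nevanlinna_char f r \<le> 9 * nevanlinna_char ?F (8 * r) + 3 * K0 + 9 * real L * k * ln (T + c)"
      by simp
    also have "9 * real L * k * ln (T + c) \<le> K * ln (T + K)"
      using K Tc by (intro mult_mono ln_mono) auto
    finally show ?thesis using K by (simp add: T_def)
  qed
  then show ?thesis using K(4) by blast
qed

text \<open>Reduction to the normalized function \<open>remove_sings f\<close>. Derivatives at a
  point need agreement in a whole neighbourhood, which is available wherever f is analytic, that is,
  off a sparse set; the characteristic does not see the rest.\<close>

lemma nevanlinna_char_le_of_diff_poly:
  assumes f: "nonzero_meromorphic f" and Q: "differential_polynomial_in f Q" and \<alpha>: "\<alpha> \<ge> 1"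
    and F: "\<not> (\<forall>\<^sub>\<approx>z. f z ^ \<alpha> * Q z = 0)"
  shows "\<exists>K\<ge>1. \<forall>r\<ge>1. nevanlinna_char f r
     \<le> 9 * nevanlinna_char (\<lambda>z. f z ^ \<alpha> * Q z) (8 * r) + K + K * ln (nevanlinna_char f (32 * r) + K)"
proof -
  have mf: "f meromorphic_on UNIV" using f by (simp add: nonzero_meromorphic_def)
  obtain ts where ts: "Q = diff_poly ts f"
    using Q by (auto simp: differential_polynomial_in_def diff_poly_def fun_eq_iff)
  define h where "h = remove_sings f"
  have h: "h nicely_meromorphic_on UNIV" unfolding h_def by (rule remove_sings_nicely_meromorphic[OF mf])
  have eq: "\<forall>\<^sub>\<approx>z. h z = f z" unfolding h_def by (rule eventually_remove_sings_eq[OF mf])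
  have nh: "nonzero_meromorphic h"
  proof -
    have "\<forall>\<^sub>\<approx>z. f z \<noteq> 0" using f by (simp add: nonzero_meromorphic_def)
    with eq have "\<forall>\<^sub>\<approx>z. h z \<noteq> 0" by eventually_elim simp
    then show ?thesis using h by (simp add: nonzero_meromorphic_def nicely_meromorphic_on_def)
  qed
  have "\<forall>\<^sub>\<approx>z. f analytic_on {z}" by (rule meromorphic_on_imp_analytic_cosparse[OF mf])
  with eq have eqF: "\<forall>\<^sub>\<approx>z. f z ^ \<alpha> * Q z = h z ^ \<alpha> * diff_poly ts h z"
  proof eventually_elim
    case (elim z)
    have "eventually (\<lambda>w. h w = f w) (nhds z)"
      unfolding h_def by (rule eventually_remove_sings_eq_nhds[OF elim(2)])
    then have "diff_poly ts h z = diff_poly ts f z" by (rule diff_poly_cong)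
    then show ?case using elim(1) ts by simp
  qed
  have "(\<lambda>z. h z ^ \<alpha> * diff_poly ts h z) meromorphic_on UNIV"
    using nh by (intro meromorphic_intros meromorphic_diff_poly) (auto simp: nonzero_meromorphic_def)
  moreover have "\<not> (\<forall>\<^sub>\<approx>z. h z ^ \<alpha> * diff_poly ts h z = 0)"
  proof
    assume "\<forall>\<^sub>\<approx>z. h z ^ \<alpha> * diff_poly ts h z = 0"
    with eqF have "\<forall>\<^sub>\<approx>z. f z ^ \<alpha> * Q z = 0" by eventually_elim simp
    with F show False by blast
  qed
  ultimately have nF: "nonzero_meromorphic (\<lambda>z. h z ^ \<alpha> * diff_poly ts h z)"
    using not_nonzero_meromorphic by blast
  obtain K where K: "K \<ge> 1" "\<And>r. r \<ge> 1 \<Longrightarrow> nevanlinna_char h r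
     \<le> 9 * nevanlinna_char (\<lambda>z. h z ^ \<alpha> * diff_poly ts h z) (8 * r) + K + K * ln (nevanlinna_char h (32 * r) + K)"
    using nevanlinna_char_le_of_diff_poly_nice[OF h nh nF \<alpha>] by blast
  have "nevanlinna_char f r
     \<le> 9 * nevanlinna_char (\<lambda>z. f z ^ \<alpha> * Q z) (8 * r) + K + K * ln (nevanlinna_char f (32 * r) + K)" if "r \<ge> 1" for r
    using K(2)[OF that] nevanlinna_char_cong[OF eq, of r] nevanlinna_char_cong[OF eq, of "32 * r"]
      nevanlinna_char_cong[OF eqF, of "8 * r"] that by simp
  then show ?thesis using K(1) by blast
qed

section \<open>Iterated logarithms and orders\<close>

lemma eventually_gt_of_filterlim: "filterlim h at_top F \<Longrightarrow> eventually (\<lambda>x. (c::real) < h x) F"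
  unfolding filterlim_at_top_dense by blast

lemma eventually_ge_of_filterlim: "filterlim h at_top F \<Longrightarrow> eventually (\<lambda>x. (c::real) \<le> h x) F"
  unfolding filterlim_at_top by blast

lemma iter_ln_Suc_right: "(ln ^^ Suc k) x = (ln ^^ k) (ln x)"
  unfolding funpow_Suc_right by simp

lemma filterlim_iter_ln: "filterlim ((ln :: real \<Rightarrow> real) ^^ k) at_top at_top"
proof (induction k)
  case 0 show ?case by (simp add: filterlim_ident)
next
  case (Suc k)
  show ?case using filterlim_compose[OF ln_at_top Suc] by (simp add: comp_def)
qed

lemma filterlim_iter_exp: "filterlim ((exp :: real \<Rightarrow> real) ^^ k) at_top at_top"
proof (induction k)
  case 0 show ?case by (simp add: filterlim_ident)
next
  case (Suc k)
  show ?case using filterlim_compose[OF exp_at_top Suc] by (simp add: comp_def)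
qed

lemma iter_ln_iter_exp: "(ln ^^ k) ((exp ^^ k) x) = (x::real)"
proof (induction k)
  case (Suc k)
  have "(ln ^^ Suc k) ((exp ^^ Suc k) x) = (ln ^^ k) (ln (exp ((exp ^^ k) x)))"
    unfolding iter_ln_Suc_right by simp
  then show ?case using Suc by simp
qed simp

lemma less_ln_iff: "0 < x \<Longrightarrow> a < ln x \<longleftrightarrow> exp a < (x::real)"
  by (metis exp_less_cancel_iff exp_ln)

text \<open>Above exp^[k] 0 every argument met by the k logarithms is positive, and there the total
  function \<open>ln\<close> is monotone.\<close>

lemma iter_ln_mono:
  assumes "(exp ^^ k) 0 < x" "x \<le> (y::real)"
  shows "(ln ^^ k) x \<le> (ln ^^ k) y"
  using assms
proof (induction k arbitrary: x y)
  case (Suc k)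
  have x: "exp ((exp ^^ k) 0) < x" using Suc.prems by simp
  then have "0 < x" using exp_gt_zero less_trans by blast
  then have "(exp ^^ k) 0 < ln x" "ln x \<le> ln y" using x Suc.prems by (auto simp: less_ln_iff)
  then show ?case unfolding iter_ln_Suc_right by (rule Suc.IH)
qed simp

lemma iter_ln_strict_mono:
  assumes "(exp ^^ k) 0 < x" "x < (y::real)"
  shows "(ln ^^ k) x < (ln ^^ k) y"
  using assms
proof (induction k arbitrary: x y)
  case (Suc k)
  have x: "exp ((exp ^^ k) 0) < x" using Suc.prems by simp
  then have "0 < x" using exp_gt_zero less_trans by blast
  then have "(exp ^^ k) 0 < ln x" "ln x < ln y" using x Suc.prems by (auto simp: less_ln_iff)
  then show ?case unfolding iter_ln_Suc_right by (rule Suc.IH)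
qed simp

text \<open>For x >= 1 one has ln (x + c) <= ln x + ln (1 + c) <= ln x + c, so an additive constant
  does not grow under further logarithms.\<close>

lemma eventually_iter_ln_add_le:
  assumes "(c::real) \<ge> 0"
  shows "eventually (\<lambda>x. (ln ^^ k) (x + c) \<le> (ln ^^ k) x + c) at_top"
proof (induction k)
  case (Suc k)
  have 1: "eventually (\<lambda>x. (ln ^^ k) (ln x + c) \<le> (ln ^^ k) (ln x) + c) at_top"
    using eventually_compose_filterlim[OF Suc ln_at_top] .
  have 2: "eventually (\<lambda>x::real. x > (exp ^^ Suc k) 0 \<and> x \<ge> 1) at_top"
    by (intro eventually_conj eventually_gt_at_top eventually_ge_at_top)
  show ?case using 1 2
  proof eventually_elim
    case (elim x)
    have x: "x \<ge> 1" "exp ((exp ^^ k) 0) < x" using elim(2) by auto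
    have "x + c \<le> x * (1 + c)" using x assms mult_right_mono[of 1 x c] by (simp add: ring_distribs)
    then have "ln (x + c) \<le> ln (x * (1 + c))" using x assms by (intro ln_mono) auto
    also have "\<dots> = ln x + ln (1 + c)" using x assms by (simp add: ln_mult)
    also have "ln (1 + c) \<le> c" using assms by (rule ln_add_one_self_le_self)
    finally have le: "ln (x + c) \<le> ln x + c" by simp
    have "(exp ^^ k) 0 < ln x" using x by (simp add: less_ln_iff)
    also have "ln x \<le> ln (x + c)" using x assms by (intro ln_mono) auto
    finally have "(ln ^^ k) (ln (x + c)) \<le> (ln ^^ k) (ln x + c)" using le by (intro iter_ln_mono) auto
    then show ?case unfolding iter_ln_Suc_right using elim(1) by linarith
  qed
qed simp

text \<open>The first logarithm turns the factor into an additive constant, hence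
  \<open>Suc k\<close>. This is how dilations and constant factors are discarded.\<close>

lemma eventually_iter_ln_mult_le:
  assumes "(A::real) \<ge> 1"
  shows "eventually (\<lambda>x. (ln ^^ Suc k) (A * x) \<le> (ln ^^ Suc k) x + ln A) at_top"
proof -
  have "eventually (\<lambda>x. (ln ^^ k) (ln x + ln A) \<le> (ln ^^ k) (ln x) + ln A) at_top"
    using eventually_compose_filterlim[OF eventually_iter_ln_add_le ln_at_top] assms by simp
  then show ?thesis using eventually_gt_at_top[of 0]
  proof eventually_elim
    case (elim x)
    then show ?case using assms unfolding iter_ln_Suc_right by (simp add: ln_mult add.commute)
  qed
qed

lemma eventually_iter_ln_le_self: "eventually (\<lambda>x::real. (ln ^^ k) x \<le> x) at_top"
proof (induction k)
  case (Suc k)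
  have "eventually (\<lambda>x::real. (ln ^^ k) x > 0) at_top"
    by (rule eventually_gt_of_filterlim[OF filterlim_iter_ln[of k]])
  with Suc show ?case
  proof eventually_elim
    case (elim x)
    have "ln ((ln ^^ k) x) \<le> (ln ^^ k) x - 1" using elim by (intro ln_le_minus_one)
    then show ?case using elim by simp
  qed
qed simp

lemma filterlim_cmult_at_top: "(s::real) > 0 \<Longrightarrow> filterlim (\<lambda>r. s * r) at_top at_top"
  by (rule filterlim_tendsto_pos_mult_at_top[OF tendsto_const _ filterlim_ident])

lemma eventually_ln_mult_le:
  assumes "(l::real) > 0"
  shows "eventually (\<lambda>x. ln x + c \<le> l * x) at_top"
proof -
  have "((\<lambda>x::real. ln x / x) \<longlongrightarrow> 0) at_top" using ln_x_over_x_tendsto_0 .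
  then have "eventually (\<lambda>x::real. ln x / x < l / 2) at_top"
    using assms by (intro order_tendstoD(2)) auto
  then show ?thesis using eventually_ge_at_top[of "max 1 (2 * c / l)"]
  proof eventually_elim
    case (elim x)
    have x: "x \<ge> 1" "2 * c / l \<le> x" using elim by auto
    have "ln x < l / 2 * x" using elim x by (simp add: divide_less_eq)
    moreover have "c \<le> l / 2 * x" using x assms by (simp add: divide_le_eq mult.commute)
    ultimately show ?case by (simp add: field_simps)
  qed
qed

text \<open>If the inequality fails at r, then j + 1 logarithms bound ln^[j+1] T(r) by ln^[j+2] T(s
  r) + O(1). The upper growth bound makes this ln (ln^[q] r) + O(1), whereas the lower one demands l
  ln^[q] r, which is larger eventually.\<close>

lemma log_of_dilation_negligible:
  fixes T :: "real \<Rightarrow> real"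
  assumes T: "filterlim T at_top at_top"
    and lo: "eventually (\<lambda>r. l * (ln ^^ q) r \<le> (ln ^^ Suc j) (T r)) at_top" "l > 0"
    and up: "eventually (\<lambda>r. (ln ^^ Suc j) (T r) \<le> b * (ln ^^ q) r) at_top" "b > 0"
    and C: "C \<ge> 1" and K: "K \<ge> 0" and s: "s \<ge> 1"
  shows "eventually (\<lambda>r. C * ln (T (s * r) + K) \<le> T r) at_top"
proof -
  have sl: "filterlim (\<lambda>r::real. s * r) at_top at_top" using s by (intro filterlim_cmult_at_top) auto
  have Ts: "filterlim (\<lambda>r. T (s * r)) at_top at_top" by (rule filterlim_compose[OF T sl])
  have "eventually (\<lambda>x::real. (ln ^^ Suc (Suc j)) (x + K) \<le> (ln ^^ Suc (Suc j)) x + K) at_top"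
    by (rule eventually_iter_ln_add_le[OF K])
  from eventually_compose_filterlim[OF this Ts]
  have e1: "eventually (\<lambda>r. (ln ^^ Suc (Suc j)) (T (s * r) + K) \<le> (ln ^^ Suc (Suc j)) (T (s * r)) + K) at_top" .
  have TK: "filterlim (\<lambda>r. ln (T (s * r) + K)) at_top at_top"
  proof (rule filterlim_compose[OF ln_at_top])
    show "filterlim (\<lambda>r. T (s * r) + K) at_top at_top"
      using filterlim_tendsto_add_at_top[OF tendsto_const Ts, of K] by (simp add: add.commute)
  qed
  from eventually_compose_filterlim[OF eventually_iter_ln_mult_le[OF C, of j] TK]
  have e2: "eventually (\<lambda>r. (ln ^^ Suc j) (C * ln (T (s * r) + K)) \<le> (ln ^^ Suc j) (ln (T (s * r) + K)) + ln C) at_top" .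
  from eventually_compose_filterlim[OF up(1) sl]
  have e3: "eventually (\<lambda>r. (ln ^^ Suc j) (T (s * r)) \<le> b * (ln ^^ q) (s * r)) at_top" .
  have "filterlim (\<lambda>r. (ln ^^ Suc j) (T (s * r))) at_top at_top"
    by (rule filterlim_compose[OF filterlim_iter_ln Ts])
  then have e4: "eventually (\<lambda>r. (ln ^^ Suc j) (T (s * r)) > 0) at_top"
    unfolding filterlim_at_top_dense by blast
  have e5: "eventually (\<lambda>r. (ln ^^ Suc q) (s * r) \<le> (ln ^^ Suc q) r + ln s) at_top"
    by (rule eventually_iter_ln_mult_le[OF s])
  define c where "c = K + ln C + ln b + ln s"
  from eventually_compose_filterlim[OF eventually_ln_mult_le[OF lo(2), of "c + 1"] filterlim_iter_ln[of q]]
  have e6: "eventually (\<lambda>r. ln ((ln ^^ q) r) + (c + 1) \<le> l * (ln ^^ q) r) at_top" .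
  have e7: "eventually (\<lambda>r. (ln ^^ q) (s * r) > 0) at_top"
    by (rule eventually_gt_of_filterlim[OF filterlim_compose[OF filterlim_iter_ln[of q] sl]])
  have e8: "eventually (\<lambda>r. T r > (exp ^^ Suc j) 0) at_top"
    by (rule eventually_gt_of_filterlim[OF T])
  from e1 e2 e3 e4 e5 e6 e7 e8 lo(1) show ?thesis
  proof eventually_elim
    case (elim r)
    show ?case
    proof (rule ccontr)
      assume "\<not> ?thesis"
      then have "(ln ^^ Suc j) (T r) < (ln ^^ Suc j) (C * ln (T (s * r) + K))"
        using elim(8) by (intro iter_ln_strict_mono) auto
      also have "\<dots> \<le> (ln ^^ Suc j) (ln (T (s * r) + K)) + ln C" by (rule elim(2))
      also have "(ln ^^ Suc j) (ln (T (s * r) + K)) = (ln ^^ Suc (Suc j)) (T (s * r) + K)"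
        by (rule iter_ln_Suc_right[symmetric])
      also have "\<dots> \<le> (ln ^^ Suc (Suc j)) (T (s * r)) + K" by (rule elim(1))
      also have "(ln ^^ Suc (Suc j)) (T (s * r)) = ln ((ln ^^ Suc j) (T (s * r)))" by simp
      also have "\<dots> \<le> ln (b * (ln ^^ q) (s * r))" using elim(3,4) by (intro ln_mono)
      also have "\<dots> = ln b + (ln ^^ Suc q) (s * r)" using up(2) elim(7) by (simp add: ln_mult)
      also have "(ln ^^ Suc q) (s * r) \<le> (ln ^^ Suc q) r + ln s" by (rule elim(5))
      also have "(ln ^^ Suc q) r = ln ((ln ^^ q) r)" by simp
      finally have "(ln ^^ Suc j) (T r) < ln ((ln ^^ q) r) + c" by (simp add: c_def)
      then show False using elim(6,9) by linarith
    qed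
  qed
qed

text \<open>The factor A and the dilation s cost the constant ln A + l ln s. It is absorbed by (l -
  l') ln^[k+1] r, which tends to infinity.\<close>

lemma iter_ln_lower_bound_transfer:
  fixes T S :: "real \<Rightarrow> real"
  assumes T: "filterlim T at_top at_top"
    and lo: "eventually (\<lambda>r. l * (ln ^^ Suc k) r \<le> (ln ^^ Suc j) (T r)) at_top" and l: "l > 0" "l' < l"
    and le: "eventually (\<lambda>r. T r \<le> A * S (s * r)) at_top" and A: "A \<ge> 1" and s: "s \<ge> 1"
  shows "eventually (\<lambda>r. l' * (ln ^^ Suc k) r \<le> (ln ^^ Suc j) (S r)) at_top"
proof -
  have sl: "filterlim (\<lambda>r::real. r / s) at_top at_top"
    using filterlim_cmult_at_top[of "1 / s"] s by simp
  have Ts: "filterlim (\<lambda>r. T (r / s)) at_top at_top" by (rule filterlim_compose[OF T sl])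
  have e1: "eventually (\<lambda>r. T (r / s) \<le> A * S r) at_top"
    using eventually_compose_filterlim[OF le sl] s by simp
  have Slim: "filterlim S at_top at_top"
  proof (rule filterlim_at_top_mono)
    show "filterlim (\<lambda>r. 1 / A * T (r / s)) at_top at_top"
      using A by (intro filterlim_tendsto_pos_mult_at_top[OF tendsto_const _ Ts]) auto
    show "eventually (\<lambda>r. 1 / A * T (r / s) \<le> S r) at_top"
      using e1 by eventually_elim (use A in \<open>simp add: divide_le_eq mult.commute\<close>)
  qed
  have e2: "eventually (\<lambda>r. (ln ^^ Suc j) (A * S r) \<le> (ln ^^ Suc j) (S r) + ln A) at_top"
    by (rule eventually_compose_filterlim[OF eventually_iter_ln_mult_le[OF A] Slim])
  have e3: "eventually (\<lambda>r. T (r / s) > (exp ^^ Suc j) 0) at_top"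
    by (rule eventually_gt_of_filterlim[OF Ts])
  have e4: "eventually (\<lambda>r. l * (ln ^^ Suc k) (r / s) \<le> (ln ^^ Suc j) (T (r / s))) at_top"
    by (rule eventually_compose_filterlim[OF lo sl])
  have e5: "eventually (\<lambda>r. (ln ^^ Suc k) r \<le> (ln ^^ Suc k) (r / s) + ln s) at_top"
    using eventually_compose_filterlim[OF eventually_iter_ln_mult_le[OF s, of k] sl] s by simp
  have e6: "eventually (\<lambda>r. (l * ln s + ln A) / (l - l') \<le> (ln ^^ Suc k) r) at_top"
    by (rule eventually_ge_of_filterlim[OF filterlim_iter_ln[of "Suc k"]])
  from e1 e2 e3 e4 e5 e6 show ?thesis
  proof eventually_elim
    case (elim r)
    have "l * (ln ^^ Suc k) r \<le> l * ((ln ^^ Suc k) (r / s) + ln s)"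
      using elim(5) l by (intro mult_left_mono) auto
    also have "\<dots> \<le> (ln ^^ Suc j) (T (r / s)) + l * ln s" using elim(4) by (simp only: ring_distribs)
    also have "(ln ^^ Suc j) (T (r / s)) \<le> (ln ^^ Suc j) (A * S r)"
      using elim(1,3) by (rule iter_ln_mono[rotated])
    also have "\<dots> \<le> (ln ^^ Suc j) (S r) + ln A" by (rule elim(2))
    finally have 1: "l * (ln ^^ Suc k) r \<le> (ln ^^ Suc j) (S r) + ln A + l * ln s" by simp
    have "l * ln s + ln A \<le> (l - l') * (ln ^^ Suc k) r"
      using elim(6) l by (simp add: divide_le_eq mult.commute del: funpow.simps)
    then show ?case using 1 by (simp only: left_diff_distrib)
  qed
qed

text \<open>One logarithm beyond the order of f turns the factor b into the additive constant ln b.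
  The cube becomes a factor 3 after one logarithm and an additive ln 3 after the next.\<close>

lemma iter_ln_upper_bound_compose:
  fixes T U M :: "real \<Rightarrow> real"
  assumes U: "filterlim U at_top at_top" and M: "filterlim M at_top at_top"
    and up: "eventually (\<lambda>r. (ln ^^ Suc j) (T r) \<le> b * (ln ^^ Suc k) r) at_top" "b > 0"
    and le: "eventually (\<lambda>r. U r \<le> A * T (M r ^ 3)) at_top" and A: "A \<ge> 1"
  shows "\<exists>C\<ge>0. eventually (\<lambda>r. (ln ^^ Suc (Suc j)) (U r) \<le> (ln ^^ Suc (Suc k)) (M r) + C) at_top"
proof -
  have M3: "filterlim (\<lambda>r. M r ^ 3) at_top at_top" by (rule filterlim_pow_at_top[OF _ M]) simp
  have X: "filterlim (\<lambda>r. T (M r ^ 3)) at_top at_top"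
  proof (rule filterlim_at_top_mono)
    show "filterlim (\<lambda>r. 1 / A * U r) at_top at_top"
      using A by (intro filterlim_tendsto_pos_mult_at_top[OF tendsto_const _ U]) auto
    show "eventually (\<lambda>r. 1 / A * U r \<le> T (M r ^ 3)) at_top"
      using le by eventually_elim (use A in \<open>simp add: divide_le_eq mult.commute\<close>)
  qed
  have e1: "eventually (\<lambda>r. (ln ^^ Suc (Suc j)) (A * T (M r ^ 3)) \<le> (ln ^^ Suc (Suc j)) (T (M r ^ 3)) + ln A) at_top"
    by (rule eventually_compose_filterlim[OF eventually_iter_ln_mult_le[OF A] X])
  have e2: "eventually (\<lambda>r. U r > (exp ^^ Suc (Suc j)) 0) at_top"
    by (rule eventually_gt_of_filterlim[OF U])
  have e3: "eventually (\<lambda>r. (ln ^^ Suc j) (T (M r ^ 3)) \<le> b * (ln ^^ Suc k) (M r ^ 3)) at_top"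
    by (rule eventually_compose_filterlim[OF up(1) M3])
  have e4: "eventually (\<lambda>r. (ln ^^ Suc j) (T (M r ^ 3)) > 0) at_top"
    by (rule eventually_gt_of_filterlim[OF filterlim_compose[OF filterlim_iter_ln[of "Suc j"] X]])
  have e5: "eventually (\<lambda>r. (ln ^^ Suc k) (M r ^ 3) > 0) at_top"
    by (rule eventually_gt_of_filterlim[OF filterlim_compose[OF filterlim_iter_ln[of "Suc k"] M3]])
  have e6: "eventually (\<lambda>r. (ln ^^ Suc k) (3 * ln (M r)) \<le> (ln ^^ Suc k) (ln (M r)) + ln 3) at_top"
    by (rule eventually_compose_filterlim[OF eventually_iter_ln_mult_le filterlim_compose[OF ln_at_top M]]) simp
  have e7: "eventually (\<lambda>r. M r > 0) at_top" by (rule eventually_gt_of_filterlim[OF M])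
  define C where "C = \<bar>ln A + ln b + ln 3\<bar>"
  from e1 e2 e3 e4 e5 e6 e7 le have "eventually (\<lambda>r. (ln ^^ Suc (Suc j)) (U r) \<le> (ln ^^ Suc (Suc k)) (M r) + C) at_top"
  proof eventually_elim
    case (elim r)
    have "(ln ^^ Suc (Suc j)) (U r) \<le> (ln ^^ Suc (Suc j)) (A * T (M r ^ 3))"
      using elim(2,8) by (rule iter_ln_mono)
    also have "\<dots> \<le> (ln ^^ Suc (Suc j)) (T (M r ^ 3)) + ln A" by (rule elim(1))
    also have "(ln ^^ Suc (Suc j)) (T (M r ^ 3)) = ln ((ln ^^ Suc j) (T (M r ^ 3)))" by simp
    also have "\<dots> \<le> ln (b * (ln ^^ Suc k) (M r ^ 3))" using elim(3,4) by (intro ln_mono)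
    also have "\<dots> = ln b + ln ((ln ^^ Suc k) (M r ^ 3))" using up(2) elim(5) by (subst ln_mult) auto
    also have "ln ((ln ^^ Suc k) (M r ^ 3)) = (ln ^^ Suc (Suc k)) (M r ^ 3)" by simp
    also have "\<dots> = (ln ^^ Suc k) (3 * ln (M r))"
      unfolding iter_ln_Suc_right[of "Suc k"] using elim(7) by (simp only: ln_realpow) simp
    also have "\<dots> \<le> (ln ^^ Suc k) (ln (M r)) + ln 3" by (rule elim(6))
    also have "(ln ^^ Suc k) (ln (M r)) = (ln ^^ Suc (Suc k)) (M r)" by (rule iter_ln_Suc_right[symmetric])
    finally show ?case unfolding C_def by linarith
  qed
  then show ?thesis by (intro exI[of _ C]) (simp add: C_def)
qed


section \<open>Orders as eventual bounds, and upper limits of quotients\<close>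

lemma max_modulus_const: "r > 0 \<Longrightarrow> max_modulus (\<lambda>_. c) r = norm c"
proof -
  assume "r > 0"
  then have "sphere (0::complex) r \<noteq> {}" by simp
  then show ?thesis by (simp add: max_modulus_def)
qed

lemma tendsto_const_over_iter_ln:
  "((\<lambda>r. c / (ln ^^ n) r) \<longlongrightarrow> (0::real)) at_top"
  by (intro tendsto_divide_0[OF tendsto_const] filterlim_at_top_imp_at_infinity filterlim_iter_ln)

text \<open>This excludes the value minus infinity, so that an order below infinity is a nonnegative
  real. For constant g the iterated logarithm is a fixed number, possibly negative, and the quotient
  tends to 0.\<close>

lemma entire_order_nonneg:
  assumes g: "g holomorphic_on UNIV"
  shows "entire_order g m n \<ge> 0"
proof (cases "g constant_on UNIV")
  case True
  then obtain c where c: "g = (\<lambda>_. c)" by (auto simp: constant_on_def)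
  have "eventually (\<lambda>r. ereal ((ln ^^ m) (norm c) / (ln ^^ n) r) = ereal ((ln ^^ m) (max_modulus g r) / (ln ^^ n) r)) at_top"
    using eventually_gt_at_top[of 0] by eventually_elim (simp add: c max_modulus_const)
  moreover have "((\<lambda>r. ereal ((ln ^^ m) (norm c) / (ln ^^ n) r)) \<longlongrightarrow> ereal 0) at_top"
    using tendsto_const_over_iter_ln by (intro tendsto_ereal)
  ultimately have "((\<lambda>r. ereal ((ln ^^ m) (max_modulus g r) / (ln ^^ n) r)) \<longlongrightarrow> ereal 0) at_top"
    by (rule Lim_transform_eventually[rotated])
  then have "entire_order g m n = ereal 0" unfolding entire_order_def
    by (intro lim_imp_Limsup) simp_all
  then show ?thesis by simp
next
  case False
  have "eventually (\<lambda>r. (ln ^^ m) (max_modulus g r) > 0) at_top"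
    by (rule eventually_gt_of_filterlim[OF filterlim_compose[OF filterlim_iter_ln max_modulus_at_top[OF g False]]])
  moreover have "eventually (\<lambda>r::real. (ln ^^ n) r > 0) at_top"
    by (rule eventually_gt_of_filterlim[OF filterlim_iter_ln[of n]])
  ultimately have "eventually (\<lambda>r. 0 \<le> ereal ((ln ^^ m) (max_modulus g r) / (ln ^^ n) r)) at_top"
    by eventually_elim simp
  then show ?thesis unfolding entire_order_def by (intro le_Limsup) simp_all
qed

lemma meromorphic_growth_bounds:
  assumes tr: "transcendental_meromorphic f"
    and lo: "0 < meromorphic_lower_order f p q"
    and le: "meromorphic_lower_order f p q \<le> meromorphic_order f p q"
    and up: "meromorphic_order f p q < \<infinity>"
  obtains l b where "meromorphic_lower_order f p q = ereal l" "l > 0" "b > 0"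
    "\<And>l'. l' < l \<Longrightarrow> eventually (\<lambda>r. l' * (ln ^^ q) r \<le> (ln ^^ (p - 1)) (nevanlinna_char f r)) at_top"
    "eventually (\<lambda>r. (ln ^^ (p - 1)) (nevanlinna_char f r) \<le> b * (ln ^^ q) r) at_top"
proof -
  obtain l where l: "meromorphic_lower_order f p q = ereal l"
    using lo le up by (cases "meromorphic_lower_order f p q") auto
  have l0: "l > 0" using lo l by simp
  obtain b0 where b0: "meromorphic_order f p q = ereal b0"
    using lo le up by (cases "meromorphic_order f p q") auto
  define b where "b = b0 + 1"
  have b: "b > 0" using le l0 unfolding l b0 b_def by simp
  have pos: "eventually (\<lambda>r::real. (ln ^^ q) r > 0) at_top"
    by (rule eventually_gt_of_filterlim[OF filterlim_iter_ln[of q]])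
  have "eventually (\<lambda>r. l' * (ln ^^ q) r \<le> (ln ^^ (p - 1)) (nevanlinna_char f r)) at_top" if "l' < l" for l'
  proof -
    have "ereal l' < meromorphic_lower_order f p q" using that l by simp
    then have "eventually (\<lambda>r. ereal l' < ereal ((ln ^^ (p - 1)) (nevanlinna_char f r) / (ln ^^ q) r)) at_top"
      unfolding meromorphic_lower_order_def by (rule less_LiminfD)
    with pos show ?thesis by eventually_elim (simp add: less_divide_eq)
  qed
  moreover have "eventually (\<lambda>r. (ln ^^ (p - 1)) (nevanlinna_char f r) \<le> b * (ln ^^ q) r) at_top"
  proof -
    have "meromorphic_order f p q < ereal b" by (simp add: b0 b_def)
    then have "eventually (\<lambda>r. ereal ((ln ^^ (p - 1)) (nevanlinna_char f r) / (ln ^^ q) r) < ereal b) at_top"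
      unfolding meromorphic_order_def by (rule Limsup_lessD)
    with pos show ?thesis by eventually_elim (simp add: divide_less_eq)
  qed
  ultimately show ?thesis using that[OF l l0 b] by blast
qed

lemma transcendental_nonzero:
  assumes "transcendental_meromorphic f"
  shows "nonzero_meromorphic f" "\<And>c. \<not> (\<forall>\<^sub>\<approx>z. f z = c)"
proof -
  show nc: "\<not> (\<forall>\<^sub>\<approx>z. f z = c)" for c
  proof
    assume "\<forall>\<^sub>\<approx>z. f z = c"
    then have "\<forall>\<^sub>\<approx>z. f z = poly [:c:] z / poly 1 z" by simp
    then have "rational_function f" unfolding rational_function_def by (metis one_neq_zero)
    then show False using assms by (simp add: transcendental_meromorphic_def)
  qed
  show "nonzero_meromorphic f"
    using not_nonzero_meromorphic[of f] nc[of 0] assms by (auto simp: transcendental_meromorphic_def)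
qed

text \<open>Serves the two degenerate cases: a numerator that is eventually constant over an
  unbounded denominator, and a quotient that is eventually 0 through division by 0.\<close>

lemma Limsup_ratio_eq_0:
  fixes u v :: "real \<Rightarrow> real"
  assumes "eventually (\<lambda>r. u r / v r = c * inverse (v r)) at_top" "filterlim v at_top at_top \<or> c = 0"
  shows "Limsup at_top (\<lambda>r. ereal (u r / v r)) = 0"
proof -
  have "((\<lambda>r. c * inverse (v r)) \<longlongrightarrow> 0) at_top"
    using assms(2)
  proof
    assume "filterlim v at_top at_top"
    then have "((\<lambda>r. c * inverse (v r)) \<longlongrightarrow> c * 0) at_top"
      by (intro tendsto_mult tendsto_const tendsto_inverse_0_at_top)
    then show ?thesis by simp
  qed simp
  then have "((\<lambda>r. ereal (c * inverse (v r))) \<longlongrightarrow> ereal 0) at_top" by (rule tendsto_ereal)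
  moreover have "eventually (\<lambda>r. ereal (c * inverse (v r)) = ereal (u r / v r)) at_top"
    using assms(1) by eventually_elim simp
  ultimately have "((\<lambda>r. ereal (u r / v r)) \<longlongrightarrow> ereal 0) at_top" by (rule Lim_transform_eventually)
  then have "Limsup at_top (\<lambda>r. ereal (u r / v r)) = ereal 0" by (intro lim_imp_Limsup) simp_all
  then show ?thesis by simp
qed

lemma Limsup_ratio_le:
  fixes u v :: "real \<Rightarrow> real"
  assumes \<gamma>: "\<gamma> \<ge> 0" and l: "l > 0"
    and u: "\<And>\<gamma>'. \<gamma>' > \<gamma> \<Longrightarrow> eventually (\<lambda>r. u r \<le> \<gamma>' * ln r) at_top"
    and v: "\<And>l'. 0 < l' \<Longrightarrow> l' < l \<Longrightarrow> eventually (\<lambda>r. l' * ln r \<le> v r) at_top"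
  shows "Limsup at_top (\<lambda>r. ereal (u r / v r)) \<le> ereal (\<gamma> / l)"
proof (rule dense_ge)
  fix x assume x: "ereal (\<gamma> / l) < x"
  show "Limsup at_top (\<lambda>r. ereal (u r / v r)) \<le> x"
  proof (cases x)
    case (real y)
    then have y: "\<gamma> / l < y" using x by simp
    moreover have "\<gamma> / l \<ge> 0" using \<gamma> l by simp
    ultimately have y0: "y > 0" by linarith
    have "\<gamma> / y < l" using y y0 l by (simp add: divide_less_eq mult.commute)
    \<comment> \<open>Since gamma / l < y, there is room for an l' below l with gamma < y l'; the
      product y l' then serves as the constant in the bound for u.\<close>
    then obtain l' where l': "\<gamma> / y < l'" "l' < l" using dense by blast
    have "\<gamma> / y \<ge> 0" using \<gamma> y0 by simp
    then have l'0: "l' > 0" using l' by linarith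
    have "\<gamma> < y * l'" using l' y0 by (simp add: divide_less_eq mult.commute)
    have "eventually (\<lambda>r. ereal (u r / v r) \<le> x) at_top"
      using u[OF \<open>\<gamma> < y * l'\<close>] v[OF l'0 l'(2)] eventually_gt_at_top[of 1]
    proof eventually_elim
      case (elim r)
      have "0 < l' * ln r" using l'0 elim by simp
      then have v0: "v r > 0" using elim by linarith
      have "y * (l' * ln r) \<le> y * v r" using y0 elim by (intro mult_left_mono) auto
      then have "u r \<le> y * v r" using elim by simp
      then show ?case using v0 real by (simp add: divide_le_eq)
    qed
    then show ?thesis by (rule Limsup_bounded)
  qed (use x in auto)
qed

text \<open>Applying p logarithms to the characteristic of f o g leads to log^[q+1] M_g + O(1). The
  parameter d counts further logarithms, so that log^[d+q+1] M_g is reached, and m <= d + q + 1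
  allows a comparison with log^[m] M_g.\<close>

lemma Limsup_ratio_composition:
  fixes f g Q F :: "complex \<Rightarrow> complex" and p q m n s d \<alpha> :: nat
  assumes tr: "transcendental_meromorphic f"
    and g: "g holomorphic_on UNIV"
    and pq: "p \<ge> 1" "q \<ge> 1" "n \<ge> 1" "p \<ge> q"
    and lo: "0 < meromorphic_lower_order f p q"
    and le: "meromorphic_lower_order f p q \<le> meromorphic_order f p q"
    and up: "meromorphic_order f p q < \<infinity>"
    and gfin: "entire_order g m n < \<infinity>"
    and Q: "differential_polynomial_in f Q"
    and \<alpha>: "\<alpha> \<ge> 1"
    and F: "F = (\<lambda>z. f z ^ \<alpha> * Q z)"
    and sd: "s = d + p" "m \<le> d + (q + 1)"
  shows "Limsup at_top (\<lambda>r. ereal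
              ((ln ^^ s) (nevanlinna_char (f \<circ> g) ((exp ^^ (n - 1)) r)) /
               (ln ^^ (p - 1)) (nevanlinna_char F ((exp ^^ (q - 1)) r))))
            \<le> entire_order g m n / meromorphic_lower_order f p q"
proof -
  obtain l b where lb: "meromorphic_lower_order f p q = ereal l" "l > 0" "b > 0"
    "\<And>l'. l' < l \<Longrightarrow> eventually (\<lambda>r. l' * (ln ^^ q) r \<le> (ln ^^ (p - 1)) (nevanlinna_char f r)) at_top"
    "eventually (\<lambda>r. (ln ^^ (p - 1)) (nevanlinna_char f r) \<le> b * (ln ^^ q) r) at_top"
    using meromorphic_growth_bounds[OF tr lo le up] by blast
  obtain \<gamma> where \<gamma>: "entire_order g m n = ereal \<gamma>" "\<gamma> \<ge> 0"
    using entire_order_nonneg[OF g, of m n] gfin by (cases "entire_order g m n") auto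
  have rhs: "entire_order g m n / meromorphic_lower_order f p q = ereal (\<gamma> / l)"
    using lb(2) by (simp add: \<gamma> lb(1))
  have rhs0: "0 \<le> ereal (\<gamma> / l)" using \<gamma>(2) lb(2) by simp
  have f: "nonzero_meromorphic f" by (rule transcendental_nonzero(1)[OF tr])
  have mf: "f meromorphic_on UNIV" using f by (simp add: nonzero_meromorphic_def)
  have Tlim: "filterlim (nevanlinna_char f) at_top at_top"
    by (rule nevanlinna_char_at_top[OF mf transcendental_nonzero(2)[OF tr]])
  have p2: "p \<noteq> 1"
  proof
    assume "p = 1"
    \<comment> \<open>Then q = 1 too, and the finite order would give T_f(r) <= b ln r
      eventually.\<close>
    then have pq1: "p = 1" "q = 1" using pq by auto
    have "eventually (\<lambda>r. b + 1 \<le> nevanlinna_char f r / ln r) at_top"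
      by (rule eventually_ge_of_filterlim[OF transcendental_growth[OF tr]])
    moreover have "eventually (\<lambda>r. nevanlinna_char f r \<le> b * ln r) at_top" using lb(5) by (simp add: pq1)
    ultimately have "eventually (\<lambda>r::real. False) at_top" using eventually_gt_at_top[of 1]
    proof eventually_elim
      case (elim r)
      then have "(b + 1) * ln r \<le> nevanlinna_char f r" by (simp add: le_divide_eq)
      with elim have "(b + 1) * ln r \<le> b * ln r" by linarith
      then show ?case using elim by (simp add: ring_distribs)
    qed
    then show False by simp
  qed
  obtain j where j: "p = Suc (Suc j)" using p2 pq(1) by (metis One_nat_def Suc_pred less_eq_Suc_le not0_implies_Suc)
  obtain k where k: "q = Suc k" using pq(2) by (cases q) auto
  obtain i where i: "n = Suc i" using pq(3) by (cases n) auto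
  have up': "eventually (\<lambda>r. (ln ^^ Suc j) (nevanlinna_char f r) \<le> b * (ln ^^ Suc k) r) at_top"
    using lb(5) by (simp add: j k del: funpow.simps)
  have lo': "eventually (\<lambda>r. l' * (ln ^^ Suc k) r \<le> (ln ^^ Suc j) (nevanlinna_char f r)) at_top" if "l' < l" for l'
    using lb(4)[OF that] by (simp add: j k del: funpow.simps)
  let ?v = "\<lambda>r. (ln ^^ (p - 1)) (nevanlinna_char F ((exp ^^ (q - 1)) r))"
  let ?u = "\<lambda>r. (ln ^^ s) (nevanlinna_char (f \<circ> g) ((exp ^^ (n - 1)) r))"
  have epos: "eventually (\<lambda>r::real. (exp ^^ i) r > 0) at_top" for i
    by (rule eventually_gt_of_filterlim[OF filterlim_iter_exp[of i]])
  show ?thesis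
  proof (cases "\<forall>\<^sub>\<approx>z. F z = 0")
    case True
    \<comment> \<open>Here T_F vanishes for positive radii. Since ln 0 = 0, the denominator is 0,
      and the quotient is 0 by convention.\<close>
    have z: "(ln ^^ i) 0 = (0::real)" for i by (induction i) auto
    have "eventually (\<lambda>r. ?u r / ?v r = 0 * inverse (?v r)) at_top"
      using epos[of "q - 1"]
    proof eventually_elim
      case (elim r)
      have "nevanlinna_char F ((exp ^^ (q - 1)) r) = 0"
        using nevanlinna_char_cong[OF True elim] by (simp add: nevanlinna_char_const log_plus_def)
      then show ?case by (simp add: z)
    qed
    then have "Limsup at_top (\<lambda>r. ereal (?u r / ?v r)) = 0" by (rule Limsup_ratio_eq_0) simp
    then show ?thesis using rhs0 unfolding rhs by simp
  next
    case False
    obtain K where K: "K \<ge> 1" "\<And>r. r \<ge> 1 \<Longrightarrow> nevanlinna_char f r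
       \<le> 9 * nevanlinna_char F (8 * r) + K + K * ln (nevanlinna_char f (32 * r) + K)"
      using nevanlinna_char_le_of_diff_poly[OF f Q \<alpha>] False unfolding F by blast
    \<comment> \<open>With 4 K the two error terms take at most T_f / 4 each. The remaining T_f / 2
      is at most 9 T_F(8 r), whence 18.\<close>
    have "eventually (\<lambda>r. (4 * K) * ln (nevanlinna_char f (32 * r) + K) \<le> nevanlinna_char f r) at_top"
      using K(1) lb(2)
      by (intro log_of_dilation_negligible[OF Tlim lo'[of "l / 2"] _ up' lb(3)]) auto
    moreover have "eventually (\<lambda>r. 4 * K \<le> nevanlinna_char f r) at_top"
      by (rule eventually_ge_of_filterlim[OF Tlim])
    ultimately have TF: "eventually (\<lambda>r. nevanlinna_char f r \<le> 18 * nevanlinna_char F (8 * r)) at_top"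
      using eventually_ge_at_top[of 1]
    proof eventually_elim
      case (elim r)
      then show ?case using K(2)[of r] by simp
    qed
    have vlow: "eventually (\<lambda>r. l' * ln r \<le> ?v r) at_top" if "0 < l'" "l' < l" for l'
    proof -
      obtain l'' where l'': "l' < l''" "l'' < l" using dense \<open>l' < l\<close> by blast
      have "eventually (\<lambda>r. l' * (ln ^^ Suc k) r \<le> (ln ^^ Suc j) (nevanlinna_char F r)) at_top"
        using that l'' by (intro iter_ln_lower_bound_transfer[OF Tlim lo'[of l''] _ _ TF]) auto
      \<comment> \<open>Substituting exp^[q-1] r reduces ln^[q] to a single ln r. The same happens
        with n in the numerator, and this makes the two sides comparable.\<close>
      from eventually_compose_filterlim[OF this filterlim_iter_exp[of k]]
      show ?thesis by (simp add: j k iter_ln_iter_exp)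
    qed
    show ?thesis
    proof (cases "\<exists>c. \<forall>\<^sub>\<approx>z. (f \<circ> g) z = c")
      \<comment> \<open>This covers constant g, for which the maximum modulus does not grow.\<close>
      case True
      then obtain c where c: "\<forall>\<^sub>\<approx>z. (f \<circ> g) z = c" by blast
      have vlim: "filterlim ?v at_top at_top"
      proof (rule filterlim_at_top_mono)
        show "filterlim (\<lambda>r. l / 2 * ln r) at_top at_top"
          using lb(2) by (intro filterlim_tendsto_pos_mult_at_top[OF tendsto_const _ ln_at_top]) auto
        show "eventually (\<lambda>r. l / 2 * ln r \<le> ?v r) at_top" using lb(2) by (intro vlow) auto
      qed
      have "eventually (\<lambda>r. ?u r / ?v r = (ln ^^ s) (log_plus (norm c)) * inverse (?v r)) at_top"
        using epos[of "n - 1"]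
      proof eventually_elim
        case (elim r)
        have "nevanlinna_char (f \<circ> g) ((exp ^^ (n - 1)) r) = log_plus (norm c)"
          using nevanlinna_char_cong[OF c elim] unfolding nevanlinna_char_const .
        then show ?case by (simp add: divide_inverse)
      qed
      then have "Limsup at_top (\<lambda>r. ereal (?u r / ?v r)) = 0" by (rule Limsup_ratio_eq_0) (rule disjI1[OF vlim])
      then show ?thesis using rhs0 unfolding rhs by simp
    next
      case nconst: False
      have gnc: "\<not> g constant_on UNIV"
      proof
        assume "g constant_on UNIV"
        then obtain c where "\<And>z. g z = c" by (auto simp: constant_on_def)
        then have "\<forall>\<^sub>\<approx>z. (f \<circ> g) z = f c" by simp
        then show False using nconst by blast
      qed
      let ?M = "max_modulus g"
      have M: "filterlim ?M at_top at_top" by (rule max_modulus_at_top[OF g gnc])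
      have Ulim: "filterlim (nevanlinna_char (f \<circ> g)) at_top at_top"
        using nconst by (intro nevanlinna_char_at_top meromorphic_compose_entire mf g) blast
      obtain C where C: "C \<ge> 0" "eventually (\<lambda>r. (ln ^^ Suc (Suc j)) (nevanlinna_char (f \<circ> g) r) \<le> (ln ^^ Suc (Suc k)) (?M r) + C) at_top"
        using iter_ln_upper_bound_compose[OF Ulim M up' lb(3)
            nevanlinna_char_compose_eventually_le[OF f g gnc]] by auto
      have MS: "filterlim (\<lambda>r. (ln ^^ Suc (Suc k)) (?M r)) at_top at_top"
        by (rule filterlim_compose[OF filterlim_iter_ln M])
      have U1: "eventually (\<lambda>r. (ln ^^ s) (nevanlinna_char (f \<circ> g) r) \<le> (ln ^^ m) (?M r) + C) at_top"
      proof -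
        have "filterlim (\<lambda>r. (ln ^^ Suc (Suc j)) (nevanlinna_char (f \<circ> g) r)) at_top at_top"
          by (rule filterlim_compose[OF filterlim_iter_ln Ulim])
        then have 1: "eventually (\<lambda>r. (exp ^^ d) 0 < (ln ^^ Suc (Suc j)) (nevanlinna_char (f \<circ> g) r)) at_top"
          unfolding filterlim_at_top_dense by blast
        have 2: "eventually (\<lambda>r. (ln ^^ d) ((ln ^^ Suc (Suc k)) (?M r) + C) \<le> (ln ^^ d) ((ln ^^ Suc (Suc k)) (?M r)) + C) at_top"
          by (rule eventually_compose_filterlim[OF eventually_iter_ln_add_le[OF C(1)] MS])
        \<comment> \<open>The number of surplus logarithms beyond m. They are dropped by ln^[e] x <=
          x for large x.\<close>
        define e where "e = d + (q + 1) - m"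
        have em: "d + Suc (Suc k) = e + m" using sd(2) by (simp add: e_def k)
        have 3: "eventually (\<lambda>r. (ln ^^ e) ((ln ^^ m) (?M r)) \<le> (ln ^^ m) (?M r)) at_top"
          by (rule eventually_compose_filterlim[OF eventually_iter_ln_le_self filterlim_compose[OF filterlim_iter_ln M]])
        from 1 2 3 C(2) show ?thesis
        proof eventually_elim
          case (elim r)
          have "(ln ^^ s) (nevanlinna_char (f \<circ> g) r) = (ln ^^ d) ((ln ^^ Suc (Suc j)) (nevanlinna_char (f \<circ> g) r))"
            unfolding sd(1) j funpow_add by simp
          also have "\<dots> \<le> (ln ^^ d) ((ln ^^ Suc (Suc k)) (?M r) + C)" using elim(1,4) by (rule iter_ln_mono)
          also have "\<dots> \<le> (ln ^^ d) ((ln ^^ Suc (Suc k)) (?M r)) + C" by (rule elim(2))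
          also have "(ln ^^ d) ((ln ^^ Suc (Suc k)) (?M r)) = (ln ^^ (d + Suc (Suc k))) (?M r)"
            unfolding funpow_add by simp
          also have "\<dots> = (ln ^^ e) ((ln ^^ m) (?M r))" unfolding em funpow_add by simp
          also have "\<dots> \<le> (ln ^^ m) (?M r)" by (rule elim(3))
          finally show ?case by (simp add: comp_def)
        qed
      qed
      have "eventually (\<lambda>r. ?u r \<le> \<gamma>' * ln r) at_top" if "\<gamma>' > \<gamma>" for \<gamma>'
      proof -
        \<comment> \<open>The gap between h and \<open>\<gamma>'\<close> absorbs the additive
          constant C.\<close>
        obtain h where h: "\<gamma> < h" "h < \<gamma>'" using dense \<open>\<gamma>' > \<gamma>\<close> by blast
        have "entire_order g m n < ereal h" using h \<gamma> by simp
        then have e1: "eventually (\<lambda>r. ereal ((ln ^^ m) (?M r) / (ln ^^ n) r) < ereal h) at_top"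
          unfolding entire_order_def by (rule Limsup_lessD)
        have e2: "eventually (\<lambda>r::real. (ln ^^ n) r > 0) at_top"
          by (rule eventually_gt_of_filterlim[OF filterlim_iter_ln[of n]])
        have e3: "eventually (\<lambda>r::real. (ln ^^ n) r \<ge> C / (\<gamma>' - h)) at_top"
          by (rule eventually_ge_of_filterlim[OF filterlim_iter_ln[of n]])
        from U1 e1 e2 e3 have "eventually (\<lambda>r. (ln ^^ s) (nevanlinna_char (f \<circ> g) r) \<le> \<gamma>' * (ln ^^ n) r) at_top"
        proof eventually_elim
          case (elim r)
          have "(ln ^^ m) (?M r) < h * (ln ^^ n) r" using elim(2,3) by (simp add: divide_less_eq)
          moreover have "C \<le> (\<gamma>' - h) * (ln ^^ n) r" using elim(4) h by (simp add: divide_le_eq mult.commute)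
          ultimately show ?case using elim(1) by (simp add: left_diff_distrib)
        qed
        from eventually_compose_filterlim[OF this filterlim_iter_exp[of i]]
        show ?thesis by (simp add: i iter_ln_iter_exp)
      qed
      then show ?thesis unfolding rhs by (intro Limsup_ratio_le \<gamma>(2) lb(2) vlow)
    qed
  qed
qed

theorem theorem4:
  fixes f g Q F :: "complex \<Rightarrow> complex" and p q m n \<alpha> :: nat
  assumes "transcendental_meromorphic f"
    and "g holomorphic_on UNIV"
    and "p \<ge> 1" "q \<ge> 1" "m \<ge> 1" "n \<ge> 1"
    and "p \<ge> q" "m \<ge> n"
    and "0 < meromorphic_lower_order f p q"
    and "meromorphic_lower_order f p q \<le> meromorphic_order f p q"
    and "meromorphic_order f p q < \<infinity>"
    and "entire_order g m n < \<infinity>"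
    and "differential_polynomial_in f Q"
    and "\<alpha> \<ge> 1"
    and "F = (\<lambda>z. f z ^ \<alpha> * Q z)"
  shows "(q \<ge> m \<longrightarrow>
            Limsup at_top (\<lambda>r. ereal
              ((ln ^^ p) (nevanlinna_char (f \<circ> g) ((exp ^^ (n - 1)) r)) /
               (ln ^^ (p - 1)) (nevanlinna_char F ((exp ^^ (q - 1)) r))))
            \<le> entire_order g m n / meromorphic_lower_order f p q)
       \<and> (q < m \<longrightarrow>
            Limsup at_top (\<lambda>r. ereal
              ((ln ^^ (p + m - q - 1)) (nevanlinna_char (f \<circ> g) ((exp ^^ (n - 1)) r)) /
               (ln ^^ (p - 1)) (nevanlinna_char F ((exp ^^ (q - 1)) r))))
            \<le> entire_order g m n / meromorphic_lower_order f p q)"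
proof (intro conjI impI)
  note main = Limsup_ratio_composition[OF assms(1-4,6,7,9-15)]
  show "Limsup at_top (\<lambda>r. ereal
              ((ln ^^ p) (nevanlinna_char (f \<circ> g) ((exp ^^ (n - 1)) r)) /
               (ln ^^ (p - 1)) (nevanlinna_char F ((exp ^^ (q - 1)) r))))
            \<le> entire_order g m n / meromorphic_lower_order f p q" if "q \<ge> m"
    \<comment> \<open>Here log^[q+1] M_g is already at least m logarithms deep, as m <= q.\<close>
    by (rule main[where d = 0]) (use that in auto)
  show "Limsup at_top (\<lambda>r. ereal
              ((ln ^^ (p + m - q - 1)) (nevanlinna_char (f \<circ> g) ((exp ^^ (n - 1)) r)) /
               (ln ^^ (p - 1)) (nevanlinna_char F ((exp ^^ (q - 1)) r))))
            \<le> entire_order g m n / meromorphic_lower_order f p q" if "q < m"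
    \<comment> \<open>With this d one has d + q + 1 = m, so log^[m] M_g is reached exactly, and d +
      p = p + m - q - 1.\<close>
    by (rule main[where d = "m - q - 1"]) (use that in auto)
qed

end
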